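(* Let $A\in\mathbb{Z}^{m\times n}$ with $m\ge n$ and $\operatorname{rank}(A)=n$. Suppose that at least one of the following conditions is satisfied: (1) $m\le n+1$; (2) there is an integer $k\ge 1$ such that all $n\times n$ minors of $A$ are contained in $\{0,\pm k,\pm 2k\}$. Then (SHC) holds for $C(A)$, i.e. every Hilbert basis element $h$ of $C(A)$ with respect to $\mathbb{Z}^n$ satisfies $h\in\operatorname{conv}\{0,r^1,\dots,r^t\}$, where $R(A)=\{r^1,\dots,r^t\}$ is the set of normalized generators of $C(A)$.
   Context: Notation: $[m]=\{1,\dots,m\}$; $A_{I,\cdot}$ is the submatrix of $A$ with rows indexed by $I$, and $A_{I,J}$ the submatrix with rows in $I$ and columns in $J$. For an integer matrix $M$ with at least as many rows as columns, say $q$ columns, $\gcd(M)$ is the greatest common divisor of all $q\times q$ minors of $M$, and $\gcd(M^T):=\gcd(M)$; so for an $(n-1)\times n$ matrix it is the gcd of its $(n-1)\times(n-1)$ minors. For $A\in\mathbb{Z}^{m\times n}$ with $m\ge n$ and full column rank, $C(A):=\{x\in\mathbb{R}^n: Ax\ge 0\}$. This cone is rational and pointed. An extreme ray is a 1-dimensional face. Hilbert basis: for a lattice $\Lambda$, a nonzero $h\in C(A)\cap\Lambda$ is a Hilbert basis element of $C(A)$ with respect to $\Lambda$ if for all $z^1,z^2\in C(A)\cap\Lambda$ with $h=z^1+z^2$ we have $z^1=0$ or $z^2=0$. Normalized generators: for each extreme ray of $C(A)$, consider all $I\subseteq[m]$ with $|I|=n-1$, $\operatorname{rank}(A_{I,\cdot})=n-1$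 and $A_{I,\cdot}r=0$ for $r$ on the ray; choose such an $I$ with $\gcd(A_{I,\cdot})$ maximal. The normalized generator of the ray is the vector $r$ on the ray with $r_i=(-1)^i\det A_{I,[n]\setminus\{i\}}$ for $i=1,\dots,n$, up to a global sign chosen so that $r\in C(A)$ (equivalently, $\gcd(A_{I,\cdot})$ times the primitive integer vector on the ray). $R(A)$ is the set of normalized generators of $C(A)$. *)

theory Defs
  imports
    "Jordan_Normal_Form.DL_Submatrix"
    "Jordan_Normal_Form.DL_Rank"
    Complex_Main
begin

text \<open>
  Integer matrices and real vectors are those of Jordan_Normal_Form, so indices start at 0;
  the set \<open>[m]\<close> becomes \<open>{..<m}\<close>. Points of the ambient space are real vectors.
\<close>

abbreviation real_mat :: "int mat \<Rightarrow> real mat" where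
  "real_mat \<equiv> map_mat real_of_int"

abbreviation real_vec :: "int vec \<Rightarrow> real vec" where
  "real_vec \<equiv> map_vec real_of_int"

definition minors :: "int mat \<Rightarrow> nat \<Rightarrow> int set" where
  "minors M q = {det (submatrix M I J) | I J.
     I \<subseteq> {..<dim_row M} \<and> card I = q \<and> J \<subseteq> {..<dim_col M} \<and> card J = q}"

text \<open>The minimum covers both the tall case and the convention \<open>gcd(M\<^sup>T) = gcd(M)\<close>.\<close>

definition gcd_mat :: "int mat \<Rightarrow> int" where
  "gcd_mat M = Gcd (minors M (min (dim_row M) (dim_col M)))"

definition polyhedral_cone :: "int mat \<Rightarrow> real vec set" where
  "polyhedral_cone A = {x \<in> carrier_vec (dim_col A). 0\<^sub>v (dim_row A) \<le> real_mat A *\<^sub>v x}"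

definition integer_lattice :: "nat \<Rightarrow> real vec set" where
  "integer_lattice n = real_vec ` carrier_vec n"

definition hilbert_basis_element :: "int mat \<Rightarrow> real vec set \<Rightarrow> real vec \<Rightarrow> bool" where
  "hilbert_basis_element A \<Lambda> h \<longleftrightarrow>
     h \<in> polyhedral_cone A \<inter> \<Lambda> \<and> h \<noteq> 0\<^sub>v (dim_col A) \<and>
     (\<forall>z1 \<in> polyhedral_cone A \<inter> \<Lambda>. \<forall>z2 \<in> polyhedral_cone A \<inter> \<Lambda>.
        h = z1 + z2 \<longrightarrow> z1 = 0\<^sub>v (dim_col A) \<or> z2 = 0\<^sub>v (dim_col A))"

text \<open>Faces of a polyhedron, cut out by valid inequalities (the polyhedron itself included).\<close>

definition face :: "nat \<Rightarrow> real vec set \<Rightarrow> real vec set \<Rightarrow> bool" where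
  "face n C F \<longleftrightarrow>
     (\<exists>c \<in> carrier_vec n. \<exists>\<delta>. (\<forall>x \<in> C. \<delta> \<le> c \<bullet> x) \<and> F = {x \<in> C. c \<bullet> x = \<delta>})"

text \<open>
  The dimension of the affine hull, as the dimension of the direction space spanned by all
  differences. The empty set gets the value 0 instead of \<open>-1\<close>, which is irrelevant below,
  where only dimension 1 is asked for.
\<close>

definition (in vec_space) affine_dim :: "'a vec set \<Rightarrow> nat" where
  "affine_dim F = vectorspace.dim class_ring (span_vs {x - y | x y. x \<in> F \<and> y \<in> F})"

definition extreme_ray :: "int mat \<Rightarrow> real vec set \<Rightarrow> bool" where
  "extreme_ray A F \<longleftrightarrow> face (dim_col A) (polyhedral_cone A) F \<and> vec_space.affine_dim (dim_col A) F = 1"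

definition ray_index_sets :: "int mat \<Rightarrow> real vec set \<Rightarrow> nat set set" where
  "ray_index_sets A F = {I. I \<subseteq> {..<dim_row A} \<and> card I = dim_col A - 1 \<and>
     vec_space.rank (dim_col A - 1) (real_mat (submatrix A I UNIV)) = dim_col A - 1 \<and>
     (\<forall>x \<in> F. real_mat (submatrix A I UNIV) *\<^sub>v x = 0\<^sub>v (dim_col A - 1))}"

text \<open>
  Counting the columns from 0 only changes the global sign of this vector.
\<close>

definition minor_vec :: "int mat \<Rightarrow> nat set \<Rightarrow> int vec" where
  "minor_vec A I = vec (dim_col A) (\<lambda>i. (- 1) ^ i * det (submatrix A I ({..<dim_col A} - {i})))"

text \<open>
  The two signs of \<open>minor_vec\<close> are disambiguated by \<open>r \<in> F\<close>, since \<open>F\<close> lies in the cone.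
\<close>

definition normalized_generators :: "int mat \<Rightarrow> real vec set" where
  "normalized_generators A = {r. \<exists>F I. extreme_ray A F \<and> r \<in> F \<and>
     I \<in> ray_index_sets A F \<and>
     (\<forall>I' \<in> ray_index_sets A F.
        gcd_mat (submatrix A I' UNIV) \<le> gcd_mat (submatrix A I UNIV)) \<and>
     (r = real_vec (minor_vec A I) \<or> r = - real_vec (minor_vec A I))}"

definition conv :: "nat \<Rightarrow> real vec set \<Rightarrow> real vec set" where
  "conv n S = {vec n (\<lambda>j. \<Sum>x\<in>T. a x * x $ j) | T a.
     finite T \<and> T \<subseteq> S \<and> (\<forall>x \<in> T. 0 \<le> a x) \<and> sum a T = 1}"

definition SHC :: "int mat \<Rightarrow> bool" where
  "SHC A \<longleftrightarrow> (\<forall>h. hilbert_basis_element A (integer_lattice (dim_col A)) h \<longrightarrow>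
     h \<in> conv (dim_col A) (insert (0\<^sub>v (dim_col A)) (normalized_generators A)))"

end

theory Submission
  imports Defs "Jordan_Normal_Form.DL_Rank_Submatrix"
begin

text \<open>For an integral point \<open>h\<close> of the cone of \<open>A\<close>, let \<open>y = A h\<close> be its vector of slacks. The extreme rays
are described by cross products \<open>c\<close> of \<open>n - 1\<close> rows: the slacks of \<open>c\<close> are, up to sign, \<open>n \<times> n\<close> minors of
\<open>A\<close>. Such a vector, if it lies in the cone, is called a ray vector here. Normalized generators are the
longest ray vectors on their rays, because the gcd of the minors of \<open>n - 1\<close> rows is the factor by which
their cross product exceeds the primitive vector. Hence ray vectors lie in the hull of \<open>0\<close> and the
normalized generators (\<open>ray_vector_in_normalized_hull\<close>), and it suffices to express an irreducible \<open>h\<close> by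
ray vectors with nonnegative weights of sum at most one. Irreducibility enters through the pigeonhole
principle: among more than \<open>\<bar>det B\<bar>\<close> integer vectors, two differ by an element of the lattice
\<open>B \<int>\<^sup>n\<close> (\<open>congruent_pair_exists\<close>).

\<^bold>\<open>At most one row more than columns.\<close> A zero row may be appended, so let there be \<open>n + 1\<close> rows, and let
\<open>d\<^sub>i\<close> be the signed minor that omits row \<open>i\<close>. Then \<open>\<Sum>i. d\<^sub>i y\<^sub>i = 0\<close>, and for \<open>i \<noteq> j\<close> with \<open>d\<^sub>i d\<^sub>j \<le> 0\<close>
and \<open>d\<^sub>j \<noteq> 0\<close> there is a ray vector \<open>c\<^sub>i\<^sub>j\<close> whose slacks are zero except for \<open>\<bar>d\<^sub>j\<bar>\<close> in row \<open>i\<close> and \<open>\<bar>d\<^sub>i\<bar>\<close> in row \<open>j\<close>. Let \<open>P\<close>, \<open>N\<close>, \<open>Z\<close> be the rows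
with positive, negative and zero \<open>d\<close>, let \<open>M\<close> be the sum of \<open>d\<^sub>i y\<^sub>i\<close> over \<open>P\<close>, and let \<open>j\<^sub>0\<close> maximize
\<open>D = \<bar>d\<^sub>j\<bar>\<close>. If \<open>M > 0\<close>, comparing slacks shows that \<open>h\<close> is the combination of the \<open>c\<^sub>i\<^sub>j\<close>, for \<open>i\<close> in \<open>P\<close> and \<open>j\<close> in \<open>N\<close>, with
weights \<open>y\<^sub>i y\<^sub>j / M\<close> and of the \<open>c\<^sub>i\<^sub>j\<close>, for \<open>i\<close> in \<open>Z\<close> and \<open>j = j\<^sub>0\<close>, with weights \<open>y\<^sub>i / D\<close>. If \<open>X\<close> and \<open>W\<close> are the
sums of \<open>y\<close> over \<open>P\<close> and over \<open>N \<union> Z\<close>, the total weight is at most one as soon as \<open>X W \<le> M\<close>, because \<open>M \<le> D X\<close>.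
For this inequality (\<open>positive_part_bound\<close>), let \<open>y\<^sup>+\<close> be the part of \<open>y\<close> supported on \<open>P\<close>, and
reach it and the remaining part \<open>y - y\<^sup>+\<close> from \<open>0\<close> by
unit steps. The lattice spanned by \<open>y\<^sup>+\<close> and the columns of \<open>A\<close> has index \<open>M\<close>; if \<open>X W > M\<close>, two of the
\<open>X W\<close> sums of a partial vector of either chain are congruent, and their difference produces a proper
part of \<open>y\<close> in \<open>A \<int>\<^sup>n\<close>, which splits \<open>h\<close>. If \<open>X = 0\<close>, then \<open>M = 0\<close>, so \<open>y\<close> is supported on \<open>Z\<close>, and the same argument
with one chain gives \<open>W \<le> D\<close> (\<open>zero_part_bound\<close>).

\<^bold>\<open>Minors in \<open>{0, \<plusminus> k, \<plusminus> 2 k}\<close>.\<close> In the coordinates of a nonsingular choice \<open>B\<close> of \<open>n\<close> rows with \<open>\<bar>det B\<bar>\<close>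
minimal, all minors become \<open>0\<close>, \<open>\<plusminus> 1\<close> or \<open>\<plusminus> 2\<close>, and \<open>\<int>\<^sup>n\<close> becomes the sublattice \<open>B \<int>\<^sup>n\<close> of index \<open>\<bar>det B\<bar>\<close>. The
point \<open>B h\<close> is a sum of irreducible integral points of the new cone, and of at most \<open>\<bar>det B\<bar>\<close> of
them, since otherwise a proper block of summands would lie in \<open>B \<int>\<^sup>n\<close>. So it suffices that for minors
bounded by two every irreducible \<open>h\<close> is half the sum of two vectors, each of them a ray vector or \<open>0\<close>
(\<open>bimodular_irreducible\<close>). Let \<open>r\<close> be a ray vector of the minimal face of \<open>h\<close>; its slacks are \<open>0\<close>, \<open>1\<close> or \<open>2\<close>.
Unless \<open>h\<close> is \<open>r\<close> or \<open>r / 2\<close>, the vector \<open>r\<close> is odd, that is, not divisible by two, and \<open>g = 2 h - r\<close> lies in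
the cone. Consider the larger cone cut
out by the rows that are even on \<open>r\<close>. Peeling its even ray vectors off \<open>g\<close> cannot end at \<open>0\<close>, as \<open>g\<close> is
odd, so an odd ray vector \<open>s\<close> turns up; it is congruent to \<open>r\<close> modulo two. Then \<open>(r + s) / 2\<close> and
\<open>h - (r + s) / 2\<close> are integral points of the original cone, whence \<open>2 h = r + s\<close>.\<close>

section \<open>Determinants as functions of their rows\<close>

definition det_rows :: "nat \<Rightarrow> 'a::comm_ring_1 vec list \<Rightarrow> 'a" where
  "det_rows n xs = det (mat_of_rows n xs)"

text \<open>The generalized cross product. The zero row on top only reserves the place of the row along which the
  cofactors are taken.\<close>

definition cross_vec :: "nat \<Rightarrow> 'a::comm_ring_1 vec list \<Rightarrow> 'a vec" where
  "cross_vec n qs = vec n (\<lambda>j. cofactor (mat_of_rows n (0\<^sub>v n # qs)) 0 j)"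

lemma cross_vec_carrier [simp]: "cross_vec n qs \<in> carrier_vec n"
  by (simp add: cross_vec_def)

lemma dim_cross_vec [simp]: "dim_vec (cross_vec n qs) = n"
  by (simp add: cross_vec_def)

text \<open>Laplace expansion along the first row; the cofactors of a row do not depend on that row.\<close>

lemma det_rows_Cons:
  assumes "length qs + 1 = n" and "a \<in> carrier_vec n"
  shows "det_rows n (a # qs) = a \<bullet> cross_vec n qs"
proof -
  have M: "mat_of_rows n (a # qs) \<in> carrier_mat n n"
    using assms by (auto simp: mat_of_rows_def)
  have "det_rows n (a # qs) = (\<Sum>j<n. mat_of_rows n (a # qs) $$ (0, j) * cofactor (mat_of_rows n (a # qs)) 0 j)"
    unfolding det_rows_def by (rule laplace_expansion_row[OF M]) (use assms in auto)
  also have "\<dots> = (\<Sum>j<n. a $ j * cross_vec n qs $ j)"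
  proof (rule sum.cong[OF refl])
    fix j assume "j \<in> {..<n}"
    hence j: "j < n" by simp
    have "mat_delete (mat_of_rows n (a # qs)) 0 j = mat_delete (mat_of_rows n (0\<^sub>v n # qs)) 0 j"
      by (auto simp: mat_delete_def mat_of_rows_def intro!: eq_matI)
    then show "mat_of_rows n (a # qs) $$ (0, j) * cofactor (mat_of_rows n (a # qs)) 0 j = a $ j * cross_vec n qs $ j"
      using j by (simp add: cross_vec_def cofactor_def mat_of_rows_index)
  qed
  also have "\<dots> = a \<bullet> cross_vec n qs"
    by (simp add: scalar_prod_def cross_vec_def atLeast0LessThan)
  finally show ?thesis .
qed

lemma cross_vec_component:
  assumes "length qs + 1 = n" "j < n"
  shows "cross_vec n qs $ j = det_rows n (unit_vec n j # qs)"
  using det_rows_Cons[OF assms(1), of "unit_vec n j"] assms(2) by simp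

lemma det_rows_swap:
  "det_rows n (us @ a # b # vs) = - det_rows n (us @ b # a # vs)"
proof (cases "length (us @ a # b # vs) = n")
  case True
  let ?M = "mat_of_rows n (us @ b # a # vs)"
  have M: "?M \<in> carrier_mat n n" using True by (auto simp: mat_of_rows_def)
  have "mat_of_rows n (us @ a # b # vs) = swaprows (length us) (Suc (length us)) ?M"
    by (rule eq_matI) (use True in \<open>auto simp: mat_of_rows_def nth_append nth_Cons' mat_swaprows_def\<close>)
  then show ?thesis
    unfolding det_rows_def using True by (simp add: det_swaprows[OF _ _ _ M])
qed (simp add: det_rows_def det_def)

lemma det_rows_move:
  "det_rows n (us @ vs @ a # ws) = (-1) ^ length vs * det_rows n (us @ a # vs @ ws)"
proof (induction vs arbitrary: us)
  case (Cons v vs)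
  have "det_rows n (us @ (v # vs) @ a # ws) = (-1) ^ length vs * det_rows n ((us @ [v]) @ a # vs @ ws)"
    using Cons[of "us @ [v]"] by simp
  also have "det_rows n ((us @ [v]) @ a # vs @ ws) = - det_rows n (us @ a # v # vs @ ws)"
    using det_rows_swap[of n us v a "vs @ ws"] by simp
  finally show ?case by simp
qed simp

text \<open>The sign \<open>\<sigma>\<close> is the same for all prefixes \<open>us\<close>; thus a permutation of the rows changes a whole cross
  product by one sign.\<close>

lemma det_rows_permute:
  assumes "mset xs = mset ys"
  obtains \<sigma> :: "'a::comm_ring_1" where "\<sigma> = 1 \<or> \<sigma> = - 1"
    and "\<And>us. det_rows n (us @ xs) = \<sigma> * det_rows n (us @ ys)"
proof -
  have "\<exists>\<sigma>::'a. (\<sigma> = 1 \<or> \<sigma> = - 1) \<and> (\<forall>us. det_rows n (us @ xs) = \<sigma> * det_rows n (us @ ys))"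
    using assms
  proof (induction xs arbitrary: ys)
    case Nil
    then show ?case by (intro exI[of _ 1]) simp
  next
    case (Cons x xs)
    then have "x \<in> set ys" by (metis list.set_intros(1) mset_eq_setD)
    then obtain y1 y2 where ys: "ys = y1 @ x # y2" by (meson split_list)
    with Cons.prems have "mset xs = mset (y1 @ y2)" by simp
    from Cons.IH[OF this] obtain \<sigma> :: 'a where s: "\<sigma> = 1 \<or> \<sigma> = - 1"
      and IH: "\<And>us. det_rows n (us @ xs) = \<sigma> * det_rows n (us @ y1 @ y2)" by blast
    have "det_rows n (us @ x # xs) = (\<sigma> * (-1) ^ length y1) * det_rows n (us @ ys)" for us
    proof -
      have "det_rows n (us @ x # xs) = \<sigma> * det_rows n (us @ x # y1 @ y2)"
        using IH[of "us @ [x]"] by simp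
      moreover have "det_rows n (us @ ys) = (-1) ^ length y1 * det_rows n (us @ x # y1 @ y2)"
        using det_rows_move[of n us y1 x y2] by (simp add: ys)
      moreover have "(-1) ^ length y1 * (-1) ^ length y1 = (1::'a)"
        by (simp flip: power_add)
      ultimately show ?thesis by (metis mult.assoc mult.right_neutral mult.commute)
    qed
    moreover have "\<sigma> * (-1) ^ length y1 = 1 \<or> \<sigma> * (-1) ^ length y1 = - 1"
      using s by (cases "even (length y1)") auto
    ultimately show ?case by blast
  qed
  then show ?thesis using that by blast
qed

lemma abs_det_rows_permute:
  assumes "mset xs = mset ys"
  shows "\<bar>det_rows n xs\<bar> = \<bar>det_rows n ys :: int\<bar>"
proof -
  obtain \<sigma> :: int where "\<sigma> = 1 \<or> \<sigma> = - 1" and "\<And>us. det_rows n (us @ xs) = \<sigma> * det_rows n (us @ ys)"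
    using det_rows_permute[OF assms] by metis
  from this(1) this(2)[of "[]"] show ?thesis by auto
qed

lemma det_rows_repeat:
  assumes "\<not> distinct xs"
  shows "det_rows n xs = 0"
proof (cases "length xs = n")
  case True
  obtain i j where ij: "i < length xs" "j < length xs" "i \<noteq> j" "xs ! i = xs ! j"
    using assms by (auto simp: distinct_conv_nth)
  show ?thesis unfolding det_rows_def
    by (rule det_identical_rows[of _ n i j])
       (use ij True in \<open>auto simp: mat_of_rows_def row_def intro!: eq_vecI\<close>)
qed (simp add: det_rows_def det_def)

lemma orthogonal_cross_vec:
  assumes "length qs + 1 = n" and "set qs \<subseteq> carrier_vec n" and "a \<in> set qs"
  shows "a \<bullet> cross_vec n qs = 0"
  using det_rows_Cons[OF assms(1), of a] det_rows_repeat[of "a # qs" n] assms(2,3) by auto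

lemma det_rows_kernel:
  fixes z :: "'a::idom vec"
  assumes "det_rows n xs \<noteq> 0" and "set xs \<subseteq> carrier_vec n" and "z \<in> carrier_vec n"
    and "\<And>a. a \<in> set xs \<Longrightarrow> a \<bullet> z = 0"
  shows "z = 0\<^sub>v n"
proof (rule ccontr)
  assume nz: "z \<noteq> 0\<^sub>v n"
  have len: "length xs = n"
    using assms(1) by (auto simp: det_rows_def det_def split: if_splits)
  have M: "mat_of_rows n xs \<in> carrier_mat n n" using len by (simp add: mat_of_rows_def)
  have "mat_of_rows n xs *\<^sub>v z = 0\<^sub>v n"
    by (rule eq_vecI) (use len assms(2,4) in \<open>auto simp: mult_mat_vec_def subset_iff\<close>)
  then show False
    using det_0_iff_vec_prod_zero[OF M] assms nz unfolding det_rows_def by blast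
qed

text \<open>Equivalently, \<open>S\<close> spans the space over the rationals; in this form the property says that the cone of
  \<open>S\<close> is pointed.\<close>

definition spanning :: "nat \<Rightarrow> int vec set \<Rightarrow> bool" where
  "spanning n S \<longleftrightarrow> (\<forall>z \<in> carrier_vec n. (\<forall>a \<in> S. a \<bullet> z = 0) \<longrightarrow> z = 0\<^sub>v n)"

text \<open>Steinitz exchange, starting from the unit vectors: a unit vector can be replaced by an element of
  \<open>S\<close> because the determinant is a nonzero linear functional of the row that is replaced.\<close>

lemma spanning_nonsingular_rows:
  assumes S: "S \<subseteq> carrier_vec n" and sp: "spanning n S"
  obtains xs where "length xs = n" "set xs \<subseteq> S" "det_rows n xs \<noteq> 0"
proof -
  have "k \<le> n \<Longrightarrow> \<exists>es qs. length es + k = n \<and> length qs = k \<and> set es \<subseteq> carrier_vec n \<and> set qs \<subseteq> S \<and>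
      det_rows n (es @ qs) \<noteq> 0" for k
  proof (induction k)
    case 0
    have "mat_of_rows n (unit_vecs n) = (1\<^sub>m n :: int mat)"
      by (rule eq_matI) (auto simp: mat_of_rows_def unit_vecs_def)
    then show ?case
      by (intro exI[of _ "unit_vecs n"] exI[of _ "[]"]) (auto simp: det_rows_def unit_vecs_def)
  next
    case (Suc k)
    then obtain es qs where h: "length es + k = n" "length qs = k" "set es \<subseteq> carrier_vec n" "set qs \<subseteq> S"
      "det_rows n (es @ qs) \<noteq> 0" by auto
    from h(1) Suc.prems obtain e es' where es: "es = e # es'" by (cases es) auto
    let ?c = "cross_vec n (es' @ qs)"
    have len: "length (es' @ qs) + 1 = n" using h es by simp
    have "e \<bullet> ?c \<noteq> 0" using h det_rows_Cons[OF len, of e] es by simp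
    then have "?c \<noteq> 0\<^sub>v n" using h(3) es by auto
    then obtain a where a: "a \<in> S" "a \<bullet> ?c \<noteq> 0"
      using sp unfolding spanning_def by (metis cross_vec_carrier)
    then have "det_rows n (a # es' @ qs) \<noteq> 0" using det_rows_Cons[OF len, of a] S by auto
    then have "det_rows n (es' @ a # qs) \<noteq> 0" using det_rows_move[of n "[]" es' a qs] by simp
    then show ?case
      by (intro exI[of _ es'] exI[of _ "a # qs"]) (use h es a in auto)
  qed
  from this[of n] obtain es qs where "es = []" "length qs = n" "set qs \<subseteq> S" "det_rows n (es @ qs) \<noteq> 0" by auto
  then show ?thesis using that by auto
qed

lemma nonsingular_rows_spanning:
  assumes "det_rows n xs \<noteq> 0" "set xs \<subseteq> S" "S \<subseteq> carrier_vec n"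
  shows "spanning n S"
  unfolding spanning_def
  by (intro ballI impI) (rule det_rows_kernel[OF assms(1)], use assms in auto)

section \<open>Cones and ray vectors\<close>

lemma scalar_prod_diff_smult:
  assumes "a \<in> carrier_vec n" "z \<in> carrier_vec n" "w \<in> carrier_vec n"
  shows "a \<bullet> (\<alpha> \<cdot>\<^sub>v z - \<beta> \<cdot>\<^sub>v w) = \<alpha> * (a \<bullet> z) - \<beta> * (a \<bullet> w :: int)"
  using assms by (subst scalar_prod_minus_distrib[where n = n]) auto

definition in_cone :: "int vec set \<Rightarrow> int vec \<Rightarrow> bool" where
  "in_cone S x \<longleftrightarrow> (\<forall>a \<in> S. 0 \<le> a \<bullet> x)"

text \<open>The value of a row on a ray vector is, up to sign, a maximal minor. The zero vector belongs to the set when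
  some \<open>n - 1\<close> rows are dependent.\<close>

definition ray_vectors :: "nat \<Rightarrow> int vec set \<Rightarrow> int vec set" where
  "ray_vectors n S = {c. in_cone S c \<and> (\<exists>qs. length qs + 1 = n \<and> set qs \<subseteq> S \<and>
     (c = cross_vec n qs \<or> c = - cross_vec n qs))}"

lemma ray_vectors_carrier: "c \<in> ray_vectors n S \<Longrightarrow> c \<in> carrier_vec n"
  by (auto simp: ray_vectors_def)

text \<open>A vector of the minimal face of \<open>x\<close> that makes as many rows vanish as possible spans an extreme ray: a vector
  \<open>w\<close> that vanishes on the same rows and is not parallel to \<open>z\<close> could be subtracted from a multiple of \<open>z\<close>
  until another row vanishes.\<close>

lemma cone_vector_minimal_support:
  assumes S: "S \<subseteq> carrier_vec n" "finite S" "spanning n S"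
    and x: "x \<in> carrier_vec n" "x \<noteq> 0\<^sub>v n" "in_cone S x"
  obtains z where "z \<in> carrier_vec n" "z \<noteq> 0\<^sub>v n" "in_cone S z" "\<And>a. a \<in> S \<Longrightarrow> a \<bullet> x = 0 \<Longrightarrow> a \<bullet> z = 0"
    and "\<And>w. w \<in> carrier_vec n \<Longrightarrow> (\<And>a. a \<in> S \<Longrightarrow> a \<bullet> z = 0 \<Longrightarrow> a \<bullet> w = 0) \<Longrightarrow>
      \<exists>\<alpha> \<beta>. \<beta> \<noteq> 0 \<and> \<alpha> \<cdot>\<^sub>v z = \<beta> \<cdot>\<^sub>v w"
proof -
  define P where "P z \<longleftrightarrow> z \<in> carrier_vec n \<and> z \<noteq> 0\<^sub>v n \<and> in_cone S z \<and> (\<forall>a \<in> S. a \<bullet> x = 0 \<longrightarrow> a \<bullet> z = 0)" for z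
  define supp where "supp z = {a \<in> S. a \<bullet> z \<noteq> 0}" for z
  have "P x" using x by (auto simp: P_def)
  then obtain z where z: "P z" and min: "\<And>y. P y \<Longrightarrow> card (supp z) \<le> card (supp y)"
    using ex_has_least_nat[of P x "\<lambda>z. card (supp z)"] by blast
  have zc: "z \<in> carrier_vec n" and znz: "z \<noteq> 0\<^sub>v n" and zcone: "in_cone S z" using z by (auto simp: P_def)
  have fin: "finite (supp z)" using S by (auto simp: supp_def)
  have ne: "supp z \<noteq> {}" using S(3) zc znz unfolding spanning_def supp_def by auto
  show ?thesis
  proof (rule that[of z])
    fix w :: "int vec" assume w: "w \<in> carrier_vec n" "\<And>a. a \<in> S \<Longrightarrow> a \<bullet> z = 0 \<Longrightarrow> a \<bullet> w = 0"
    \<comment> \<open>Decreasing \<open>\<alpha>\<close> in \<open>\<alpha> z - w\<close>, the row of maximal ratio is the first to vanish.\<close>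
    define f where "f a = real_of_int (a \<bullet> w) / real_of_int (a \<bullet> z)" for a
    have "Max (f ` supp z) \<in> f ` supp z" using fin ne by simp
    then obtain a0 where a0: "a0 \<in> supp z" "f a0 = Max (f ` supp z)" by auto
    have a0p: "a0 \<bullet> z > 0" using a0(1) zcone by (force simp: supp_def in_cone_def)
    define z' where "z' = (a0 \<bullet> w) \<cdot>\<^sub>v z - (a0 \<bullet> z) \<cdot>\<^sub>v w"
    have az': "a \<bullet> z' = (a0 \<bullet> w) * (a \<bullet> z) - (a0 \<bullet> z) * (a \<bullet> w)" if "a \<in> S" for a
      unfolding z'_def using that S zc w by (intro scalar_prod_diff_smult[of _ n]) auto
    have z'c: "z' \<in> carrier_vec n" using zc w by (auto simp: z'_def)
    have ge: "(a \<bullet> w) * (a0 \<bullet> z) \<le> (a0 \<bullet> w) * (a \<bullet> z)" if a: "a \<in> supp z" for a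
    proof -
      have "a \<bullet> z > 0" using a zcone by (force simp: supp_def in_cone_def)
      moreover have "f a \<le> f a0" using a fin a0(2) by simp
      ultimately have "real_of_int (a \<bullet> w) * real_of_int (a0 \<bullet> z) \<le> real_of_int (a0 \<bullet> w) * real_of_int (a \<bullet> z)"
        using a0p by (simp add: f_def divide_simps mult.commute)
      then show ?thesis by (simp only: flip: of_int_mult of_int_le_iff)
    qed
    have "z' = 0\<^sub>v n"
    proof (rule ccontr)
      assume nz: "z' \<noteq> 0\<^sub>v n"
      have "in_cone S z'"
        unfolding in_cone_def
      proof
        fix a assume a: "a \<in> S"
        show "0 \<le> a \<bullet> z'"
          using ge[of a] a w(2)[of a] by (cases "a \<in> supp z") (auto simp: az' supp_def mult.commute)
      qed
      moreover have "a \<bullet> z' = 0" if "a \<in> S" "a \<bullet> x = 0" for a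
        using that w(2)[of a] z az'[of a] by (auto simp: P_def)
      ultimately have "P z'" using nz z'c by (auto simp: P_def)
      have "supp z' \<subseteq> supp z - {a0}"
        using az' w(2) by (auto simp: supp_def)
      then have "card (supp z') < card (supp z)"
        using a0 fin by (meson card_Diff1_less card_mono finite_Diff order_le_less_trans)
      with min[OF \<open>P z'\<close>] show False by simp
    qed
    then have "(a0 \<bullet> w) \<cdot>\<^sub>v z = (a0 \<bullet> z) \<cdot>\<^sub>v w"
      using zc w by (auto simp: z'_def vec_eq_iff)
    then show "\<exists>\<alpha> \<beta>. \<beta> \<noteq> 0 \<and> \<alpha> \<cdot>\<^sub>v z = \<beta> \<cdot>\<^sub>v w" using a0p by (intro exI[of _ "a0 \<bullet> w"] exI[of _ "a0 \<bullet> z"]) auto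
  qed (use z in \<open>auto simp: P_def\<close>)
qed

text \<open>The rows vanishing on a vector \<open>z\<close> of minimal support have only the multiples of \<open>z\<close> as their kernel, so
  together with a unit vector they are spanning. The exchange lemma then selects \<open>n - 1\<close> of them with a nonzero
  cross product, which is parallel to \<open>z\<close>.\<close>

lemma ray_vector_in_minimal_face:
  assumes S: "S \<subseteq> carrier_vec n" "finite S" "spanning n S"
    and x: "x \<in> carrier_vec n" "x \<noteq> 0\<^sub>v n" "in_cone S x"
  obtains r where "r \<in> ray_vectors n S" "r \<noteq> 0\<^sub>v n" "\<And>a. a \<in> S \<Longrightarrow> a \<bullet> x = 0 \<Longrightarrow> a \<bullet> r = 0"
proof -
  obtain z where z: "z \<in> carrier_vec n" "z \<noteq> 0\<^sub>v n" "in_cone S z" "\<And>a. a \<in> S \<Longrightarrow> a \<bullet> x = 0 \<Longrightarrow> a \<bullet> z = 0"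
    and par: "\<And>w. w \<in> carrier_vec n \<Longrightarrow> (\<And>a. a \<in> S \<Longrightarrow> a \<bullet> z = 0 \<Longrightarrow> a \<bullet> w = 0) \<Longrightarrow>
      \<exists>\<alpha> \<beta>. \<beta> \<noteq> 0 \<and> \<alpha> \<cdot>\<^sub>v z = \<beta> \<cdot>\<^sub>v w"
    using cone_vector_minimal_support[OF S x] by metis
  obtain j where j: "j < n" "z $ j \<noteq> 0" using z by (auto simp: vec_eq_iff)
  define T where "T = {a \<in> S. a \<bullet> z = 0}"
  define e :: "int vec" where "e = unit_vec n j"
  have e: "e \<in> carrier_vec n" by (simp add: e_def)
  have ev: "e \<bullet> v = v $ j" if "v \<in> carrier_vec n" for v
    using that j by (simp add: e_def)
  have "spanning n (insert e T)"
    unfolding spanning_def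
  proof (intro ballI impI)
    fix w :: "int vec" assume w: "w \<in> carrier_vec n" "\<forall>a\<in>insert e T. a \<bullet> w = 0"
    then obtain \<alpha> \<beta> where ab: "\<beta> \<noteq> 0" "\<alpha> \<cdot>\<^sub>v z = \<beta> \<cdot>\<^sub>v w" using par[of w] by (auto simp: T_def)
    have "w $ j = 0" using w ev by auto
    then have "\<alpha> * z $ j = 0" using arg_cong[OF ab(2), of "\<lambda>v. v $ j"] j z w by auto
    then have "\<alpha> = 0" using j by simp
    have "\<beta> * w $ i = 0" if "i < n" for i
      using arg_cong[OF ab(2), of "\<lambda>v. v $ i"] that z w \<open>\<alpha> = 0\<close> by auto
    then show "w = 0\<^sub>v n" using ab(1) w by (auto simp: vec_eq_iff)
  qed
  then obtain xs where xs: "length xs = n" "set xs \<subseteq> insert e T" "det_rows n xs \<noteq> 0"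
    using spanning_nonsingular_rows[of "insert e T" n] e S by (auto simp: T_def)
  have xsc: "set xs \<subseteq> carrier_vec n" using xs(2) e S by (auto simp: T_def)
  have "e \<in> set xs"
  proof (rule ccontr)
    assume "e \<notin> set xs"
    then have "z = 0\<^sub>v n" using det_rows_kernel[OF xs(3) xsc z(1)] xs(2) by (auto simp: T_def)
    then show False using z by simp
  qed
  then obtain x1 x2 where x12: "xs = x1 @ e # x2" by (meson split_list)
  define qs where "qs = x1 @ x2"
  have dist: "distinct xs" using det_rows_repeat xs(3) by blast
  have qs: "length qs + 1 = n" "set qs \<subseteq> T" using xs x12 dist by (auto simp: qs_def)
  have "det_rows n (e # qs) \<noteq> 0" using det_rows_move[of n "[]" x1 e x2] xs(3) x12 by (simp add: qs_def)
  define c where "c = cross_vec n qs"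
  have c: "c \<in> carrier_vec n" by (simp add: c_def)
  have cj: "c $ j \<noteq> 0" using \<open>det_rows n (e # qs) \<noteq> 0\<close> det_rows_Cons[OF qs(1) e] ev c by (simp add: c_def)
  have "c $ j \<cdot>\<^sub>v z - z $ j \<cdot>\<^sub>v c = 0\<^sub>v n"
  proof (rule det_rows_kernel[OF xs(3) xsc])
    fix a assume a: "a \<in> set xs"
    have ac: "a \<in> carrier_vec n" using a xsc by auto
    have "a = e \<or> a \<in> set qs" using a x12 by (auto simp: qs_def)
    then show "a \<bullet> (c $ j \<cdot>\<^sub>v z - z $ j \<cdot>\<^sub>v c) = 0"
    proof
      assume "a = e" then show ?thesis using scalar_prod_diff_smult[OF ac z(1) c] ev c z by simp
    next
      assume aq: "a \<in> set qs"
      have "a \<bullet> c = 0" unfolding c_def by (rule orthogonal_cross_vec[OF qs(1)]) (use aq xsc x12 qs_def in auto)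
      moreover have "a \<bullet> z = 0" using aq qs(2) by (auto simp: T_def)
      ultimately show ?thesis using scalar_prod_diff_smult[OF ac z(1) c] by simp
    qed
  qed (use z c in auto)
  then have acz: "c $ j * (a \<bullet> z) = z $ j * (a \<bullet> c)" if "a \<in> carrier_vec n" for a
    using scalar_prod_diff_smult[OF that z(1) c, of "c $ j" "z $ j"] that by simp
  define r where "r = (if c $ j * z $ j > 0 then c else - c)"
  have ar: "\<bar>z $ j\<bar> * (a \<bullet> r) = \<bar>c $ j\<bar> * (a \<bullet> z)" if "a \<in> carrier_vec n" for a
    using acz[OF that] cj j that c by (auto simp: r_def zero_less_mult_iff not_less mult_le_0_iff abs_if split: if_splits)
  show ?thesis
  proof (rule that[of r])
    have "in_cone S r"
      unfolding in_cone_def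
    proof
      fix a assume a: "a \<in> S"
      have "0 \<le> \<bar>z $ j\<bar> * (a \<bullet> r)" using ar[of a] a S z(3) by (auto simp: in_cone_def)
      then show "0 \<le> a \<bullet> r" using j by (simp add: zero_le_mult_iff)
    qed
    then show "r \<in> ray_vectors n S"
      unfolding ray_vectors_def using qs by (auto simp: r_def c_def T_def intro!: exI[of _ qs])
    have "r $ j \<noteq> 0" using cj c j by (auto simp: r_def)
    then show "r \<noteq> 0\<^sub>v n" using j by auto
    show "a \<bullet> r = 0" if "a \<in> S" "a \<bullet> x = 0" for a
      using ar[of a] z(4)[OF that] j that S by auto
  qed
qed

section \<open>The index of a full-dimensional lattice\<close>

text \<open>The Euclidean algorithm on the entries of the first row. Its steps are unimodular column operations, so
  the lattice spanned by the columns does not grow and the determinant changes at most its sign.\<close>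

lemma column_reduce_first_row:
  fixes B :: "int mat"
  assumes "B \<in> carrier_mat n n" "0 < n"
  shows "\<exists>C \<in> carrier_mat n n. \<bar>det C\<bar> = \<bar>det B\<bar> \<and> (\<forall>z \<in> carrier_vec n. \<exists>z' \<in> carrier_vec n. C *\<^sub>v z = B *\<^sub>v z') \<and>
    (\<forall>j. 0 < j \<and> j < n \<longrightarrow> C $$ (0, j) = 0)"
  using assms(1)
proof (induction "\<Sum>j<n. nat \<bar>B $$ (0, j)\<bar>" arbitrary: B rule: less_induct)
  case less
  show ?case
  proof (cases "\<exists>j<n. \<exists>k<n. j \<noteq> k \<and> B $$ (0, j) \<noteq> 0 \<and> B $$ (0, k) \<noteq> 0")
    case True
    then obtain j k where jk: "j < n" "k < n" "j \<noteq> k" "B $$ (0, j) \<noteq> 0" "B $$ (0, k) \<noteq> 0"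
      and le: "\<bar>B $$ (0, k)\<bar> \<le> \<bar>B $$ (0, j)\<bar>"
      by (metis linear)
    define a where "a = - sgn (B $$ (0, j)) * sgn (B $$ (0, k))"
    define C where "C = addcol a j k B"
    have C: "C \<in> carrier_mat n n" using less.prems by (auto simp: C_def)
    have C0: "C $$ (0, i) = (if i = j then a * B $$ (0, k) + B $$ (0, j) else B $$ (0, i))" if "i < n" for i
      using that less.prems \<open>0 < n\<close> by (auto simp: C_def)
    have small: "nat \<bar>C $$ (0, j)\<bar> < nat \<bar>B $$ (0, j)\<bar>"
      using jk le by (auto simp: C0 a_def sgn_if abs_if split: if_splits)
    have "(\<Sum>i<n. nat \<bar>C $$ (0, i)\<bar>) < (\<Sum>i<n. nat \<bar>B $$ (0, i)\<bar>)"
    proof (rule sum_strict_mono_ex1)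
      show "\<forall>x\<in>{..<n}. nat \<bar>C $$ (0, x)\<bar> \<le> nat \<bar>B $$ (0, x)\<bar>"
        using small C0 by (metis lessThan_iff order.refl less_imp_le)
      show "\<exists>x\<in>{..<n}. nat \<bar>C $$ (0, x)\<bar> < nat \<bar>B $$ (0, x)\<bar>"
        using small jk by blast
    qed simp
    from less.hyps[OF this C] obtain D where D: "D \<in> carrier_mat n n" "\<bar>det D\<bar> = \<bar>det C\<bar>"
      "\<forall>z\<in>carrier_vec n. \<exists>z'\<in>carrier_vec n. D *\<^sub>v z = C *\<^sub>v z'" "\<forall>j. 0 < j \<and> j < n \<longrightarrow> D $$ (0, j) = 0"
      by blast
    have detC: "det C = det B" unfolding C_def by (rule det_addcol[OF jk(2) jk(3) less.prems])
    have CB: "\<exists>z'\<in>carrier_vec n. C *\<^sub>v z = B *\<^sub>v z'" if z: "z \<in> carrier_vec n" for z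
    proof -
      have "C *\<^sub>v z = B *\<^sub>v (addrow_mat n a k j *\<^sub>v z)"
        unfolding C_def addcol_mat[OF less.prems jk(2)]
        by (rule assoc_mult_mat_vec[OF less.prems _ z]) simp
      then show ?thesis using z by (intro bexI[of _ "addrow_mat n a k j *\<^sub>v z"]) (auto intro!: mult_mat_vec_carrier[of _ n n])
    qed
    have "\<exists>z'\<in>carrier_vec n. D *\<^sub>v z = B *\<^sub>v z'" if "z \<in> carrier_vec n" for z
      using D(3) CB that by metis
    then show ?thesis using D detC by auto
  next
    case False
    show ?thesis
    proof (cases "\<exists>j. 0 < j \<and> j < n \<and> B $$ (0, j) \<noteq> 0")
      case True
      then obtain j where j: "0 < j" "j < n" "B $$ (0, j) \<noteq> 0" by blast
      define C where "C = swapcols 0 j B"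
      have C: "C \<in> carrier_mat n n" using less.prems by (auto simp: C_def)
      have "C $$ (0, i) = 0" if "0 < i" "i < n" for i
        using that False less.prems j by (auto simp: C_def)
      moreover have "det C = - det B"
        unfolding C_def by (rule det_swapcols[OF _ _ _ less.prems]) (use j in auto)
      moreover have "\<exists>z'\<in>carrier_vec n. C *\<^sub>v z = B *\<^sub>v z'" if z: "z \<in> carrier_vec n" for z
      proof -
        have "C *\<^sub>v z = B *\<^sub>v (swaprows_mat n 0 j *\<^sub>v z)"
          unfolding C_def swapcols_mat[OF less.prems \<open>0 < n\<close> j(2)]
          by (rule assoc_mult_mat_vec[OF less.prems _ z]) simp
        then show ?thesis using z by (intro bexI[of _ "swaprows_mat n 0 j *\<^sub>v z"]) (auto intro!: mult_mat_vec_carrier[of _ n n])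
      qed
      ultimately show ?thesis using C by (intro bexI[of _ C]) auto
    next
      case False
      then show ?thesis using less.prems by (intro bexI[of _ B]) auto
    qed
  qed
qed

text \<open>Induction on the dimension: once the first row is \<open>(g, 0, \<dots>, 0)\<close>, the first coordinates fall into \<open>\<bar>g\<bar>\<close> residue
  classes, and inside a class multiples of the first column reduce the problem to the complementary
  minor.\<close>

lemma card_incongruent_le_det:
  fixes B :: "int mat"
  assumes "B \<in> carrier_mat n n" "det B \<noteq> 0" "finite F" "F \<subseteq> carrier_vec n"
    and "\<And>x y z. x \<in> F \<Longrightarrow> y \<in> F \<Longrightarrow> z \<in> carrier_vec n \<Longrightarrow> x - y = B *\<^sub>v z \<Longrightarrow> x = y"
  shows "int (card F) \<le> \<bar>det B\<bar>"
  using assms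
proof (induction n arbitrary: B F)
  case 0
  have "x = 0\<^sub>v 0" if "x \<in> F" for x using 0(4) that by (metis carrier_vecD subsetD vec_of_dim_0)
  then have "F \<subseteq> {0\<^sub>v 0}" by blast
  then have "card F \<le> 1" using card_mono[of "{0\<^sub>v 0 :: int vec}" F] by simp
  then show ?case using 0 by simp
next
  case (Suc n B0 F)
  obtain B where B: "B \<in> carrier_mat (Suc n) (Suc n)" and detB: "\<bar>det B\<bar> = \<bar>det B0\<bar>"
    and sub: "\<forall>z \<in> carrier_vec (Suc n). \<exists>z' \<in> carrier_vec (Suc n). B *\<^sub>v z = B0 *\<^sub>v z'"
    and row0: "\<forall>j. 0 < j \<and> j < Suc n \<longrightarrow> B $$ (0, j) = 0"
    using column_reduce_first_row[OF Suc.prems(1)] by auto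
  have incong: "x = y" if "x \<in> F" "y \<in> F" "z \<in> carrier_vec (Suc n)" "x - y = B *\<^sub>v z" for x y z
    using Suc.prems(5)[OF that(1,2)] that sub by metis
  define g where "g = B $$ (0, 0)"
  define B' where "B' = mat_delete B 0 0"
  have B': "B' \<in> carrier_mat n n" using B by (auto simp: B'_def mat_delete_def)
  have "det B = (\<Sum>j<Suc n. B $$ (0, j) * cofactor B 0 j)" by (rule laplace_expansion_row[OF B]) simp
  also have "\<dots> = g * det B'" using row0 by (simp add: sum.lessThan_Suc_shift cofactor_def g_def B'_def del: sum.lessThan_Suc)
  finally have det: "det B = g * det B'" .
  then have g0: "g \<noteq> 0" and dB'0: "det B' \<noteq> 0" using Suc.prems(2) detB by auto
  define Fr where "Fr r = {x \<in> F. x $ 0 mod \<bar>g\<bar> = r}" for r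
  have le: "int (card (Fr r)) \<le> \<bar>det B'\<bar>" for r
  proof -
    define q where "q x = (x $ 0 - r) div g" for x :: "int vec"
    \<comment> \<open>Clear the first coordinate up to its residue by a multiple of the first column, then drop it.\<close>
    define \<phi> where "\<phi> x = vec n (\<lambda>i. x $ Suc i - B $$ (Suc i, 0) * q x)" for x
    have q: "x $ 0 = r + g * q x" if "x \<in> Fr r" for x
    proof -
      have "r = x $ 0 mod \<bar>g\<bar>" using that by (simp add: Fr_def)
      then have "\<bar>g\<bar> dvd x $ 0 - r" by (simp add: dvd_minus_mod)
      then show ?thesis by (simp add: q_def)
    qed
    have inc: "x = y" if x: "x \<in> Fr r" and y: "y \<in> Fr r" and z: "z \<in> carrier_vec n" and e: "\<phi> x - \<phi> y = B' *\<^sub>v z" for x y z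
    proof (rule incong)
      show "x \<in> F" "y \<in> F" using x y by (auto simp: Fr_def)
      then have xc: "x \<in> carrier_vec (Suc n)" "y \<in> carrier_vec (Suc n)" using Suc.prems(4) by auto
      let ?z = "vCons (q x - q y) z"
      show zc: "?z \<in> carrier_vec (Suc n)" using z by simp
      show "x - y = B *\<^sub>v ?z"
      proof (rule eq_vecI)
        fix i assume "i < dim_vec (B *\<^sub>v ?z)"
        then have i: "i < Suc n" using B by auto
        have zd: "dim_vec z = n" using z by auto
        have Bz: "(B *\<^sub>v ?z) $ i = B $$ (i, 0) * (q x - q y) + (\<Sum>j<n. B $$ (i, Suc j) * z $ j)"
          using i B zd by (simp add: mult_mat_vec_def scalar_prod_def atLeast0LessThan sum.lessThan_Suc_shift del: sum.lessThan_Suc)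
        show "(x - y) $ i = (B *\<^sub>v ?z) $ i"
        proof (cases i)
          case 0
          have "(\<Sum>j<n. B $$ (0, Suc j) * z $ j) = 0" using row0 by (intro sum.neutral) auto
          then show ?thesis using 0 Bz q[OF x] q[OF y] xc by (simp add: g_def algebra_simps)
        next
          case (Suc i')
          have i': "i' < n" using i Suc by simp
          have "(B' *\<^sub>v z) $ i' = (\<Sum>j<n. B $$ (i, Suc j) * z $ j)"
            using i' B' B zd Suc by (simp add: mult_mat_vec_def scalar_prod_def atLeast0LessThan B'_def mat_delete_def)
          moreover have "(B' *\<^sub>v z) $ i' = x $ i - B $$ (i, 0) * q x - (y $ i - B $$ (i, 0) * q y)"
            using i' Suc unfolding e[symmetric] by (simp add: \<phi>_def)
          ultimately show ?thesis using Bz xc i by (simp add: algebra_simps)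
        qed
      qed (use B xc in auto)
    qed
    have inj: "inj_on \<phi> (Fr r)"
    proof (rule inj_onI)
      fix x y assume "x \<in> Fr r" "y \<in> Fr r" "\<phi> x = \<phi> y"
      then show "x = y" by (intro inc[of x y "0\<^sub>v n"]) (use B' in \<open>auto simp: \<phi>_def\<close>)
    qed
    have "int (card (\<phi> ` Fr r)) \<le> \<bar>det B'\<bar>"
    proof (rule Suc.IH[OF B' dB'0])
      show "finite (\<phi> ` Fr r)" using Suc.prems(3) by (simp add: Fr_def)
      show "\<phi> ` Fr r \<subseteq> carrier_vec n" by (auto simp: \<phi>_def)
    qed (use inc in blast)
    then show ?thesis by (simp add: card_image[OF inj])
  qed
  have "F = (\<Union>r\<in>{0..<\<bar>g\<bar>}. Fr r)" using g0 by (auto simp: Fr_def)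
  then have "int (card F) \<le> int (\<Sum>r\<in>{0..<\<bar>g\<bar>}. card (Fr r))"
    by (metis card_UN_le finite_atLeastLessThan_int of_nat_mono)
  also have "\<dots> \<le> (\<Sum>r\<in>{0..<\<bar>g\<bar>}. \<bar>det B'\<bar>)" unfolding of_nat_sum by (rule sum_mono) (rule le)
  also have "\<dots> = \<bar>g\<bar> * \<bar>det B'\<bar>" by simp
  finally show ?case using det detB by (simp add: abs_mult)
qed

lemma congruent_pair_exists:
  fixes B :: "int mat" and f :: "'i \<Rightarrow> int vec"
  assumes B: "B \<in> carrier_mat n n" "det B \<noteq> 0" and K: "finite K" "\<bar>det B\<bar> < int (card K)"
    and f: "\<And>i. i \<in> K \<Longrightarrow> f i \<in> carrier_vec n"
  obtains i j z where "i \<in> K" "j \<in> K" "i \<noteq> j" "z \<in> carrier_vec n" "f i - f j = B *\<^sub>v z"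
proof (cases "inj_on f K")
  case True
  have "\<exists>x\<in>f ` K. \<exists>y\<in>f ` K. \<exists>z\<in>carrier_vec n. x - y = B *\<^sub>v z \<and> x \<noteq> y"
    using card_incongruent_le_det[OF B, of "f ` K"] K f by (force simp: card_image[OF True])
  then show ?thesis using that by blast
next
  case False
  then obtain i j where ij: "i \<in> K" "j \<in> K" "i \<noteq> j" "f i = f j" by (auto simp: inj_on_def)
  have "f i - f j = B *\<^sub>v 0\<^sub>v n" using ij f[OF ij(2)] B by auto
  then show ?thesis using that ij by (meson zero_carrier_vec)
qed

section \<open>Cones whose minors are at most two in absolute value\<close>

text \<open>The Hilbert basis elements, phrased for integer vectors and a set of rows.\<close>

definition irreducible_in_cone :: "nat \<Rightarrow> int vec set \<Rightarrow> int vec \<Rightarrow> bool" where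
  "irreducible_in_cone n S h \<longleftrightarrow> h \<in> carrier_vec n \<and> h \<noteq> 0\<^sub>v n \<and> in_cone S h \<and>
     (\<forall>z \<in> carrier_vec n. in_cone S z \<and> in_cone S (h - z) \<longrightarrow> z = 0\<^sub>v n \<or> z = h)"

lemma scalar_prod_uminus_cross_vec [simp]:
  "a \<in> carrier_vec n \<Longrightarrow> a \<bullet> - cross_vec n qs = - (a \<bullet> cross_vec n qs)"
  by (rule scalar_prod_uminus_right) (simp add: cross_vec_def)

lemma ray_vector_det_rows:
  assumes "c \<in> ray_vectors n S" "S \<subseteq> carrier_vec n"
  obtains qs where "length qs + 1 = n" "set qs \<subseteq> S" "\<And>a. a \<in> carrier_vec n \<Longrightarrow> \<bar>a \<bullet> c\<bar> = \<bar>det_rows n (a # qs)\<bar>"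
    "\<And>a. a \<in> set qs \<Longrightarrow> a \<bullet> c = 0"
proof -
  obtain qs where qs: "length qs + 1 = n" "set qs \<subseteq> S" "c = cross_vec n qs \<or> c = - cross_vec n qs"
    using assms by (auto simp: ray_vectors_def)
  have abs: "\<bar>a \<bullet> c\<bar> = \<bar>det_rows n (a # qs)\<bar>" if "a \<in> carrier_vec n" for a
    using qs(3) that det_rows_Cons[OF qs(1) that] by auto
  moreover have "a \<bullet> c = 0" if "a \<in> set qs" for a
  proof -
    have "det_rows n (a # qs) = 0" using that by (intro det_rows_repeat) auto
    moreover have "a \<in> carrier_vec n" using that qs(2) assms(2) by auto
    ultimately show ?thesis using abs[of a] by simp
  qed
  ultimately show ?thesis using that qs by blast
qed

text \<open>A matrix with odd determinant is invertible modulo two; the adjugate serves as the inverse up to an odd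
  factor.\<close>

lemma even_of_odd_det_rows:
  fixes z :: "int vec"
  assumes "odd (det_rows n xs)" "set xs \<subseteq> carrier_vec n" "z \<in> carrier_vec n"
    and "\<And>a. a \<in> set xs \<Longrightarrow> even (a \<bullet> z)" and "i < n"
  shows "even (z $ i)"
proof -
  let ?M = "mat_of_rows n xs"
  have len: "length xs = n"
    using assms(1) by (auto simp: det_rows_def det_def split: if_splits)
  have M: "?M \<in> carrier_mat n n" using len by (simp add: mat_of_rows_def)
  have "det ?M * z $ i = ((det ?M \<cdot>\<^sub>m 1\<^sub>m n) *\<^sub>v z) $ i"
    using assms(3,5) by (simp add: smult_scalar_prod_distrib[of _ n] row_smult)
  also have "\<dots> = (adj_mat ?M *\<^sub>v (?M *\<^sub>v z)) $ i"
    using assoc_mult_mat_vec[OF adj_mat(1)[OF M] M assms(3)] by (simp only: adj_mat(3)[OF M])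
  also have "\<dots> = (\<Sum>k = 0..<n. adj_mat ?M $$ (i, k) * (?M *\<^sub>v z) $ k)"
    using adj_mat(1)[OF M] assms(5) M by (auto simp: mult_mat_vec_def scalar_prod_def)
  finally have e: "det ?M * z $ i = (\<Sum>k = 0..<n. adj_mat ?M $$ (i, k) * (?M *\<^sub>v z) $ k)" .
  have even_k: "even ((?M *\<^sub>v z) $ k)" if "k < n" for k
  proof -
    have "xs ! k \<in> set xs" using that len by simp
    then have "(?M *\<^sub>v z) $ k = xs ! k \<bullet> z" using that len assms(2) by (simp add: subset_iff)
    then show ?thesis using assms(4)[OF \<open>xs ! k \<in> set xs\<close>] by simp
  qed
  have "even (\<Sum>k = 0..<n. adj_mat ?M $$ (i, k) * (?M *\<^sub>v z) $ k)"
  proof (rule dvd_sum)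
    fix k assume "k \<in> {0..<n}"
    then show "even (adj_mat ?M $$ (i, k) * (?M *\<^sub>v z) $ k)" using even_k[of k] by simp
  qed
  then have "even (det ?M * z $ i)" by (simp only: e)
  then show ?thesis using assms(1) by (simp add: det_rows_def)
qed

text \<open>Modulo two, the rows \<open>qs\<close> have rank \<open>n - 1\<close> as soon as their cross product is nonzero modulo two. Their
  kernel is then a line over the field of two elements and contains a single nonzero vector.\<close>

lemma parity_class_unique:
  fixes r s :: "int vec"
  assumes qs: "length qs + 1 = n" "set qs \<subseteq> carrier_vec n" and s: "s = cross_vec n qs \<or> s = - cross_vec n qs"
    and r: "r \<in> carrier_vec n" "\<And>a. a \<in> set qs \<Longrightarrow> even (a \<bullet> r)"
    and odd: "j < n" "odd (s $ j)" "k < n" "odd (r $ k)" and i: "i < n"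
  shows "even (r $ i + s $ i)"
proof -
  have sc: "s \<in> carrier_vec n" using s by auto
  let ?e = "unit_vec n j :: int vec"
  have "det_rows n (?e # qs) = cross_vec n qs $ j"
    using det_rows_Cons[OF qs(1), of ?e] odd(1) by simp
  moreover have "s $ j = cross_vec n qs $ j \<or> s $ j = - (cross_vec n qs $ j)"
    using s odd(1) by (auto simp: cross_vec_def)
  ultimately have odd_det: "odd (det_rows n (?e # qs))" using odd(2) by (metis even_minus)
  have even_t: "even (a \<bullet> (s $ j \<cdot>\<^sub>v r - r $ j \<cdot>\<^sub>v s))" if "a \<in> set (?e # qs)" for a
  proof (cases "a = ?e")
    case True
    have "?e \<bullet> (s $ j \<cdot>\<^sub>v r - r $ j \<cdot>\<^sub>v s) = s $ j * (?e \<bullet> r) - r $ j * (?e \<bullet> s)"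
      by (rule scalar_prod_diff_smult) (use r sc in auto)
    then show ?thesis using True odd(1) r sc by simp
  next
    case False
    then have a: "a \<in> set qs" "a \<in> carrier_vec n" using that qs by auto
    have "a \<bullet> s = 0" using orthogonal_cross_vec[OF qs a(1)] s a(2) by auto
    moreover have "a \<bullet> (s $ j \<cdot>\<^sub>v r - r $ j \<cdot>\<^sub>v s) = s $ j * (a \<bullet> r) - r $ j * (a \<bullet> s)"
      by (rule scalar_prod_diff_smult) (use a r sc in auto)
    ultimately show ?thesis using r(2)[OF a(1)] by simp
  qed
  have t: "even ((s $ j \<cdot>\<^sub>v r - r $ j \<cdot>\<^sub>v s) $ l)" if "l < n" for l
  proof (rule even_of_odd_det_rows[OF odd_det _ _ even_t that])
    show "set (?e # qs) \<subseteq> carrier_vec n" using qs(2) by simp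
    show "s $ j \<cdot>\<^sub>v r - r $ j \<cdot>\<^sub>v s \<in> carrier_vec n" using r(1) sc by simp
  qed
  have par: "even (s $ j * r $ l - r $ j * s $ l)" if "l < n" for l
    using t[OF that] that r(1) sc by simp
  have "odd (r $ j)"
  proof
    assume "even (r $ j)"
    then have "even (s $ j * r $ k)" using par[OF odd(3)] by simp
    then show False using odd(2,4) by simp
  qed
  moreover have "even (s $ j * r $ i) = even (r $ j * s $ i)" using par[OF i] by simp
  ultimately show ?thesis using odd(2) by simp
qed

text \<open>As long as an even ray vector \<open>s\<close> is found in the minimal face of \<open>g\<close>, it can be subtracted: the values
  of the rows on \<open>g\<close> are even, hence at least two where they do not vanish, and those on \<open>s\<close> are at most two. The
  difference is again odd, so this descent must meet an odd ray vector.\<close>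

lemma odd_ray_vector_in_minimal_face:
  fixes g :: "int vec"
  assumes S: "S \<subseteq> carrier_vec n" "finite S" "spanning n S"
    and le2: "\<And>a s. a \<in> S \<Longrightarrow> s \<in> ray_vectors n S \<Longrightarrow> a \<bullet> s \<le> 2"
    and g: "g \<in> carrier_vec n" "in_cone S g" "\<And>a. a \<in> S \<Longrightarrow> even (a \<bullet> g)" "\<exists>i<n. odd (g $ i)"
  obtains s where "s \<in> ray_vectors n S" "\<exists>i<n. odd (s $ i)" "\<And>a. a \<in> S \<Longrightarrow> a \<bullet> g = 0 \<Longrightarrow> a \<bullet> s = 0"
proof -
  have "\<exists>s \<in> ray_vectors n S. (\<exists>i<n. odd (s $ i)) \<and> (\<forall>a\<in>S. a \<bullet> g = 0 \<longrightarrow> a \<bullet> s = 0)"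
    using g
  proof (induction "nat (\<Sum>a\<in>S. a \<bullet> g)" arbitrary: g rule: less_induct)
    case (less g)
    have gnz: "g \<noteq> 0\<^sub>v n" using less.prems(4) by (metis even_zero index_zero_vec(1))
    obtain s where s: "s \<in> ray_vectors n S" "s \<noteq> 0\<^sub>v n" "\<And>a. a \<in> S \<Longrightarrow> a \<bullet> g = 0 \<Longrightarrow> a \<bullet> s = 0"
      using ray_vector_in_minimal_face[OF S less.prems(1) gnz less.prems(2)] by metis
    show ?case
    proof (cases "\<exists>i<n. odd (s $ i)")
      case True then show ?thesis using s(1,3) by (intro bexI[of _ s]) auto
    next
      case False
      have sc: "s \<in> carrier_vec n" using s(1) by (rule ray_vectors_carrier)
      have as0: "0 \<le> a \<bullet> s" if "a \<in> S" for a using s(1) that by (auto simp: ray_vectors_def in_cone_def)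
      have ags: "a \<bullet> (g - s) = a \<bullet> g - a \<bullet> s" if "a \<in> S" for a
        using that S sc less.prems(1) by (intro scalar_prod_minus_distrib[of _ n]) auto
      have even_as: "even (a \<bullet> s)" if "a \<in> S" for a
        using False sc that by (auto simp: scalar_prod_def intro!: dvd_sum)
      have pos: "0 \<le> a \<bullet> (g - s)" if a: "a \<in> S" for a
      proof (cases "a \<bullet> g = 0")
        case True then show ?thesis using s(3)[OF a] ags[OF a] by simp
      next
        case False
        have g: "0 \<le> a \<bullet> g" "even (a \<bullet> g)" using less.prems(2,3) a by (auto simp: in_cone_def)
        then have "a \<bullet> g \<noteq> 1" by auto
        with False g have "2 \<le> a \<bullet> g" by linarith
        then show ?thesis using le2[OF a s(1)] ags[OF a] by simp
      qed
      obtain a0 where a0: "a0 \<in> S" "a0 \<bullet> s \<noteq> 0" using S(3) s(2) sc by (metis spanning_def)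
      have "(\<Sum>a\<in>S. a \<bullet> (g - s)) < (\<Sum>a\<in>S. a \<bullet> g)"
      proof (rule sum_strict_mono_ex1[OF S(2)])
        show "\<forall>x\<in>S. x \<bullet> (g - s) \<le> x \<bullet> g" using ags as0 by (simp add: ags)
        show "\<exists>a\<in>S. a \<bullet> (g - s) < a \<bullet> g" using a0 ags as0 by (intro bexI[of _ a0]) force+
      qed
      moreover have "0 \<le> (\<Sum>a\<in>S. a \<bullet> (g - s))" using pos by (rule sum_nonneg)
      ultimately have "nat (\<Sum>a\<in>S. a \<bullet> (g - s)) < nat (\<Sum>a\<in>S. a \<bullet> g)" by simp
      moreover have "\<exists>i<n. odd ((g - s) $ i)"
        using less.prems(1,4) sc False by auto
      moreover have "in_cone S (g - s)" using pos by (simp add: in_cone_def)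
      moreover have "even (a \<bullet> (g - s))" if "a \<in> S" for a
        using ags[OF that] even_as[OF that] less.prems(3)[OF that] by simp
      moreover have "g - s \<in> carrier_vec n" using less.prems(1) sc by simp
      ultimately have "\<exists>s'\<in>ray_vectors n S. (\<exists>i<n. odd (s' $ i)) \<and> (\<forall>a\<in>S. a \<bullet> (g - s) = 0 \<longrightarrow> a \<bullet> s' = 0)"
        using less.hyps[of "g - s"] by blast
      then obtain s' where "s' \<in> ray_vectors n S" "\<exists>i<n. odd (s' $ i)" "\<forall>a\<in>S. a \<bullet> (g - s) = 0 \<longrightarrow> a \<bullet> s' = 0"
        by blast
      moreover have "a \<bullet> (g - s) = 0" if "a \<in> S" "a \<bullet> g = 0" for a
        using ags[OF that(1)] s(3)[OF that] that(2) by simp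
      ultimately show ?thesis by (intro bexI[of _ s']) auto
    qed
  qed
  then show ?thesis using that by blast
qed

lemma half_vec:
  fixes x :: "int vec"
  assumes "x \<in> carrier_vec n" "\<And>i. i < n \<Longrightarrow> even (x $ i)"
  obtains u where "u \<in> carrier_vec n" "x = 2 \<cdot>\<^sub>v u"
  by (rule that[of "vec n (\<lambda>i. x $ i div 2)"]) (use assms in \<open>auto simp: vec_eq_iff\<close>)

text \<open>The core of the case of bounded minors. If the ray vector \<open>r\<close> of the minimal face of \<open>h\<close> is even, then
  \<open>r / 2\<close> has slacks at most one and can be subtracted from \<open>h\<close>; if \<open>r\<close> itself can be subtracted, then \<open>r = h\<close>.
  Otherwise some row has the values \<open>2\<close> on \<open>r\<close> and \<open>1\<close> on \<open>h\<close>, and a second odd ray vector \<open>s\<close>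
  with \<open>2 h = r + s\<close> exists.\<close>

lemma bimodular_irreducible:
  fixes h :: "int vec"
  assumes S: "S \<subseteq> carrier_vec n" "finite S" "spanning n S"
    and bimod: "\<And>xs. length xs = n \<Longrightarrow> set xs \<subseteq> S \<Longrightarrow> \<bar>det_rows n xs\<bar> \<le> 2"
    and h: "irreducible_in_cone n S h"
  obtains r s where "r \<in> insert (0\<^sub>v n) (ray_vectors n S)" "s \<in> insert (0\<^sub>v n) (ray_vectors n S)" "2 \<cdot>\<^sub>v h = r + s"
proof -
  have hc: "h \<in> carrier_vec n" and hnz: "h \<noteq> 0\<^sub>v n" and hcone: "in_cone S h"
    and irr: "\<And>z. z \<in> carrier_vec n \<Longrightarrow> in_cone S z \<Longrightarrow> in_cone S (h - z) \<Longrightarrow> z = 0\<^sub>v n \<or> z = h"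
    using h by (auto simp: irreducible_in_cone_def)
  have ah0: "0 \<le> a \<bullet> h" if "a \<in> S" for a using hcone that by (simp add: in_cone_def)
  have le2: "\<bar>a \<bullet> c\<bar> \<le> 2" if c: "c \<in> ray_vectors n S'" and S': "S' \<subseteq> S" and a: "a \<in> S" for a c S'
  proof -
    obtain qs where qs: "length qs + 1 = n" "set qs \<subseteq> S'" "\<bar>a \<bullet> c\<bar> = \<bar>det_rows n (a # qs)\<bar>"
      using ray_vector_det_rows[OF c] S S' a by (metis subsetD subset_trans)
    then show ?thesis using bimod[of "a # qs"] S' a by auto
  qed
  obtain r where r: "r \<in> ray_vectors n S" "r \<noteq> 0\<^sub>v n" "\<And>a. a \<in> S \<Longrightarrow> a \<bullet> h = 0 \<Longrightarrow> a \<bullet> r = 0"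
    using ray_vector_in_minimal_face[OF S hc hnz hcone] by blast
  have rc: "r \<in> carrier_vec n" using r(1) by (rule ray_vectors_carrier)
  have ar0: "0 \<le> a \<bullet> r" if "a \<in> S" for a using r(1) that by (auto simp: ray_vectors_def in_cone_def)
  have ar2: "a \<bullet> r \<le> 2" if "a \<in> S" for a using le2[OF r(1) order.refl that] by simp
  have diff: "a \<bullet> (x - y) = a \<bullet> x - a \<bullet> y" if "a \<in> S" "x \<in> carrier_vec n" "y \<in> carrier_vec n" for a x y :: "int vec"
    using that S by (intro scalar_prod_minus_distrib[of _ n]) auto
  show ?thesis
  proof (cases "\<forall>i<n. even (r $ i)")
    case True
    then obtain u where u: "u \<in> carrier_vec n" "r = 2 \<cdot>\<^sub>v u" using half_vec[OF rc] by metis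
    have ar: "a \<bullet> r = 2 * (a \<bullet> u)" if "a \<in> S" for a using u that S by auto
    have unz: "u \<noteq> 0\<^sub>v n" using r(2) u by auto
    have "in_cone S u" using ar ar0 by (force simp: in_cone_def)
    moreover have "in_cone S (h - u)"
      unfolding in_cone_def
    proof
      fix a assume a: "a \<in> S"
      have "a \<bullet> u \<le> a \<bullet> h" using ar[OF a] ar2[OF a] r(3)[OF a] ah0[OF a] by (cases "a \<bullet> h = 0") auto
      then show "0 \<le> a \<bullet> (h - u)" using diff[OF a hc u(1)] by simp
    qed
    ultimately have "u = h" using irr[OF u(1)] unz by blast
    then have "2 \<cdot>\<^sub>v h = r + 0\<^sub>v n" using u(2) rc by simp
    then show ?thesis using r(1) by (intro that[of r "0\<^sub>v n"]) auto
  next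
    case False
    then obtain k where k: "k < n" "odd (r $ k)" by blast
    show ?thesis
    proof (cases "\<forall>a\<in>S. a \<bullet> r \<le> a \<bullet> h")
      case True
      then have "in_cone S (h - r)" using diff hc rc by (auto simp: in_cone_def)
      moreover have "in_cone S r" using ar0 by (simp add: in_cone_def)
      ultimately have "r = h" using irr rc r(2) by blast
      then have "2 \<cdot>\<^sub>v h = r + r" using hc by (auto simp: vec_eq_iff)
      then show ?thesis using r(1) by (intro that[of r r]) auto
    next
      case False
      then obtain a0 where a0: "a0 \<in> S" "a0 \<bullet> h < a0 \<bullet> r" by force
      have "a0 \<bullet> h \<noteq> 0" using r(3)[OF a0(1)] a0 by auto
      then have a0r: "a0 \<bullet> r = 2" using a0 ar2[OF a0(1)] ah0[OF a0(1)] by linarith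
      define g where "g = 2 \<cdot>\<^sub>v h - r"
      have gc: "g \<in> carrier_vec n" using hc rc by (simp add: g_def)
      have ag: "a \<bullet> g = 2 * (a \<bullet> h) - a \<bullet> r" if "a \<in> S" for a
        unfolding g_def using that S hc rc by (subst diff) auto
      have ag0: "0 \<le> a \<bullet> g" if "a \<in> S" for a
        using ag[OF that] ar2[OF that] r(3)[OF that] ah0[OF that] by (cases "a \<bullet> h = 0") auto
      \<comment> \<open>On \<open>r\<close> and hence on \<open>g\<close> these rows are even; they span, because \<open>qs\<close> vanishes on \<open>r\<close> and \<open>a0\<close> has value two.\<close>
      define E where "E = {a \<in> S. even (a \<bullet> r)}"
      have ES: "E \<subseteq> S" by (auto simp: E_def)
      obtain qs where qs: "length qs + 1 = n" "set qs \<subseteq> S" "\<bar>a0 \<bullet> r\<bar> = \<bar>det_rows n (a0 # qs)\<bar>" "\<And>a. a \<in> set qs \<Longrightarrow> a \<bullet> r = 0"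
        using ray_vector_det_rows[OF r(1) S(1)] a0(1) S(1) by (metis subsetD)
      have "spanning n E"
        by (rule nonsingular_rows_spanning[of n "a0 # qs"]) (use qs a0 a0r S in \<open>auto simp: E_def\<close>)
      moreover have "a \<bullet> s \<le> 2" if "a \<in> E" "s \<in> ray_vectors n E" for a s
        using le2[OF that(2) ES, of a] that(1) ES by auto
      moreover have "\<exists>i<n. odd (g $ i)" using k hc rc by (intro exI[of _ k]) (simp add: g_def)
      moreover have "in_cone E g" using ag0 ES by (auto simp: in_cone_def)
      moreover have "even (a \<bullet> g)" if "a \<in> E" for a using that ag ES by (auto simp: E_def)
      moreover have "E \<subseteq> carrier_vec n" "finite E" using ES S finite_subset[OF ES] by auto
      ultimately obtain s where s: "s \<in> ray_vectors n E" "\<exists>i<n. odd (s $ i)" "\<And>a. a \<in> E \<Longrightarrow> a \<bullet> g = 0 \<Longrightarrow> a \<bullet> s = 0"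
        using odd_ray_vector_in_minimal_face[of E n g] gc by blast
      have sc: "s \<in> carrier_vec n" using s(1) by (rule ray_vectors_carrier)
      obtain ps where ps: "length ps + 1 = n" "set ps \<subseteq> E" "s = cross_vec n ps \<or> s = - cross_vec n ps"
        using s(1) by (auto simp: ray_vectors_def)
      have rs_even: "even (r $ i + s $ i)" if "i < n" for i
      proof -
        obtain j where j: "j < n" "odd (s $ j)" using s(2) by blast
        show ?thesis
        proof (rule parity_class_unique[OF ps(1) _ ps(3) rc _ j k that])
          show "set ps \<subseteq> carrier_vec n" using ps(2) ES S(1) by blast
          show "even (a \<bullet> r)" if "a \<in> set ps" for a using that ps(2) by (auto simp: E_def)
        qed
      qed
      obtain v where v: "v \<in> carrier_vec n" "r + s = 2 \<cdot>\<^sub>v v"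
        using half_vec[of "r + s" n] rc sc rs_even by auto
      have av: "2 * (a \<bullet> v) = a \<bullet> r + a \<bullet> s" if "a \<in> S" for a
      proof -
        have "a \<bullet> (r + s) = a \<bullet> r + a \<bullet> s" using that S rc sc by (intro scalar_prod_add_distrib[of _ n]) auto
        then show ?thesis using v that S by auto
      qed
      have as0: "0 \<le> a \<bullet> s" if "a \<in> E" for a using s(1) that by (auto simp: ray_vectors_def in_cone_def)
      have as2: "\<bar>a \<bullet> s\<bar> \<le> 2" if "a \<in> S" for a using le2[OF s(1) ES that] .
      have as_par: "even (a \<bullet> r + a \<bullet> s)" if "a \<in> S" for a using av[OF that] by (metis dvd_triv_left)
      have as_odd: "\<bar>a \<bullet> s\<bar> \<le> 1" "a \<bullet> r = 1" if "a \<in> S" "a \<notin> E" for a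
      proof -
        have o: "odd (a \<bullet> r)" using that by (simp add: E_def)
        then have "a \<bullet> r \<noteq> 0" "a \<bullet> r \<noteq> 2" by auto
        then show "a \<bullet> r = 1" using ar0[OF that(1)] ar2[OF that(1)] by linarith
        have "odd (a \<bullet> s)" using o as_par[OF that(1)] by simp
        then have "a \<bullet> s \<noteq> 2" "a \<bullet> s \<noteq> - 2" by auto
        then show "\<bar>a \<bullet> s\<bar> \<le> 1" using as2[OF that(1)] by linarith
      qed
      \<comment> \<open>This says that \<open>h - v\<close> lies in the cone, as \<open>2 (h - v) = g - s\<close>. On odd rows \<open>g\<close> is odd, hence positive.\<close>
      have sg: "a \<bullet> s \<le> a \<bullet> g" if a: "a \<in> S" for a
      proof (cases "a \<in> E")
        case True
        then have "even (a \<bullet> g)" using ag[OF a] by (simp add: E_def)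
        then have "a \<bullet> g \<noteq> 1" by auto
        then show ?thesis using s(3)[OF True] ag0[OF a] as2[OF a] by (cases "a \<bullet> g = 0") auto
      next
        case False
        have "odd (a \<bullet> g)" using ag[OF a] as_odd(2)[OF a False] by simp
        then have "a \<bullet> g \<noteq> 0" by auto
        then show ?thesis using ag0[OF a] as_odd(1)[OF a False] by linarith
      qed
      have "in_cone S v"
        unfolding in_cone_def
      proof
        fix a assume a: "a \<in> S"
        show "0 \<le> a \<bullet> v" using av[OF a] as0[of a] ar0[OF a] as_odd[OF a] by (cases "a \<in> E") auto
      qed
      moreover have "in_cone S (h - v)"
        unfolding in_cone_def
      proof
        fix a assume a: "a \<in> S"
        show "0 \<le> a \<bullet> (h - v)" using diff[OF a hc v(1)] av[OF a] sg[OF a] ag[OF a] by simp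
      qed
      moreover have "v \<noteq> 0\<^sub>v n"
      proof
        assume "v = 0\<^sub>v n"
        then have "a0 \<bullet> v = 0" using a0(1) S by auto
        moreover have "0 \<le> a0 \<bullet> s" using as0[of a0] a0(1) a0r by (simp add: E_def)
        ultimately show False using av[OF a0(1)] a0r by simp
      qed
      ultimately have "v = h" using irr[OF v(1)] by blast
      have "in_cone S s"
        unfolding in_cone_def
      proof
        fix a assume a: "a \<in> S"
        show "0 \<le> a \<bullet> s" using av[OF a] ag[OF a] ag0[OF a] \<open>v = h\<close> by simp
      qed
      then have "s \<in> ray_vectors n S" using ps ES by (auto simp: ray_vectors_def)
      then show ?thesis using that[of r s] r(1) v \<open>v = h\<close> by simp
    qed
  qed
qed

section \<open>Convex combinations with the origin\<close>

lemma conv_member: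
  assumes "x \<in> S" "x \<in> carrier_vec n"
  shows "x \<in> conv n S"
  unfolding conv_def
  by (rule CollectI, rule exI[of _ "{x}"], rule exI[of _ "\<lambda>_. 1"]) (use assms in auto)

text \<open>Convexity of the hull, with the missing weight \<open>1 - sum w K\<close> put on the origin.\<close>

lemma conv_combination:
  assumes K: "finite K" "\<And>\<kappa>. \<kappa> \<in> K \<Longrightarrow> 0 \<le> w \<kappa>" "sum w K \<le> 1"
    and g: "\<And>\<kappa>. \<kappa> \<in> K \<Longrightarrow> g \<kappa> \<in> conv n (insert (0\<^sub>v n) R)"
    and h: "h \<in> carrier_vec n" "\<And>j. j < n \<Longrightarrow> h $ j = (\<Sum>\<kappa>\<in>K. w \<kappa> * g \<kappa> $ j)"
  shows "h \<in> conv n (insert (0\<^sub>v n) R)"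
proof -
  define Q where "Q \<kappa> T a \<longleftrightarrow> finite T \<and> T \<subseteq> insert (0\<^sub>v n) R \<and> (\<forall>x\<in>T. 0 \<le> a x) \<and> sum a T = 1 \<and>
      g \<kappa> = vec n (\<lambda>j. \<Sum>x\<in>T. a x * x $ j)" for \<kappa> T a
  have "\<forall>\<kappa>\<in>K. \<exists>T a. Q \<kappa> T a"
  proof
    fix \<kappa> assume "\<kappa> \<in> K"
    from g[OF this] show "\<exists>T a. Q \<kappa> T a" unfolding conv_def Q_def by blast
  qed
  from bchoice[OF this] obtain T where "\<forall>\<kappa>\<in>K. \<exists>a. Q \<kappa> (T \<kappa>) a" by blast
  from bchoice[OF this] obtain a where Q: "\<forall>\<kappa>\<in>K. Q \<kappa> (T \<kappa>) (a \<kappa>)" by blast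
  have T: "finite (T \<kappa>)" "T \<kappa> \<subseteq> insert (0\<^sub>v n) R" and a: "\<And>x. x \<in> T \<kappa> \<Longrightarrow> 0 \<le> a \<kappa> x" "sum (a \<kappa>) (T \<kappa>) = 1"
    and ga: "g \<kappa> = vec n (\<lambda>j. \<Sum>x\<in>T \<kappa>. a \<kappa> x * x $ j)" if "\<kappa> \<in> K" for \<kappa>
    using Q that by (simp_all add: Q_def)
  define U where "U = insert (0\<^sub>v n) (\<Union>\<kappa>\<in>K. T \<kappa>)"
  define \<delta> where "\<delta> x = (if x = 0\<^sub>v n then 1 - sum w K else 0)" for x :: "real vec"
  define b where "b x = (\<Sum>\<kappa>\<in>K. if x \<in> T \<kappa> then w \<kappa> * a \<kappa> x else 0) + \<delta> x" for x
  have U: "finite U" "U \<subseteq> insert (0\<^sub>v n) R" using T K by (auto simp: U_def)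
  have b0: "0 \<le> b x" for x
    unfolding b_def \<delta>_def using K a by (intro add_nonneg_nonneg sum_nonneg) auto
  have key: "(\<Sum>x\<in>U. b x * f x) = (\<Sum>\<kappa>\<in>K. w \<kappa> * (\<Sum>x\<in>T \<kappa>. a \<kappa> x * f x)) + (1 - sum w K) * f (0\<^sub>v n)"
    for f :: "real vec \<Rightarrow> real"
  proof -
    have "(\<Sum>x\<in>U. b x * f x) = (\<Sum>x\<in>U. \<Sum>\<kappa>\<in>K. if x \<in> T \<kappa> then w \<kappa> * a \<kappa> x * f x else 0) + (\<Sum>x\<in>U. \<delta> x * f x)"
      by (simp add: b_def distrib_right sum.distrib sum_distrib_right if_distrib[of "\<lambda>t. t * _"] cong: if_cong)
    also have "(\<Sum>x\<in>U. \<delta> x * f x) = (\<Sum>x\<in>{0\<^sub>v n}. \<delta> x * f x)"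
      by (rule sum.mono_neutral_right) (use U in \<open>auto simp: U_def \<delta>_def\<close>)
    also have "\<dots> = (1 - sum w K) * f (0\<^sub>v n)" by (simp add: \<delta>_def)
    also have "(\<Sum>x\<in>U. \<Sum>\<kappa>\<in>K. if x \<in> T \<kappa> then w \<kappa> * a \<kappa> x * f x else 0) =
        (\<Sum>\<kappa>\<in>K. \<Sum>x\<in>U. if x \<in> T \<kappa> then w \<kappa> * a \<kappa> x * f x else 0)" by (rule sum.swap)
    also have "\<dots> = (\<Sum>\<kappa>\<in>K. w \<kappa> * (\<Sum>x\<in>T \<kappa>. a \<kappa> x * f x))"
    proof (rule sum.cong[OF refl])
      fix \<kappa> assume k: "\<kappa> \<in> K"
      have "(\<Sum>x\<in>U. if x \<in> T \<kappa> then w \<kappa> * a \<kappa> x * f x else 0) = (\<Sum>x\<in>T \<kappa>. w \<kappa> * a \<kappa> x * f x)"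
        using k U(1) by (intro sum.mono_neutral_cong_right) (auto simp: U_def)
      then show "(\<Sum>x\<in>U. if x \<in> T \<kappa> then w \<kappa> * a \<kappa> x * f x else 0) = w \<kappa> * (\<Sum>x\<in>T \<kappa>. a \<kappa> x * f x)"
        by (simp add: sum_distrib_left mult.assoc)
    qed
    finally show ?thesis .
  qed
  have "sum b U = 1"
    using key[of "\<lambda>_. 1"] a(2) by simp
  moreover have "h = vec n (\<lambda>j. \<Sum>x\<in>U. b x * x $ j)"
  proof (rule eq_vecI)
    fix j assume "j < dim_vec (vec n (\<lambda>j. \<Sum>x\<in>U. b x * x $ j))"
    then have j: "j < n" by simp
    have "h $ j = (\<Sum>\<kappa>\<in>K. w \<kappa> * (\<Sum>x\<in>T \<kappa>. a \<kappa> x * x $ j))"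
      unfolding h(2)[OF j] using ga j by (intro sum.cong) auto
    then show "h $ j = vec n (\<lambda>j. \<Sum>x\<in>U. b x * x $ j) $ j"
      using key[of "\<lambda>x. x $ j"] j by simp
  qed (use h in auto)
  ultimately show ?thesis
    unfolding conv_def using U b0 by blast
qed

lemma conv_insert_zero_mono:
  assumes "\<And>x. x \<in> R \<Longrightarrow> x \<in> conv n (insert (0\<^sub>v n) R')" and h: "h \<in> conv n (insert (0\<^sub>v n) R)"
  shows "h \<in> conv n (insert (0\<^sub>v n) R')"
proof -
  obtain T a where T: "finite T" "T \<subseteq> insert (0\<^sub>v n) R" "\<forall>x\<in>T. 0 \<le> a x" "sum a T = 1"
    and ha: "h = vec n (\<lambda>j. \<Sum>x\<in>T. a x * x $ j)" using h by (auto simp: conv_def)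
  show ?thesis
    by (rule conv_combination[of T a "\<lambda>x. x"]) (use T ha assms(1) conv_member[of "0\<^sub>v n"] in auto)
qed

text \<open>To recognize \<open>h\<close> as a combination of ray vectors it suffices to compare the values of all rows, because the
  rows are spanning. The weights are integers with the common denominator \<open>N\<close>.\<close>

lemma hull_of_weighted_rays:
  fixes \<omega> :: "'k \<Rightarrow> int" and c :: "'k \<Rightarrow> int vec"
  assumes S: "S \<subseteq> carrier_vec n" "spanning n S" and h: "h \<in> carrier_vec n"
    and K: "finite K" "\<And>\<kappa>. \<kappa> \<in> K \<Longrightarrow> c \<kappa> \<in> insert (0\<^sub>v n) (ray_vectors n S)"
    and \<omega>: "\<And>\<kappa>. \<kappa> \<in> K \<Longrightarrow> 0 \<le> \<omega> \<kappa>" "sum \<omega> K \<le> N" "0 < N"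
    and eq: "\<And>a. a \<in> S \<Longrightarrow> (\<Sum>\<kappa>\<in>K. \<omega> \<kappa> * (a \<bullet> c \<kappa>)) = N * (a \<bullet> h)"
  shows "real_vec h \<in> conv n (insert (0\<^sub>v n) (real_vec ` ray_vectors n S))"
proof -
  have cc: "c \<kappa> \<in> carrier_vec n" if "\<kappa> \<in> K" for \<kappa>
    using K(2)[OF that] by (auto dest: ray_vectors_carrier)
  define v where "v = vec n (\<lambda>j. \<Sum>\<kappa>\<in>K. \<omega> \<kappa> * c \<kappa> $ j)"
  have vc: "v \<in> carrier_vec n" by (simp add: v_def)
  have av: "a \<bullet> v = N * (a \<bullet> h)" if a: "a \<in> S" for a
  proof -
    have "a \<bullet> v = (\<Sum>j = 0..<n. \<Sum>\<kappa>\<in>K. \<omega> \<kappa> * (a $ j * c \<kappa> $ j))"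
      by (simp add: v_def scalar_prod_def sum_distrib_left mult.left_commute)
    also have "\<dots> = (\<Sum>\<kappa>\<in>K. \<Sum>j = 0..<n. \<omega> \<kappa> * (a $ j * c \<kappa> $ j))" by (rule sum.swap)
    also have "\<dots> = (\<Sum>\<kappa>\<in>K. \<omega> \<kappa> * (a \<bullet> c \<kappa>))"
    proof (rule sum.cong[OF refl])
      fix \<kappa> assume "\<kappa> \<in> K"
      from cc[OF this] show "(\<Sum>j = 0..<n. \<omega> \<kappa> * (a $ j * c \<kappa> $ j)) = \<omega> \<kappa> * (a \<bullet> c \<kappa>)"
        by (simp add: scalar_prod_def sum_distrib_left)
    qed
    finally show ?thesis using eq[OF a] by simp
  qed
  have "1 \<cdot>\<^sub>v v - N \<cdot>\<^sub>v h = 0\<^sub>v n"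
  proof -
    have "a \<bullet> (1 \<cdot>\<^sub>v v - N \<cdot>\<^sub>v h) = 0" if a: "a \<in> S" for a
    proof -
      have ac: "a \<in> carrier_vec n" using a S by auto
      show ?thesis unfolding scalar_prod_diff_smult[OF ac vc h] av[OF a] by simp
    qed
    moreover have "1 \<cdot>\<^sub>v v - N \<cdot>\<^sub>v h \<in> carrier_vec n" using vc h by simp
    ultimately show ?thesis using S(2) unfolding spanning_def by blast
  qed
  have vh: "v $ j = N * h $ j" if j: "j < n" for j
  proof -
    have "(1 \<cdot>\<^sub>v v - N \<cdot>\<^sub>v h) $ j = v $ j - N * h $ j" using j h vc by simp
    then show ?thesis unfolding \<open>1 \<cdot>\<^sub>v v - N \<cdot>\<^sub>v h = 0\<^sub>v n\<close> using j by simp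
  qed
  show ?thesis
  proof (rule conv_combination[of K "\<lambda>\<kappa>. real_of_int (\<omega> \<kappa>) / real_of_int N" "\<lambda>\<kappa>. real_vec (c \<kappa>)"])
    show "finite K" by (rule K(1))
    show "0 \<le> real_of_int (\<omega> \<kappa>) / real_of_int N" if "\<kappa> \<in> K" for \<kappa> using \<omega>(1)[OF that] \<omega>(3) by simp
    have "real_of_int (sum \<omega> K) \<le> real_of_int N" using \<omega>(2) by (simp only: of_int_le_iff)
    then show "(\<Sum>\<kappa>\<in>K. real_of_int (\<omega> \<kappa>) / real_of_int N) \<le> 1"
      using \<omega>(3) by (simp flip: sum_divide_distrib)
    show "real_vec (c \<kappa>) \<in> conv n (insert (0\<^sub>v n) (real_vec ` ray_vectors n S))" if "\<kappa> \<in> K" for \<kappa>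
    proof (rule conv_member)
      have "real_vec (0\<^sub>v n) = 0\<^sub>v n" by auto
      then show "real_vec (c \<kappa>) \<in> insert (0\<^sub>v n) (real_vec ` ray_vectors n S)"
        using K(2)[OF that] by (metis image_insert imageI)
    qed (use cc[OF that] in simp)
    show "real_vec h \<in> carrier_vec n" using h by simp
    fix j assume j: "j < n"
    have "N * h $ j = (\<Sum>\<kappa>\<in>K. \<omega> \<kappa> * c \<kappa> $ j)" using vh[OF j] j by (simp add: v_def)
    then have "real_of_int N * real_of_int (h $ j) = (\<Sum>\<kappa>\<in>K. real_of_int (\<omega> \<kappa>) * real_of_int (c \<kappa> $ j))"
      by (simp flip: of_int_mult of_int_sum)
    also have "\<dots> = (\<Sum>\<kappa>\<in>K. real_of_int (\<omega> \<kappa>) * real_vec (c \<kappa>) $ j)"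
    proof (rule sum.cong[OF refl])
      fix \<kappa> assume "\<kappa> \<in> K"
      from cc[OF this] show "real_of_int (\<omega> \<kappa>) * real_of_int (c \<kappa> $ j) = real_of_int (\<omega> \<kappa>) * real_vec (c \<kappa>) $ j"
        using j by simp
    qed
    finally have e: "real_of_int N * real_of_int (h $ j) = (\<Sum>\<kappa>\<in>K. real_of_int (\<omega> \<kappa>) * real_vec (c \<kappa>) $ j)" .
    have "real_vec h $ j = (\<Sum>\<kappa>\<in>K. real_of_int (\<omega> \<kappa>) * real_vec (c \<kappa>) $ j) / real_of_int N"
      unfolding e[symmetric] using \<omega>(3) j h by simp
    then show "real_vec h $ j = (\<Sum>\<kappa>\<in>K. real_of_int (\<omega> \<kappa>) / real_of_int N * real_vec (c \<kappa>) $ j)"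
      by (simp add: sum_divide_distrib)
  qed
qed

section \<open>Decomposition into irreducible elements\<close>

definition vsum :: "nat \<Rightarrow> int vec list \<Rightarrow> int vec" where
  "vsum n bs = foldr (+) bs (0\<^sub>v n)"

lemma vsum_simps [simp]: "vsum n [] = 0\<^sub>v n" "vsum n (b # bs) = b + vsum n bs"
  by (simp_all add: vsum_def)

lemma vsum_carrier [simp]: "set bs \<subseteq> carrier_vec n \<Longrightarrow> vsum n bs \<in> carrier_vec n"
  by (induction bs) auto

lemma vsum_append:
  "set bs \<subseteq> carrier_vec n \<Longrightarrow> set cs \<subseteq> carrier_vec n \<Longrightarrow> vsum n (bs @ cs) = vsum n bs + vsum n cs"
  by (induction bs) (auto intro!: assoc_add_vec[symmetric])

lemma scalar_prod_vsum:
  assumes "a \<in> carrier_vec n" "set bs \<subseteq> carrier_vec n"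
  shows "a \<bullet> vsum n bs = (\<Sum>b\<leftarrow>bs. a \<bullet> b)"
  using assms(2)
proof (induction bs)
  case (Cons b bs)
  then have "a \<bullet> (b + vsum n bs) = a \<bullet> b + a \<bullet> vsum n bs"
    using assms(1) by (intro scalar_prod_add_distrib[of _ n]) auto
  then show ?case using Cons by simp
qed (use assms in simp)

text \<open>The cone is pointed, so nonzero elements cannot cancel.\<close>

lemma vsum_cone_nonzero:
  assumes S: "S \<subseteq> carrier_vec n" "spanning n S"
    and bs: "bs \<noteq> []" "\<And>b. b \<in> set bs \<Longrightarrow> b \<in> carrier_vec n \<and> b \<noteq> 0\<^sub>v n \<and> in_cone S b"
  shows "vsum n bs \<noteq> 0\<^sub>v n"
proof
  assume z: "vsum n bs = 0\<^sub>v n"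
  obtain b where b: "b \<in> set bs" using bs(1) by (cases bs) auto
  then obtain a where a: "a \<in> S" "a \<bullet> b \<noteq> 0" using S(2) bs(2)[OF b] by (metis spanning_def)
  have "a \<bullet> vsum n bs = (\<Sum>b\<leftarrow>bs. a \<bullet> b)" by (rule scalar_prod_vsum) (use a S bs in auto)
  then have "(\<Sum>b\<leftarrow>bs. a \<bullet> b) = 0" using z a(1) S(1) by auto
  moreover have "\<forall>t\<in>set (map (\<lambda>b. a \<bullet> b) bs). 0 \<le> t" using a(1) bs(2) by (auto simp: in_cone_def)
  ultimately have "\<forall>t\<in>set (map (\<lambda>b. a \<bullet> b) bs). t = 0"
    using sum_list_nonneg_eq_0_iff[of "map (\<lambda>b. a \<bullet> b) bs"] by auto
  then show False using a(2) b by auto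
qed

text \<open>Splitting terminates because the sum of all slacks is positive on every nonzero element of the cone.\<close>

lemma irreducible_decomposition:
  assumes S: "S \<subseteq> carrier_vec n" "finite S" "spanning n S"
    and x: "x \<in> carrier_vec n" "in_cone S x"
  obtains bs where "\<And>b. b \<in> set bs \<Longrightarrow> irreducible_in_cone n S b" "x = vsum n bs"
proof -
  have pos: "0 < (\<Sum>a\<in>S. a \<bullet> y)" if y: "y \<in> carrier_vec n" "in_cone S y" "y \<noteq> 0\<^sub>v n" for y
  proof -
    obtain a where "a \<in> S" "a \<bullet> y \<noteq> 0" using S(3) y by (metis spanning_def)
    then show ?thesis using y(2) S(2) by (intro sum_pos2[of _ a]) (force simp: in_cone_def)+
  qed
  have "\<exists>bs. (\<forall>b\<in>set bs. irreducible_in_cone n S b) \<and> x = vsum n bs" using x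
  proof (induction "nat (\<Sum>a\<in>S. a \<bullet> x)" arbitrary: x rule: less_induct)
    case (less x)
    show ?case
    proof (cases "x = 0\<^sub>v n \<or> irreducible_in_cone n S x")
      case True
      then show ?thesis
      proof
        assume "x = 0\<^sub>v n" then show ?thesis by (intro exI[of _ "[]"]) simp
      next
        assume "irreducible_in_cone n S x" then show ?thesis
          using less.prems(1) by (intro exI[of _ "[x]"]) simp
      qed
    next
      case False
      then obtain z where z: "z \<in> carrier_vec n" "in_cone S z" "in_cone S (x - z)" "z \<noteq> 0\<^sub>v n" "z \<noteq> x"
        using less.prems by (auto simp: irreducible_in_cone_def)
      define y where "y = x - z"
      have y: "y \<in> carrier_vec n" "in_cone S y" using z less.prems(1) by (auto simp: y_def)
      have ynz: "y \<noteq> 0\<^sub>v n"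
      proof
        assume "y = 0\<^sub>v n"
        then have "x $ i = z $ i" if "i < n" for i
        proof -
          have "y $ i = 0" using \<open>y = 0\<^sub>v n\<close> that by simp
          moreover have "y $ i = x $ i - z $ i" unfolding y_def using that z(1) by simp
          ultimately show ?thesis by simp
        qed
        then show False using z(1,5) less.prems(1) by auto
      qed
      have split: "a \<bullet> x = a \<bullet> z + a \<bullet> y" if "a \<in> S" for a
      proof -
        have "a \<bullet> y = a \<bullet> x - a \<bullet> z" unfolding y_def
          using that S z(1) less.prems(1) by (intro scalar_prod_minus_distrib[of _ n]) auto
        then show ?thesis by simp
      qed
      have tot: "(\<Sum>a\<in>S. a \<bullet> x) = (\<Sum>a\<in>S. a \<bullet> z) + (\<Sum>a\<in>S. a \<bullet> y)"
        by (simp add: split sum.distrib)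
      have "nat (\<Sum>a\<in>S. a \<bullet> z) < nat (\<Sum>a\<in>S. a \<bullet> x)" "nat (\<Sum>a\<in>S. a \<bullet> y) < nat (\<Sum>a\<in>S. a \<bullet> x)"
        using tot pos[OF y ynz] pos[OF z(1,2,4)] by auto
      then obtain bs cs where bc: "\<forall>b\<in>set bs. irreducible_in_cone n S b" "z = vsum n bs"
          "\<forall>b\<in>set cs. irreducible_in_cone n S b" "y = vsum n cs"
        using less.hyps[of z] less.hyps[of y] z y by metis
      have "x = z + y" unfolding y_def using z(1) less.prems(1) by auto
      also have "\<dots> = vsum n (bs @ cs)" unfolding bc(2,4)
        by (rule vsum_append[symmetric]) (use bc in \<open>auto simp: irreducible_in_cone_def\<close>)
      finally show ?thesis using bc by (intro exI[of _ "bs @ cs"]) auto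
    qed
  qed
  then show ?thesis using that by blast
qed

section \<open>Cones whose minors are zero, one or two times a constant\<close>

text \<open>If no minor is \<open>\<plusminus> k\<close>, then all nonzero minors are \<open>\<plusminus> 2 k\<close>; in both cases a nonzero minor of least
  absolute value divides all others and is at least half as large.\<close>

lemma basis_of_minimal_minor:
  fixes k :: int
  assumes S: "S \<subseteq> carrier_vec n" "spanning n S" and "k \<ge> 1"
    and minors: "\<And>xs. length xs = n \<Longrightarrow> set xs \<subseteq> S \<Longrightarrow> det_rows n xs \<in> {0, k, - k, 2 * k, - 2 * k}"
  obtains bs where "length bs = n" "set bs \<subseteq> S" "det_rows n bs \<noteq> 0"
    and "\<And>xs. length xs = n \<Longrightarrow> set xs \<subseteq> S \<Longrightarrow>
      det_rows n bs dvd det_rows n xs \<and> \<bar>det_rows n xs\<bar> \<le> 2 * \<bar>det_rows n bs\<bar>"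
proof (cases "\<exists>bs. length bs = n \<and> set bs \<subseteq> S \<and> (det_rows n bs = k \<or> det_rows n bs = - k)")
  case True
  then obtain bs where bs: "length bs = n" "set bs \<subseteq> S" "det_rows n bs = k \<or> det_rows n bs = - k" by blast
  show ?thesis
  proof (rule that[OF bs(1,2)])
    fix xs :: "int vec list" assume "length xs = n" "set xs \<subseteq> S"
    from minors[OF this] show "det_rows n bs dvd det_rows n xs \<and> \<bar>det_rows n xs\<bar> \<le> 2 * \<bar>det_rows n bs\<bar>"
      using bs(3) \<open>k \<ge> 1\<close> by auto
  qed (use bs \<open>k \<ge> 1\<close> in auto)
next
  case False
  obtain bs where bs: "length bs = n" "set bs \<subseteq> S" "det_rows n bs \<noteq> 0"
    using spanning_nonsingular_rows[OF S] by metis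
  then have dbs: "det_rows n bs = 2 * k \<or> det_rows n bs = - 2 * k" using minors[OF bs(1,2)] False by auto
  show ?thesis
  proof (rule that[OF bs])
    fix xs :: "int vec list" assume xs: "length xs = n" "set xs \<subseteq> S"
    from minors[OF xs] False xs have "det_rows n xs \<in> {0, 2 * k, - 2 * k}" by auto
    then show "det_rows n bs dvd det_rows n xs \<and> \<bar>det_rows n xs\<bar> \<le> 2 * \<bar>det_rows n bs\<bar>"
      using dbs \<open>k \<ge> 1\<close> by auto
  qed
qed

text \<open>Cramer's rule: the coordinates of the row \<open>a\<close> in the basis \<open>bs\<close> are quotients of two minors.\<close>

lemma coordinates_in_basis:
  fixes bs :: "int vec list"
  assumes bs: "length bs = n" "set bs \<subseteq> carrier_vec n" "det_rows n bs \<noteq> 0"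
    and a: "a \<in> carrier_vec n"
    and dvd: "\<And>i. i < n \<Longrightarrow> det_rows n bs dvd det_rows n (bs[i := a])"
  obtains a' where "a' \<in> carrier_vec n"
    "\<And>x. x \<in> carrier_vec n \<Longrightarrow> a' \<bullet> (mat_of_rows n bs *\<^sub>v x) = a \<bullet> x"
proof -
  define B where "B = mat_of_rows n bs"
  have B: "B \<in> carrier_mat n n" using bs by (simp add: B_def mat_of_rows_def)
  note adj = adj_mat[OF B]
  define t where "t = (adj_mat B)\<^sup>T *\<^sub>v a"
  have tc: "t \<in> carrier_vec n" using adj(1) a by (auto simp: t_def)
  have ti: "t $ i = det_rows n (bs[i := a])" if i: "i < n" for i
  proof -
    let ?M = "mat_of_rows n (bs[i := a])"
    have M: "?M \<in> carrier_mat n n" using bs by (simp add: mat_of_rows_def)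
    have "det ?M = (\<Sum>j<n. ?M $$ (i, j) * cofactor ?M i j)" by (rule laplace_expansion_row[OF M i])
    also have "\<dots> = (\<Sum>j<n. cofactor B i j * a $ j)"
    proof (rule sum.cong[OF refl])
      fix j assume "j \<in> {..<n}"
      moreover have "mat_delete ?M i j = mat_delete B i j"
        using bs i by (auto simp: mat_delete_def mat_of_rows_def B_def intro!: eq_matI)
      ultimately show "?M $$ (i, j) * cofactor ?M i j = cofactor B i j * a $ j"
        using i bs by (simp add: cofactor_def mat_of_rows_index)
    qed
    also have "\<dots> = t $ i"
      using i B a adj(1) by (simp add: t_def mult_mat_vec_def scalar_prod_def adj_mat_def atLeast0LessThan)
    finally show ?thesis by (simp add: det_rows_def)
  qed
  define a' where "a' = vec n (\<lambda>i. t $ i div det_rows n bs)"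
  have ta': "t = det_rows n bs \<cdot>\<^sub>v a'"
    using tc ti dvd by (auto simp: a'_def vec_eq_iff)
  show ?thesis
  proof (rule that[of a'])
    show a'c: "a' \<in> carrier_vec n" by (simp add: a'_def)
    fix x :: "int vec" assume x: "x \<in> carrier_vec n"
    have Bx: "B *\<^sub>v x \<in> carrier_vec n" using B x by simp
    have "det_rows n bs * (a' \<bullet> (B *\<^sub>v x)) = t \<bullet> (B *\<^sub>v x)"
      using ta' a'c Bx by simp
    also have "\<dots> = a \<bullet> (adj_mat B *\<^sub>v (B *\<^sub>v x))"
      unfolding t_def by (rule transpose_vec_mult_scalar[OF adj(1) Bx a])
    also have "adj_mat B *\<^sub>v (B *\<^sub>v x) = (det B \<cdot>\<^sub>m 1\<^sub>m n) *\<^sub>v x"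
      using assoc_mult_mat_vec[OF adj(1) B x] by (simp only: adj(3))
    also have "\<dots> = det B \<cdot>\<^sub>v x"
      by (rule eq_vecI) (use x in \<open>auto simp: row_smult smult_scalar_prod_distrib[of _ n]\<close>)
    also have "a \<bullet> (det B \<cdot>\<^sub>v x) = det_rows n bs * (a \<bullet> x)"
      using a x by (simp add: B_def det_rows_def)
    finally show "a' \<bullet> (mat_of_rows n bs *\<^sub>v x) = a \<bullet> x" using bs(3) by (simp add: B_def)
  qed
qed

lemma det_rows_in_coordinates:
  fixes f :: "int vec \<Rightarrow> int vec"
  assumes bs: "length bs = n" and f: "\<And>a. a \<in> S \<Longrightarrow> f a \<in> carrier_vec n"
    "\<And>a x. a \<in> S \<Longrightarrow> x \<in> carrier_vec n \<Longrightarrow> f a \<bullet> (mat_of_rows n bs *\<^sub>v x) = a \<bullet> x"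
    and S: "S \<subseteq> carrier_vec n" and xs: "length xs = n" "set xs \<subseteq> S"
  shows "det_rows n xs = det_rows n (map f xs) * det_rows n bs"
proof -
  let ?B = "mat_of_rows n bs" and ?X = "mat_of_rows n (map f xs)"
  have B: "?B \<in> carrier_mat n n" and X: "?X \<in> carrier_mat n n"
    using bs xs by (simp_all add: mat_of_rows_def)
  have "mat_of_rows n xs = ?X * ?B"
  proof (rule eq_matI)
    fix i j assume "i < dim_row (?X * ?B)" "j < dim_col (?X * ?B)"
    then have ij: "i < n" "j < n" using xs by auto
    have xi: "xs ! i \<in> S" using xs ij by auto
    have "?B *\<^sub>v unit_vec n j = col ?B j"
      by (rule eq_vecI) (use ij B bs in auto)
    then have "f (xs ! i) \<bullet> col ?B j = xs ! i \<bullet> unit_vec n j"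
      using f(2)[OF xi, of "unit_vec n j"] by simp
    also have "\<dots> = xs ! i $ j" using ij xi S by auto
    finally show "mat_of_rows n xs $$ (i, j) = (?X * ?B) $$ (i, j)"
      using ij xs X B f(1)[OF xi] by (simp add: mat_of_rows_index)
  qed (use xs in auto)
  then show ?thesis unfolding det_rows_def using det_mult[OF X B] by simp
qed

text \<open>If \<open>c'\<close> is built from the coordinate rows \<open>f a\<close>, then the cross product of the corresponding original rows is the preimage of
  \<open>\<plusminus> det B \<cdot> c'\<close> under \<open>B\<close>, since determinants are multiplicative.\<close>

lemma ray_vector_pullback:
  fixes f :: "int vec \<Rightarrow> int vec"
  assumes bs: "length bs = n" and f: "\<And>a. a \<in> S \<Longrightarrow> f a \<in> carrier_vec n"
    "\<And>a x. a \<in> S \<Longrightarrow> x \<in> carrier_vec n \<Longrightarrow> f a \<bullet> (mat_of_rows n bs *\<^sub>v x) = a \<bullet> x"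
    and S: "S \<subseteq> carrier_vec n" and c': "c' \<in> insert (0\<^sub>v n) (ray_vectors n (f ` S))"
  obtains c where "c \<in> insert (0\<^sub>v n) (ray_vectors n S)"
    "\<And>a. a \<in> S \<Longrightarrow> a \<bullet> c = \<bar>det_rows n bs\<bar> * (f a \<bullet> c')"
proof (cases "c' = 0\<^sub>v n")
  case True
  have "a \<bullet> 0\<^sub>v n = \<bar>det_rows n bs\<bar> * (f a \<bullet> c')" if "a \<in> S" for a
    using True f(1)[OF that] S that by auto
  then show ?thesis using that[of "0\<^sub>v n"] by blast
next
  case False
  then have cone': "in_cone (f ` S) c'" and ex: "\<exists>qs'. length qs' + 1 = n \<and> set qs' \<subseteq> f ` S \<and> (c' = cross_vec n qs' \<or> c' = - cross_vec n qs')"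
    using c' by (auto simp: ray_vectors_def)
  then obtain qs' where qs': "length qs' + 1 = n" "set qs' \<subseteq> f ` S" "c' = cross_vec n qs' \<or> c' = - cross_vec n qs'"
    by blast
  from qs'(2) have "qs' \<in> lists (f ` S)" by auto
  then obtain qs where qs: "qs' = map f qs" "set qs \<subseteq> S" by (auto simp: lists_image)
  define D where "D = det_rows n bs"
  define c0 where "c0 = cross_vec n qs"
  have key: "a \<bullet> c0 = D * (f a \<bullet> cross_vec n qs')" if a: "a \<in> S" for a
  proof -
    have "a \<bullet> c0 = det_rows n (a # qs)"
      unfolding c0_def by (rule det_rows_Cons[symmetric]) (use qs qs' a S in auto)
    also have "\<dots> = det_rows n (map f (a # qs)) * D"
      unfolding D_def by (rule det_rows_in_coordinates[OF bs f S]) (use qs qs' a in auto)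
    also have "det_rows n (map f (a # qs)) = f a \<bullet> cross_vec n qs'"
      using det_rows_Cons[OF qs'(1) f(1)[OF a]] qs(1) by simp
    finally show ?thesis by simp
  qed
  \<comment> \<open>Two signs are corrected at once: that of \<open>c'\<close> relative to its cross product and that of \<open>D\<close>.\<close>
  define c where "c = (if (c' = cross_vec n qs') = (0 \<le> D) then c0 else - c0)"
  have ac: "a \<bullet> c = \<bar>D\<bar> * (f a \<bullet> c')" if a: "a \<in> S" for a
  proof -
    have "a \<in> carrier_vec n" using a S by auto
    then show ?thesis
      using key[OF a] qs'(3) f(1)[OF a] by (cases "c' = cross_vec n qs'") (auto simp: c_def c0_def)
  qed
  have "in_cone S c" using ac cone' by (auto simp: in_cone_def)
  then have "c \<in> ray_vectors n S"
    unfolding ray_vectors_def using qs qs'(1) by (auto simp: c_def c0_def intro!: exI[of _ qs])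
  then show ?thesis using that[of c] ac by (simp add: D_def)
qed

text \<open>A pigeonhole over the proper prefix sums, the empty one included; this leaves a nonempty rest \<open>ws\<close>.\<close>

lemma zero_sum_block:
  fixes B :: "int mat"
  assumes B: "B \<in> carrier_mat n n" "det B \<noteq> 0" and bs: "set bs \<subseteq> carrier_vec n"
    and long: "\<bar>det B\<bar> < int (length bs)"
  obtains us vs ws z where "bs = us @ vs @ ws" "vs \<noteq> []" "ws \<noteq> []" "z \<in> carrier_vec n" "vsum n vs = B *\<^sub>v z"
proof -
  define f where "f i = vsum n (take i bs)" for i
  have fc: "f i \<in> carrier_vec n" for i
    unfolding f_def using bs set_take_subset[of i bs] by (intro vsum_carrier) blast
  obtain i j z where ijz: "i \<in> {..<length bs}" "j \<in> {..<length bs}" "i \<noteq> j" "z \<in> carrier_vec n" "f i - f j = B *\<^sub>v z"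
    by (rule congruent_pair_exists[OF B, of "{..<length bs}" f]) (use long fc in auto)
  obtain i j z where ij: "j < i" "i < length bs" and z: "z \<in> carrier_vec n" "f i - f j = B *\<^sub>v z"
  proof (cases "j < i")
    case True then show ?thesis using that ijz by auto
  next
    case False
    have "f j - f i = - (f i - f j)" using fc[of i] fc[of j] by auto
    also have "\<dots> = B *\<^sub>v (- z)" unfolding ijz(5) using B(1) ijz(4) by auto
    finally show ?thesis using that[of i j "- z"] False ijz by auto
  qed
  define us vs ws where "us = take j bs" and "vs = drop j (take i bs)" and "ws = drop i bs"
  have tk: "take i bs = us @ vs" using ij(1) unfolding us_def vs_def
    by (metis append_take_drop_id min.absorb1 less_imp_le take_take)
  have sub: "set us \<subseteq> carrier_vec n" "set vs \<subseteq> carrier_vec n"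
    using bs tk set_take_subset[of i bs] by (auto simp: us_def dest: in_set_takeD)
  have "f i = f j + vsum n vs" unfolding f_def tk
    using vsum_append[OF sub] by (simp add: us_def)
  then have "vsum n vs = f i - f j" using fc[of i] fc[of j] vsum_carrier[OF sub(2)] by auto
  then have "vsum n vs = B *\<^sub>v z" using z(2) by simp
  moreover have "bs = us @ vs @ ws"
    using tk append_take_drop_id[of i bs] by (simp add: ws_def)
  moreover have "length vs = i - j" "length ws = length bs - i" using ij by (simp_all add: vs_def ws_def)
  then have "vs \<noteq> []" "ws \<noteq> []" using ij by force+
  ultimately show ?thesis using that z(1) by blast
qed

text \<open>Passing to the coordinates of a basis \<open>bs\<close> of minimal determinant \<open>D\<close>: the image of \<open>h\<close> is a sum of at
  most \<open>\<bar>D\<bar>\<close> irreducible elements of the new cone, each of which is half the sum of two vectors that are ray vectors there or zero.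
  Pulling back multiplies ray vectors by \<open>\<bar>D\<bar>\<close>, so the weights are \<open>1 / (2 \<bar>D\<bar>)\<close>, for at most \<open>2 \<bar>D\<bar>\<close> terms.\<close>

lemma hull_of_bimodular_cone:
  fixes k :: int
  assumes S: "S \<subseteq> carrier_vec n" "finite S" "spanning n S" and "k \<ge> 1"
    and minors: "\<And>xs. length xs = n \<Longrightarrow> set xs \<subseteq> S \<Longrightarrow> det_rows n xs \<in> {0, k, - k, 2 * k, - 2 * k}"
    and h: "irreducible_in_cone n S h"
  shows "real_vec h \<in> conv n (insert (0\<^sub>v n) (real_vec ` ray_vectors n S))"
proof -
  obtain bs where bs: "length bs = n" "set bs \<subseteq> S" "det_rows n bs \<noteq> 0"
    and min: "\<And>xs. length xs = n \<Longrightarrow> set xs \<subseteq> S \<Longrightarrow>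
      det_rows n bs dvd det_rows n xs \<and> \<bar>det_rows n xs\<bar> \<le> 2 * \<bar>det_rows n bs\<bar>"
    using basis_of_minimal_minor[OF S(1,3) \<open>k \<ge> 1\<close> minors] by blast
  define D where "D = det_rows n bs"
  define B where "B = mat_of_rows n bs"
  have B: "B \<in> carrier_mat n n" "det B = D" using bs by (simp_all add: B_def D_def mat_of_rows_def det_rows_def)
  have D0: "D \<noteq> 0" using bs by (simp add: D_def)
  have "\<exists>a'. a' \<in> carrier_vec n \<and> (\<forall>x\<in>carrier_vec n. a' \<bullet> (B *\<^sub>v x) = a \<bullet> x)" if a: "a \<in> S" for a
  proof -
    have dv: "det_rows n bs dvd det_rows n (bs[i := a])" if "i < n" for i
    proof -
      have "set (bs[i := a]) \<subseteq> S"
        by (rule set_update_subsetI[OF bs(2) a])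
      moreover have "length (bs[i := a]) = n" using bs(1) by simp
      ultimately show ?thesis using min by blast
    qed
    have bsc: "set bs \<subseteq> carrier_vec n" and ac: "a \<in> carrier_vec n" using bs(2) S(1) a by auto
    obtain a' where "a' \<in> carrier_vec n" "\<And>x. x \<in> carrier_vec n \<Longrightarrow> a' \<bullet> (mat_of_rows n bs *\<^sub>v x) = a \<bullet> x"
      by (rule coordinates_in_basis[OF bs(1) bsc bs(3) ac dv]) (assumption, rule that)
    then show ?thesis unfolding B_def by (intro exI[of _ a']) simp
  qed
  then have "\<forall>a\<in>S. \<exists>a'. a' \<in> carrier_vec n \<and> (\<forall>x\<in>carrier_vec n. a' \<bullet> (B *\<^sub>v x) = a \<bullet> x)" by blast
  from bchoice[OF this] obtain f where f0: "\<forall>a\<in>S. f a \<in> carrier_vec n \<and> (\<forall>x\<in>carrier_vec n. f a \<bullet> (B *\<^sub>v x) = a \<bullet> x)"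
    by blast
  have f: "f a \<in> carrier_vec n" if "a \<in> S" for a using f0 that by blast
  have fB: "f a \<bullet> (B *\<^sub>v x) = a \<bullet> x" if "a \<in> S" "x \<in> carrier_vec n" for a x using f0 that by blast
  define S' where "S' = f ` S"
  have S': "S' \<subseteq> carrier_vec n" "finite S'" using f S by (auto simp: S'_def)
  have coord: "det_rows n xs = det_rows n (map f xs) * D" if "length xs = n" "set xs \<subseteq> S" for xs
    unfolding D_def by (rule det_rows_in_coordinates[OF bs(1) f fB[unfolded B_def] S(1) that])
  have sp': "spanning n S'"
  proof (rule nonsingular_rows_spanning[OF _ _ S'(1)])
    show "det_rows n (map f bs) \<noteq> 0" using coord[OF bs(1,2)] bs(3) by (metis mult_zero_left)
    show "set (map f bs) \<subseteq> S'" using bs(2) by (auto simp: S'_def)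
  qed
  have bimod: "\<bar>det_rows n ys\<bar> \<le> 2" if ys: "length ys = n" "set ys \<subseteq> S'" for ys
  proof -
    from ys(2) have "ys \<in> lists (f ` S)" by (auto simp: S'_def)
    then obtain xs where xs: "ys = map f xs" "set xs \<subseteq> S" by (auto simp: lists_image)
    then have lx: "length xs = n" using ys by simp
    have "\<bar>det_rows n ys\<bar> * \<bar>D\<bar> \<le> 2 * \<bar>D\<bar>"
      using coord[OF lx xs(2)] min[OF lx xs(2)] xs(1) by (simp only: abs_mult flip: D_def)
    then show ?thesis using D0 by simp
  qed
  have hc: "h \<in> carrier_vec n" and hcone: "in_cone S h"
    and irr: "\<And>z. z \<in> carrier_vec n \<Longrightarrow> in_cone S z \<Longrightarrow> in_cone S (h - z) \<Longrightarrow> z = 0\<^sub>v n \<or> z = h"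
    using h by (auto simp: irreducible_in_cone_def)
  have "B *\<^sub>v h \<in> carrier_vec n" using B(1) hc by simp
  moreover have "in_cone S' (B *\<^sub>v h)" using hcone fB hc by (auto simp: in_cone_def S'_def)
  ultimately obtain cs where cs: "\<And>b. b \<in> set cs \<Longrightarrow> irreducible_in_cone n S' b" "B *\<^sub>v h = vsum n cs"
    using irreducible_decomposition[OF S' sp'] by metis
  have csp: "b \<in> carrier_vec n \<and> b \<noteq> 0\<^sub>v n \<and> in_cone S' b" if "b \<in> set cs" for b
    using cs(1)[OF that] by (simp add: irreducible_in_cone_def)
  have csc: "set cs \<subseteq> carrier_vec n" using csp by blast
  \<comment> \<open>A longer decomposition would have a proper block in the sublattice, and hence split \<open>h\<close>.\<close>
  have short: "int (length cs) \<le> \<bar>D\<bar>"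
  proof (rule ccontr)
    assume "\<not> int (length cs) \<le> \<bar>D\<bar>"
    then have long: "\<bar>det B\<bar> < int (length cs)" using B(2) by simp
    have "det B \<noteq> 0" using B(2) D0 by simp
    from zero_sum_block[OF B(1) this csc long] obtain us vs ws z where
      split: "cs = us @ vs @ ws" "vs \<noteq> []" "ws \<noteq> []" and z: "z \<in> carrier_vec n" "vsum n vs = B *\<^sub>v z"
      by metis
    have sub: "set us \<subseteq> carrier_vec n" "set vs \<subseteq> carrier_vec n" "set ws \<subseteq> carrier_vec n"
      using csc split(1) by auto
    have nn: "0 \<le> f a \<bullet> vsum n bs'" if "a \<in> S" "set bs' \<subseteq> set cs" for a bs'
    proof -
      have "f a \<bullet> vsum n bs' = (\<Sum>b\<leftarrow>bs'. f a \<bullet> b)"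
        by (rule scalar_prod_vsum) (use f that csc in auto)
      also have "0 \<le> \<dots>" using that csp by (intro sum_list_nonneg) (force simp: in_cone_def S'_def)
      finally show ?thesis .
    qed
    have tot: "vsum n cs = vsum n vs + vsum n (us @ ws)"
    proof -
      have "vsum n cs = vsum n us + (vsum n vs + vsum n ws)"
        using sub by (simp add: split(1) vsum_append)
      also have "\<dots> = vsum n vs + (vsum n us + vsum n ws)"
        using sub by (intro eq_vecI) (auto simp: carrier_vecD[OF vsum_carrier] )
      also have "vsum n us + vsum n ws = vsum n (us @ ws)" using sub by (simp add: vsum_append)
      finally show ?thesis .
    qed
    have ahz: "a \<bullet> (h - z) = f a \<bullet> vsum n (us @ ws)" if a: "a \<in> S" for a
    proof -
      have "a \<bullet> (h - z) = a \<bullet> h - a \<bullet> z"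
        using a S(1) hc z(1) by (intro scalar_prod_minus_distrib[of _ n]) auto
      also have "\<dots> = f a \<bullet> vsum n cs - f a \<bullet> vsum n vs"
        using fB[OF a hc] fB[OF a z(1)] by (simp add: cs(2) z(2))
      also have "f a \<bullet> vsum n cs = f a \<bullet> vsum n vs + f a \<bullet> vsum n (us @ ws)"
        unfolding tot using f[OF a] sub by (intro scalar_prod_add_distrib[of _ n]) auto
      finally show ?thesis by simp
    qed
    have "in_cone S z"
      unfolding in_cone_def
    proof
      fix a assume a: "a \<in> S"
      show "0 \<le> a \<bullet> z" using nn[OF a, of vs] fB[OF a z(1)] z(2) split(1) by auto
    qed
    moreover have "in_cone S (h - z)"
      unfolding in_cone_def using ahz nn[of _ "us @ ws"] split(1) by auto
    ultimately have "z = 0\<^sub>v n \<or> z = h" using irr[OF z(1)] by blast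
    then show False
    proof
      assume "z = 0\<^sub>v n"
      then have "vsum n vs = 0\<^sub>v n" using z(2) B(1) by auto
      moreover have "vsum n vs \<noteq> 0\<^sub>v n"
        by (rule vsum_cone_nonzero[OF S'(1) sp' split(2)]) (use csp split(1) in auto)
      ultimately show False by simp
    next
      assume "z = h"
      have "c \<bullet> vsum n (us @ ws) = 0" if c: "c \<in> S'" for c
      proof -
        obtain a where a: "a \<in> S" "c = f a" using c by (auto simp: S'_def)
        have "a \<in> carrier_vec n" using a S by auto
        then have "a \<bullet> (h - z) = 0" using \<open>z = h\<close> hc by simp
        then show ?thesis using ahz[OF a(1)] a(2) by simp
      qed
      moreover have "vsum n (us @ ws) \<in> carrier_vec n" using sub by simp
      ultimately have "vsum n (us @ ws) = 0\<^sub>v n" using sp' by (simp add: spanning_def)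
      moreover have "vsum n (us @ ws) \<noteq> 0\<^sub>v n"
        by (rule vsum_cone_nonzero[OF S'(1) sp']) (use csp split in auto)
      ultimately show False by simp
    qed
  qed
  \<comment> \<open>Every summand is half the sum of two ray vectors; pull these back.\<close>
  have "\<forall>i. \<exists>p. i < length cs \<longrightarrow> fst p \<in> insert (0\<^sub>v n) (ray_vectors n S) \<and> snd p \<in> insert (0\<^sub>v n) (ray_vectors n S) \<and>
      (\<forall>a\<in>S. a \<bullet> fst p + a \<bullet> snd p = 2 * \<bar>D\<bar> * (f a \<bullet> cs ! i))"
  proof
    fix i
    show "\<exists>p. i < length cs \<longrightarrow> fst p \<in> insert (0\<^sub>v n) (ray_vectors n S) \<and> snd p \<in> insert (0\<^sub>v n) (ray_vectors n S) \<and>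
      (\<forall>a\<in>S. a \<bullet> fst p + a \<bullet> snd p = 2 * \<bar>D\<bar> * (f a \<bullet> cs ! i))"
    proof (cases "i < length cs")
      case True
      then have i: "irreducible_in_cone n S' (cs ! i)" using cs(1) by simp
      obtain r s where rs: "r \<in> insert (0\<^sub>v n) (ray_vectors n S')" "s \<in> insert (0\<^sub>v n) (ray_vectors n S')" "2 \<cdot>\<^sub>v (cs ! i) = r + s"
        by (rule bimodular_irreducible[OF S' sp' bimod i])
      have rsc: "r \<in> carrier_vec n" "s \<in> carrier_vec n" using rs by (auto dest: ray_vectors_carrier)
      obtain \<rho> where \<rho>: "\<rho> \<in> insert (0\<^sub>v n) (ray_vectors n S)" "\<And>a. a \<in> S \<Longrightarrow> a \<bullet> \<rho> = \<bar>D\<bar> * (f a \<bullet> r)"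
        using ray_vector_pullback[OF bs(1) f fB[unfolded B_def] S(1) rs(1)[unfolded S'_def]] unfolding D_def by blast
      obtain \<sigma> where \<sigma>: "\<sigma> \<in> insert (0\<^sub>v n) (ray_vectors n S)" "\<And>a. a \<in> S \<Longrightarrow> a \<bullet> \<sigma> = \<bar>D\<bar> * (f a \<bullet> s)"
        using ray_vector_pullback[OF bs(1) f fB[unfolded B_def] S(1) rs(2)[unfolded S'_def]] unfolding D_def by blast
      have "a \<bullet> \<rho> + a \<bullet> \<sigma> = 2 * \<bar>D\<bar> * (f a \<bullet> cs ! i)" if a: "a \<in> S" for a
      proof -
        have "f a \<bullet> r + f a \<bullet> s = f a \<bullet> (r + s)"
          using f[OF a] rsc by (intro scalar_prod_add_distrib[symmetric, of _ n]) auto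
        also have "\<dots> = 2 * (f a \<bullet> cs ! i)"
          unfolding rs(3)[symmetric] using f[OF a] csp[of "cs ! i"] True by auto
        finally show ?thesis using \<rho>(2)[OF a] \<sigma>(2)[OF a] by (simp flip: distrib_left)
      qed
      then show ?thesis using \<rho>(1) \<sigma>(1) by (intro exI[of _ "(\<rho>, \<sigma>)"]) auto
    qed simp
  qed
  from choice[OF this] obtain p where p: "\<And>i. i < length cs \<Longrightarrow> fst (p i) \<in> insert (0\<^sub>v n) (ray_vectors n S) \<and>
      snd (p i) \<in> insert (0\<^sub>v n) (ray_vectors n S) \<and> (\<forall>a\<in>S. a \<bullet> fst (p i) + a \<bullet> snd (p i) = 2 * \<bar>D\<bar> * (f a \<bullet> cs ! i))"
    by blast
  define q where "q = length cs"
  define g where "g \<kappa> = (if snd \<kappa> then fst (p (fst \<kappa>)) else snd (p (fst \<kappa>)))" for \<kappa> :: "nat \<times> bool"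
  define K where "K = {..<q} \<times> (UNIV :: bool set)"
  have gm: "g \<kappa> \<in> insert (0\<^sub>v n) (ray_vectors n S)" if "\<kappa> \<in> K" for \<kappa>
    using p[of "fst \<kappa>"] that by (auto simp: g_def K_def q_def)
  show ?thesis
  proof (rule hull_of_weighted_rays[OF S(1,3) hc, of K g "\<lambda>_. 1" "2 * \<bar>D\<bar>"])
    show "finite K" by (simp add: K_def)
    show "(\<Sum>\<kappa>\<in>K. 1) \<le> 2 * \<bar>D\<bar>" using short by (simp add: K_def q_def card_cartesian_product)
    fix a assume a: "a \<in> S"
    have "(\<Sum>\<kappa>\<in>K. 1 * (a \<bullet> g \<kappa>)) = (\<Sum>i<q. \<Sum>b\<in>UNIV. a \<bullet> g (i, b))"
      unfolding K_def by (simp add: sum.cartesian_product split_def)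
    also have "\<dots> = (\<Sum>i<q. a \<bullet> fst (p i) + a \<bullet> snd (p i))"
      by (simp add: g_def UNIV_bool add.commute)
    also have "\<dots> = (\<Sum>i<q. 2 * \<bar>D\<bar> * (f a \<bullet> cs ! i))"
      using p a by (intro sum.cong) (auto simp: q_def)
    also have "\<dots> = 2 * \<bar>D\<bar> * (\<Sum>b\<leftarrow>cs. f a \<bullet> b)"
      by (simp add: sum_distrib_left sum_list_sum_nth q_def atLeast0LessThan)
    also have "(\<Sum>b\<leftarrow>cs. f a \<bullet> b) = f a \<bullet> vsum n cs" by (rule scalar_prod_vsum[symmetric]) (use f a csc in auto)
    also have "\<dots> = a \<bullet> h" using fB[OF a hc] cs(2) by simp
    finally show "(\<Sum>\<kappa>\<in>K. 1 * (a \<bullet> g \<kappa>)) = 2 * \<bar>D\<bar> * (a \<bullet> h)" .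
  qed (use gm D0 in auto)
qed

section \<open>Cones with one row more than columns\<close>

definition omit :: "nat \<Rightarrow> 'a list \<Rightarrow> 'a list" where
  "omit i rs = map ((!) rs) (filter (\<lambda>l. l \<noteq> i) [0..<length rs])"

text \<open>The sign makes this number the cofactor of the entry \<open>i\<close> of a column put in front of the matrix with rows
  \<open>rs\<close>.\<close>

definition omit_minor :: "nat \<Rightarrow> int vec list \<Rightarrow> nat \<Rightarrow> int" where
  "omit_minor n rs i = (-1) ^ i * det_rows n (omit i rs)"

definition bordered :: "nat \<Rightarrow> int vec list \<Rightarrow> (nat \<Rightarrow> int) \<Rightarrow> int mat" where
  "bordered n rs v = mat (Suc n) (Suc n) (\<lambda>(i, j). if j = 0 then v i else rs ! i $ (j - 1))"

lemma omit_eq: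
  assumes "i < length rs"
  shows "length (omit i rs) = length rs - 1"
    and "k < length rs - 1 \<Longrightarrow> omit i rs ! k = rs ! (if k < i then k else Suc k)"
proof -
  have "[0..<length rs] = [0..<i] @ [i..<length rs]" using assms by (metis le_add_diff_inverse less_imp_le upt_add_eq_append zero_le)
  also have "[i..<length rs] = i # [Suc i..<length rs]" using assms by (rule upt_conv_Cons)
  finally have u: "[0..<length rs] = [0..<i] @ i # [Suc i..<length rs]" .
  have a: "filter (\<lambda>l. l \<noteq> i) [0..<i] = [0..<i]" by (rule filter_True) auto
  have b: "filter (\<lambda>l. l \<noteq> i) [Suc i..<length rs] = [Suc i..<length rs]" by (rule filter_True) auto
  have f: "filter (\<lambda>l. l \<noteq> i) [0..<length rs] = [0..<i] @ [Suc i..<length rs]"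
    unfolding u by (simp add: a b)
  show "length (omit i rs) = length rs - 1" using assms by (simp add: omit_def f)
  show "omit i rs ! k = rs ! (if k < i then k else Suc k)" if "k < length rs - 1"
    using that assms by (auto simp: omit_def f nth_append)
qed

lemma det_bordered:
  assumes "length rs = Suc n"
  shows "det (bordered n rs v) = (\<Sum>i<Suc n. v i * omit_minor n rs i)"
proof -
  have M: "bordered n rs v \<in> carrier_mat (Suc n) (Suc n)" by (simp add: bordered_def)
  have "det (bordered n rs v) = (\<Sum>i<Suc n. bordered n rs v $$ (i, 0) * cofactor (bordered n rs v) i 0)"
    by (rule laplace_expansion_column[OF M]) simp
  also have "\<dots> = (\<Sum>i<Suc n. v i * omit_minor n rs i)"
  proof (rule sum.cong[OF refl])
    fix i assume "i \<in> {..<Suc n}"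
    then have i: "i < Suc n" by simp
    have "mat_delete (bordered n rs v) i 0 = mat_of_rows n (omit i rs)"
      using i assms omit_eq[of i rs]
      by (auto simp: mat_delete_def bordered_def mat_of_rows_def intro!: eq_matI)
    then show "bordered n rs v $$ (i, 0) * cofactor (bordered n rs v) i 0 = v i * omit_minor n rs i"
      using i by (simp add: cofactor_def omit_minor_def det_rows_def bordered_def)
  qed
  finally show ?thesis .
qed

lemma bordered_mult:
  assumes "length rs = Suc n" "set rs \<subseteq> carrier_vec n" "z \<in> carrier_vec n" "i < Suc n"
  shows "(bordered n rs v *\<^sub>v vCons s z) $ i = v i * s + rs ! i \<bullet> z"
proof -
  have "dim_vec z = n" using assms(3) by auto
  then show ?thesis using assms(4)
    by (simp add: bordered_def mult_mat_vec_def scalar_prod_def atLeast0LessThan sum.lessThan_Suc_shift del: sum.lessThan_Suc)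
qed

text \<open>The matrix bordered by a combination of its own columns is singular.\<close>

lemma omit_minor_orthogonal:
  assumes rs: "length rs = Suc n" "set rs \<subseteq> carrier_vec n" and z: "z \<in> carrier_vec n"
  shows "(\<Sum>i<Suc n. omit_minor n rs i * (rs ! i \<bullet> z)) = 0"
proof -
  let ?B = "bordered n rs (\<lambda>i. rs ! i \<bullet> z)"
  have B: "?B \<in> carrier_mat (Suc n) (Suc n)" by (simp add: bordered_def)
  let ?w = "vCons 1 (- z)"
  have "?B *\<^sub>v ?w = 0\<^sub>v (Suc n)"
  proof (rule eq_vecI)
    fix i assume "i < dim_vec (0\<^sub>v (Suc n) :: int vec)"
    then have i: "i < Suc n" by simp
    have ri: "rs ! i \<in> carrier_vec n" using rs i by auto
    have "rs ! i \<bullet> (- z) = - (rs ! i \<bullet> z)" using ri z by (intro scalar_prod_uminus_right) auto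
    then show "(?B *\<^sub>v ?w) $ i = 0\<^sub>v (Suc n) $ i"
      using bordered_mult[OF rs _ i, of "- z" "\<lambda>i. rs ! i \<bullet> z" 1] z i by simp
  qed (use B in simp)
  moreover have "?w \<in> carrier_vec (Suc n)" using z by simp
  moreover have "?w \<noteq> 0\<^sub>v (Suc n)"
  proof
    assume "?w = 0\<^sub>v (Suc n)"
    then have "?w $ 0 = 0\<^sub>v (Suc n) $ 0" by (rule arg_cong)
    then show False by simp
  qed
  ultimately have "det ?B = 0" using det_0_iff_vec_prod_zero[OF B] by blast
  then show ?thesis using det_bordered[OF rs(1)] by (simp add: mult.commute)
qed

lemma omit_minor_nonzero:
  assumes rs: "length rs = Suc n" "set rs \<subseteq> carrier_vec n" and sp: "spanning n (set rs)"
  obtains i where "i < Suc n" "omit_minor n rs i \<noteq> 0"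
proof -
  obtain xs where xs: "length xs = n" "set xs \<subseteq> set rs" "det_rows n xs \<noteq> 0"
    using spanning_nonsingular_rows[OF rs(2) sp] by metis
  have "distinct xs" using det_rows_repeat xs(3) by blast
  then have "mset xs \<subseteq># mset rs"
    using xs(2) by (metis mset_set_set mset_set_set_mset_msubset set_mset_mset subset_mset.order_trans subset_imp_msubset_mset_set List.finite_set)
  then obtain M where M: "mset rs = mset xs + M" by (metis subset_mset.le_iff_add)
  then have "size M = 1" using xs(1) rs(1) by (metis add_left_cancel plus_1_eq_Suc add.commute size_mset size_union)
  then obtain a where a: "M = {#a#}" by (metis size_1_singleton_mset)
  then have "a \<in> set rs" using M by (metis add_mset_add_single set_mset_mset union_single_eq_member)
  then obtain i where i: "i < length rs" "rs ! i = a" by (auto simp: in_set_conv_nth)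
  have "mset (i # filter (\<lambda>l. l \<noteq> i) [0..<length rs]) = mset [0..<length rs]"
    using i by (subst set_eq_iff_mset_eq_distinct[symmetric]) auto
  then have "mset (map ((!) rs) (i # filter (\<lambda>l. l \<noteq> i) [0..<length rs])) = mset (map ((!) rs) [0..<length rs])"
    by (metis mset_map)
  then have "mset (a # omit i rs) = mset rs" using i by (simp add: omit_def map_nth)
  then have "mset (omit i rs) = mset xs" using M a by simp
  then have "\<bar>det_rows n (omit i rs)\<bar> = \<bar>det_rows n xs\<bar>" by (rule abs_det_rows_permute)
  then show ?thesis using that[of i] i rs(1) xs(3) by (simp add: omit_minor_def)
qed

text \<open>The cross product of the rows other than \<open>i\<close> and \<open>j\<close> takes the values \<open>\<plusminus> d\<^sub>j\<close> and \<open>\<plusminus> d\<^sub>i\<close> on these two rows, where \<open>d\<close>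
  stands for the omitted minors. Orthogonality of the vector of slacks to \<open>d\<close> forces equal signs when
  \<open>d\<^sub>i d\<^sub>j \<le> 0\<close>.\<close>

lemma two_row_ray:
  assumes rs: "length rs = Suc n" "set rs \<subseteq> carrier_vec n" and ij: "i < Suc n" "j < Suc n" "i \<noteq> j"
    and sgn: "omit_minor n rs i * omit_minor n rs j \<le> 0" "omit_minor n rs j \<noteq> 0"
  obtains c where "c \<in> ray_vectors n (set rs)" "rs ! i \<bullet> c = \<bar>omit_minor n rs j\<bar>" "rs ! j \<bullet> c = \<bar>omit_minor n rs i\<bar>"
    "\<And>l. l < Suc n \<Longrightarrow> l \<noteq> i \<Longrightarrow> l \<noteq> j \<Longrightarrow> rs ! l \<bullet> c = 0"
proof -
  let ?d = "omit_minor n rs"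
  define ls where "ls = filter (\<lambda>l. l \<noteq> i \<and> l \<noteq> j) [0..<length rs]"
  define qs where "qs = map ((!) rs) ls"
  have perm: "mset (rs ! i' # qs) = mset (omit j' rs)" if "{i', j'} = {i, j}" "i' \<noteq> j'" for i' j'
  proof -
    have "mset (i' # ls) = mset (filter (\<lambda>l. l \<noteq> j') [0..<length rs])"
      using that ij rs(1) by (subst set_eq_iff_mset_eq_distinct[symmetric]) (auto simp: ls_def doubleton_eq_iff)
    then have "mset (map ((!) rs) (i' # ls)) = mset (map ((!) rs) (filter (\<lambda>l. l \<noteq> j') [0..<length rs]))"
      by (metis mset_map)
    then show ?thesis by (simp add: qs_def omit_def)
  qed
  have "length (rs ! i # qs) = length (omit j rs)" using perm[of i j] ij by (metis size_mset)
  then have len: "length qs + 1 = n" using omit_eq(1)[of j rs] ij rs(1) by simp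
  have qsub: "set qs \<subseteq> set rs" by (auto simp: qs_def ls_def)
  define c0 where "c0 = cross_vec n qs"
  have c0c: "c0 \<in> carrier_vec n" by (simp add: c0_def)
  have ric: "rs ! l \<in> carrier_vec n" if "l < Suc n" for l using that rs by auto
  have abs: "\<bar>rs ! i' \<bullet> c0\<bar> = \<bar>?d j'\<bar>" if "{i', j'} = {i, j}" "i' \<noteq> j'" for i' j'
  proof -
    have i': "i' < Suc n" using that ij by (auto simp: doubleton_eq_iff)
    have "rs ! i' \<bullet> c0 = det_rows n (rs ! i' # qs)"
      unfolding c0_def by (rule det_rows_Cons[OF len ric[OF i'], symmetric])
    then show ?thesis using abs_det_rows_permute[OF perm[OF that], of n] by (simp add: omit_minor_def abs_mult power_abs)
  qed
  have absi: "\<bar>rs ! i \<bullet> c0\<bar> = \<bar>?d j\<bar>" and absj: "\<bar>rs ! j \<bullet> c0\<bar> = \<bar>?d i\<bar>" using abs[of i j] abs[of j i] ij by auto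
  have zero0: "rs ! l \<bullet> c0 = 0" if l: "l < Suc n" "l \<noteq> i" "l \<noteq> j" for l
  proof -
    have "l \<in> set ls" using l rs(1) by (auto simp: ls_def simp del: upt_Suc)
    then have "rs ! l \<in> set qs" by (simp add: qs_def)
    then show ?thesis unfolding c0_def using orthogonal_cross_vec[OF len] qsub rs(2) by blast
  qed
  define c where "c = (if rs ! i \<bullet> c0 \<ge> 0 then c0 else - c0)"
  have cc: "c \<in> carrier_vec n" using c0c by (simp add: c_def)
  have neg: "rs ! l \<bullet> (- c0) = - (rs ! l \<bullet> c0)" if "l < Suc n" for l
    unfolding c0_def using ric[OF that] by simp
  have ci: "rs ! i \<bullet> c = \<bar>?d j\<bar>" using absi neg[OF ij(1)] by (auto simp: c_def)
  have cj: "\<bar>rs ! j \<bullet> c\<bar> = \<bar>?d i\<bar>" using absj neg[OF ij(2)] by (auto simp: c_def)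
  have cl: "rs ! l \<bullet> c = 0" if "l < Suc n" "l \<noteq> i" "l \<noteq> j" for l
    using zero0[OF that] neg[OF that(1)] by (auto simp: c_def)
  have "(\<Sum>l<Suc n. ?d l * (rs ! l \<bullet> c)) = (\<Sum>l\<in>{i, j}. ?d l * (rs ! l \<bullet> c))"
    by (rule sum.mono_neutral_right) (use ij cl in auto)
  then have orth: "?d i * (rs ! i \<bullet> c) + ?d j * (rs ! j \<bullet> c) = 0"
    using omit_minor_orthogonal[OF rs cc] ij by simp
  have "0 \<le> rs ! j \<bullet> c"
  proof (rule ccontr)
    assume n: "\<not> 0 \<le> rs ! j \<bullet> c"
    have "(?d j * ?d j) * (rs ! j \<bullet> c) = - ((?d i * ?d j) * (rs ! i \<bullet> c))"
      using arg_cong[OF orth, of "\<lambda>t. ?d j * t"] by (simp add: algebra_simps)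
    also have "\<dots> \<ge> 0" using sgn(1) ci by (simp add: mult_nonpos_nonneg)
    finally have "0 \<le> (?d j * ?d j) * (rs ! j \<bullet> c)" .
    moreover have "0 < ?d j * ?d j" using sgn(2) by (simp add: zero_less_mult_iff) linarith
    ultimately show False using n by (simp add: zero_le_mult_iff)
  qed
  then have cj': "rs ! j \<bullet> c = \<bar>?d i\<bar>" using cj by simp
  have "in_cone (set rs) c"
    unfolding in_cone_def
  proof
    fix a assume "a \<in> set rs"
    then obtain l where l: "l < Suc n" "a = rs ! l" using rs(1) by (auto simp: in_set_conv_nth)
    show "0 \<le> a \<bullet> c" using ci cj' cl[OF l(1)] l by (cases "l = i"; cases "l = j") auto
  qed
  then have "c \<in> ray_vectors n (set rs)"
    unfolding ray_vectors_def using len qsub by (auto simp: c_def c0_def intro!: exI[of _ qs])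
  then show ?thesis using that ci cj' cl by blast
qed

text \<open>A maximal chain from \<open>0\<close> to \<open>y\<close> in the product order, indexed by the size of its members.\<close>

lemma unit_step_chain:
  fixes y :: "nat \<Rightarrow> nat"
  assumes "\<And>i. m \<le> i \<Longrightarrow> y i = 0"
  obtains p :: "nat \<Rightarrow> nat \<Rightarrow> nat" where "p (\<Sum>i<m. y i) = y"
    "\<And>s t. s \<le> t \<Longrightarrow> t \<le> (\<Sum>i<m. y i) \<Longrightarrow> p s \<le> p t"
    "\<And>t. t \<le> (\<Sum>i<m. y i) \<Longrightarrow> (\<Sum>i<m. p t i) = t"
proof -
  have "\<exists>p :: nat \<Rightarrow> nat \<Rightarrow> nat. p N = y \<and> (\<forall>s t. s \<le> t \<longrightarrow> t \<le> N \<longrightarrow> p s \<le> p t) \<and> (\<forall>t\<le>N. (\<Sum>i<m. p t i) = t)"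
    if "N = (\<Sum>i<m. y i)" for N
    using that assms
  proof (induction N arbitrary: y)
    case 0
    then show ?case by (intro exI[of _ "\<lambda>_. y"]) auto
  next
    case (Suc N)
    then obtain i where i: "i < m" "y i > 0"
      by (metis (no_types, lifting) gr0I lessThan_iff nat.distinct(1) sum.neutral)
    define y' where "y' = y(i := y i - 1)"
    have "(\<Sum>l<m. y l) = y i + (\<Sum>l\<in>{..<m} - {i}. y l)" using i by (simp add: sum.remove)
    moreover have "(\<Sum>l<m. y' l) = y' i + (\<Sum>l\<in>{..<m} - {i}. y' l)" using i by (simp add: sum.remove)
    moreover have "(\<Sum>l\<in>{..<m} - {i}. y' l) = (\<Sum>l\<in>{..<m} - {i}. y l)" by (rule sum.cong) (auto simp: y'_def)
    ultimately have N: "N = (\<Sum>l<m. y' l)" using Suc.prems(1) i by (simp add: y'_def)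
    have "y' l = 0" if "m \<le> l" for l using Suc.prems(2)[OF that] i that by (simp add: y'_def)
    from Suc.IH[OF N this] obtain p where p: "p N = y'" "\<And>s t. s \<le> t \<Longrightarrow> t \<le> N \<Longrightarrow> p s \<le> p t"
      "\<And>t. t \<le> N \<Longrightarrow> (\<Sum>i<m. p t i) = t" by blast
    have y'y: "y' \<le> y" by (auto simp: y'_def le_fun_def)
    show ?case
    proof (intro exI[of _ "\<lambda>t. if t \<le> N then p t else y"] conjI allI impI)
      fix s t assume st: "s \<le> t" "t \<le> Suc N"
      show "(if s \<le> N then p s else y) \<le> (if t \<le> N then p t else y)"
        using st p(2)[of s t] p(2)[of s N] p(1) y'y by (auto intro: order_trans)
    next
      fix t assume "t \<le> Suc N"
      then show "(\<Sum>i<m. (if t \<le> N then p t else y) i) = t"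
        using p(3)[of t] Suc.prems(1) by (cases "t \<le> N") auto
    qed simp
  qed
  then show ?thesis using that by blast
qed

text \<open>If a proper part \<open>e\<close> of the slack vector of \<open>h\<close> is itself the slack vector of an integral \<open>z\<close>, then
  \<open>h = z + (h - z)\<close> is a nontrivial splitting.\<close>

lemma irreducible_no_proper_part:
  fixes e :: "nat \<Rightarrow> int"
  assumes rs: "length rs = Suc n" "set rs \<subseteq> carrier_vec n" "spanning n (set rs)"
    and h: "irreducible_in_cone n (set rs) h" and z: "z \<in> carrier_vec n"
    and e: "\<And>i. i < Suc n \<Longrightarrow> rs ! i \<bullet> z = e i" "\<And>i. i < Suc n \<Longrightarrow> 0 \<le> e i" "\<And>i. i < Suc n \<Longrightarrow> e i \<le> rs ! i \<bullet> h"
    and total: "0 < (\<Sum>i<Suc n. e i)" "(\<Sum>i<Suc n. e i) < (\<Sum>i<Suc n. rs ! i \<bullet> h)"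
  shows False
proof -
  have hc: "h \<in> carrier_vec n" using h by (simp add: irreducible_in_cone_def)
  have in_rs: "\<exists>i<Suc n. a = rs ! i" if "a \<in> set rs" for a using that rs(1) by (auto simp: in_set_conv_nth)
  have "in_cone (set rs) z" using in_rs e(1,2) by (fastforce simp: in_cone_def)
  moreover have "in_cone (set rs) (h - z)"
    unfolding in_cone_def
  proof
    fix a assume a: "a \<in> set rs"
    then obtain i where i: "i < Suc n" "a = rs ! i" using in_rs by blast
    have "a \<bullet> (h - z) = a \<bullet> h - a \<bullet> z"
      using a rs(2) hc z by (intro scalar_prod_minus_distrib[of _ n]) auto
    then show "0 \<le> a \<bullet> (h - z)" using e(1,3)[OF i(1)] i by simp
  qed
  ultimately have "z = 0\<^sub>v n \<or> z = h" using h z unfolding irreducible_in_cone_def by blast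
  then show False
  proof
    assume "z = 0\<^sub>v n"
    then have "e i = 0" if "i < Suc n" for i using e(1)[OF that] rs that by (metis nth_mem scalar_prod_right_zero subsetD)
    then show False using total(1) by simp
  next
    assume "z = h"
    then have "(\<Sum>i<Suc n. e i) = (\<Sum>i<Suc n. rs ! i \<bullet> h)" using e(1) by (intro sum.cong) auto
    then show False using total(2) by simp
  qed
qed

text \<open>The lattice spanned by \<open>v\<close> and the columns of the matrix has the absolute value of the bordered determinant
  as its index.\<close>

lemma bordered_congruence:
  fixes F :: "'k \<Rightarrow> nat \<Rightarrow> int"
  assumes rs: "length rs = Suc n" "set rs \<subseteq> carrier_vec n"
    and v: "(\<Sum>i<Suc n. v i * omit_minor n rs i) \<noteq> 0"
    and K: "finite K" "\<bar>\<Sum>i<Suc n. v i * omit_minor n rs i\<bar> < int (card K)"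
  shows "\<exists>\<kappa>\<in>K. \<exists>\<kappa>'\<in>K. \<exists>s. \<exists>z\<in>carrier_vec n. \<kappa> \<noteq> \<kappa>' \<and>
    (\<forall>i<Suc n. F \<kappa> i - F \<kappa>' i = v i * s + rs ! i \<bullet> z)"
proof -
  let ?B = "bordered n rs v" and ?F = "\<lambda>\<kappa>. vec (Suc n) (F \<kappa>)"
  have B: "?B \<in> carrier_mat (Suc n) (Suc n)" by (simp add: bordered_def)
  obtain \<kappa> \<kappa>' w where \<kappa>: "\<kappa> \<in> K" "\<kappa>' \<in> K" "\<kappa> \<noteq> \<kappa>'" and w: "w \<in> carrier_vec (Suc n)" "?F \<kappa> - ?F \<kappa>' = ?B *\<^sub>v w"
    by (rule congruent_pair_exists[OF B, of K ?F]) (use v K in \<open>simp_all only: det_bordered[OF rs(1)] vec_carrier not_False_eq_True\<close>)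
  define z where "z = vec n (\<lambda>i. w $ Suc i)"
  have zc: "z \<in> carrier_vec n" by (simp add: z_def)
  have wz: "w = vCons (w $ 0) z"
  proof (rule eq_vecI)
    fix i assume "i < dim_vec (vCons (w $ 0) z)"
    then show "w $ i = vCons (w $ 0) z $ i" using zc by (cases i) (auto simp: z_def)
  qed (use w zc in auto)
  have "F \<kappa> i - F \<kappa>' i = v i * w $ 0 + rs ! i \<bullet> z" if i: "i < Suc n" for i
  proof -
    have "F \<kappa> i - F \<kappa>' i = (?B *\<^sub>v w) $ i" using i by (simp flip: w(2))
    also have "\<dots> = (?B *\<^sub>v vCons (w $ 0) z) $ i" using wz by simp
    also have "\<dots> = v i * w $ 0 + rs ! i \<bullet> z" by (rule bordered_mult[OF rs zc i])
    finally show ?thesis .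
  qed
  then show ?thesis using \<kappa> zc by blast
qed

lemma row_uminus:
  assumes "length rs = Suc n" "set rs \<subseteq> carrier_vec n" "z \<in> carrier_vec n" "i < Suc n"
  shows "rs ! i \<bullet> (- z) = - (rs ! i \<bullet> z :: int)"
  using assms by (intro scalar_prod_uminus_right) (metis carrier_vecD nth_mem subsetD)

text \<open>Two chains of unit steps lead from \<open>0\<close> to the parts \<open>xp\<close> and \<open>xq\<close> of the slack vector on the rows with
  positive and with nonpositive minor. The lattice spanned by \<open>xp\<close> and the columns of the matrix has index
  \<open>M\<close>, so if \<open>X * W\<close> exceeds \<open>M\<close>, two sums of a partial vector of either chain are congruent. The weighted
  size \<open>dsum\<close>, which vanishes on slack vectors of integral points, bounds the multiple of \<open>xp\<close> in their
  difference. What remains is a proper part of the slack vector of \<open>h\<close> that comes from an integral point.\<close>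

lemma positive_part_bound:
  fixes h :: "int vec" and rs :: "int vec list"
  assumes rs: "length rs = Suc n" "set rs \<subseteq> carrier_vec n" "spanning n (set rs)"
    and h: "irreducible_in_cone n (set rs) h"
  defines "d \<equiv> omit_minor n rs" and "y \<equiv> (\<lambda>i. rs ! i \<bullet> h)"
  defines "X \<equiv> (\<Sum>i | i < Suc n \<and> 0 < d i. y i)" and "W \<equiv> (\<Sum>i | i < Suc n \<and> d i \<le> 0. y i)"
    and "M \<equiv> (\<Sum>i | i < Suc n \<and> 0 < d i. d i * y i)"
  assumes X: "0 < X"
  shows "X * W \<le> M"
proof (rule ccontr)
  assume long: "\<not> X * W \<le> M"
  have hc: "h \<in> carrier_vec n" and hcone: "in_cone (set rs) h" using h by (auto simp: irreducible_in_cone_def)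
  have y0: "0 \<le> y i" if "i < Suc n" for i using hcone that rs(1) by (simp add: in_cone_def y_def)
  define xp where "xp i = (if i < Suc n \<and> 0 < d i then nat (y i) else 0)" for i
  define xq where "xq i = (if i < Suc n \<and> d i \<le> 0 then nat (y i) else 0)" for i
  have xpq: "int (xp i) + int (xq i) = y i" if "i < Suc n" for i using y0[OF that] that by (auto simp: xp_def xq_def)
  have Xi: "int (\<Sum>i<Suc n. xp i) = X"
    unfolding X_def of_nat_sum by (rule sum.mono_neutral_cong_right) (use y0 in \<open>auto simp: xp_def\<close>)
  have Wi: "int (\<Sum>i<Suc n. xq i) = W"
    unfolding W_def of_nat_sum by (rule sum.mono_neutral_cong_right) (use y0 in \<open>auto simp: xq_def\<close>)
  have Mi: "(\<Sum>i<Suc n. d i * int (xp i)) = M"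
    unfolding M_def by (rule sum.mono_neutral_cong_right) (use y0 in \<open>auto simp: xp_def\<close>)
  have M_pos: "0 < M"
  proof -
    have "X \<le> M" unfolding X_def M_def
    proof (rule sum_mono)
      fix i assume "i \<in> {i. i < Suc n \<and> 0 < d i}"
      then have "1 * y i \<le> d i * y i" using y0[of i] by (intro mult_right_mono) auto
      then show "y i \<le> d i * y i" by simp
    qed
    then show ?thesis using X by simp
  qed
  define dsum where "dsum g = (\<Sum>i<Suc n. d i * g i)" for g :: "nat \<Rightarrow> int"
  have dsum_add: "dsum (\<lambda>i. g i + g' i) = dsum g + dsum g'" for g g'
    by (simp add: dsum_def distrib_left sum.distrib)
  have dsum_diff: "dsum (\<lambda>i. g i - g' i) = dsum g - dsum g'" for g g'
    by (simp add: dsum_def right_diff_distrib sum_subtractf)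
  have dsum_row: "dsum (\<lambda>i. rs ! i \<bullet> z) = 0" if "z \<in> carrier_vec n" for z
    unfolding dsum_def d_def by (rule omit_minor_orthogonal[OF rs(1,2) that])
  have dsum_xp: "dsum (\<lambda>i. int (xp i)) = M" using Mi by (simp add: dsum_def)
  have dsum_xq: "dsum (\<lambda>i. int (xq i)) = - M"
  proof -
    have "dsum (\<lambda>i. int (xp i) + int (xq i)) = dsum (\<lambda>i. rs ! i \<bullet> h)"
      unfolding dsum_def by (rule sum.cong) (use xpq in \<open>auto simp: y_def\<close>)
    then show ?thesis using dsum_row[OF hc] dsum_xp dsum_add[of "\<lambda>i. int (xp i)" "\<lambda>i. int (xq i)"] by simp
  qed
  obtain p where p: "p (\<Sum>i<Suc n. xp i) = xp" "\<And>s t. s \<le> t \<Longrightarrow> t \<le> (\<Sum>i<Suc n. xp i) \<Longrightarrow> p s \<le> p t"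
    "\<And>t. t \<le> (\<Sum>i<Suc n. xp i) \<Longrightarrow> (\<Sum>i<Suc n. p t i) = t"
    using unit_step_chain[of "Suc n" xp] by (auto simp: xp_def)
  obtain q where q: "q (\<Sum>i<Suc n. xq i) = xq" "\<And>s t. s \<le> t \<Longrightarrow> t \<le> (\<Sum>i<Suc n. xq i) \<Longrightarrow> q s \<le> q t"
    "\<And>t. t \<le> (\<Sum>i<Suc n. xq i) \<Longrightarrow> (\<Sum>i<Suc n. q t i) = t"
    using unit_step_chain[of "Suc n" xq] by (auto simp: xq_def)
  define NX where "NX = (\<Sum>i<Suc n. xp i)"
  define NW where "NW = (\<Sum>i<Suc n. xq i)"
  have NX: "int NX = X" and NW: "int NW = W" using Xi Wi by (simp_all add: NX_def NW_def)
  note p = p[folded NX_def] and q = q[folded NW_def]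
  have p_le: "p t i \<le> xp i" if "t \<le> NX" for t i using p(2)[OF that order.refl] p(1) by (simp add: le_fun_def)
  have q_le: "q t i \<le> xq i" if "t \<le> NW" for t i using q(2)[OF that order.refl] q(1) by (simp add: le_fun_def)
  have p_mono: "p s i \<le> p t i" if "s \<le> t" "t \<le> NX" for s t i using p(2)[OF that] by (simp add: le_fun_def)
  have q_mono: "q s i \<le> q t i" if "s \<le> t" "t \<le> NW" for s t i using q(2)[OF that] by (simp add: le_fun_def)
  have p_sum: "(\<Sum>i<Suc n. int (p t i)) = int t" if "t \<le> NX" for t using p(3)[OF that] by (simp only: flip: of_nat_sum)
  have q_sum: "(\<Sum>i<Suc n. int (q t i)) = int t" if "t \<le> NW" for t using q(3)[OF that] by (simp only: flip: of_nat_sum)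
  \<comment> \<open>Positive minors are at least one, so the weights do not shrink a block of the first chain.\<close>
  have dp: "int t - int s \<le> dsum (\<lambda>i. int (p t i) - int (p s i))" if st: "s \<le> t" "t \<le> NX" for s t
  proof -
    have "int t - int s = (\<Sum>i<Suc n. int (p t i) - int (p s i))"
      using st by (simp only: sum_subtractf p_sum[of t] p_sum[of s] order_trans[OF st])
    also have "\<dots> \<le> dsum (\<lambda>i. int (p t i) - int (p s i))"
      unfolding dsum_def
    proof (rule sum_mono)
      fix i assume "i \<in> {..<Suc n}"
      have ge: "0 \<le> int (p t i) - int (p s i)" using p_mono[OF st, of i] by simp
      show "int (p t i) - int (p s i) \<le> d i * (int (p t i) - int (p s i))"
      proof (cases "0 < d i")
        case True
        then have "1 * (int (p t i) - int (p s i)) \<le> d i * (int (p t i) - int (p s i))"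
          using ge by (intro mult_right_mono) auto
        then show ?thesis by simp
      next
        case False
        then have "p t i = 0" using p_le[OF st(2), of i] by (simp add: xp_def)
        then show ?thesis using ge by simp
      qed
    qed
    finally show ?thesis .
  qed
  have dq: "dsum (\<lambda>i. int (q t i) - int (q s i)) \<le> 0" if st: "s \<le> t" "t \<le> NW" for s t
    unfolding dsum_def
  proof (rule sum_nonpos)
    fix i
    show "d i * (int (q t i) - int (q s i)) \<le> 0"
    proof (cases "d i \<le> 0")
      case True then show ?thesis using q_mono[OF st, of i] by (intro mult_nonpos_nonneg) auto
    next
      case False
      then have "q t i = 0" "q s i = 0" using q_le[OF st(2), of i] q_le[OF order_trans[OF st], of i] by (simp_all add: xq_def)
      then show ?thesis by simp
    qed
  qed
  define P where "P t = dsum (\<lambda>i. int (p t i))" for t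
  define Q where "Q t = dsum (\<lambda>i. int (q t i))" for t
  have P: "int t - int s \<le> P t - P s" if "s \<le> t" "t \<le> NX" for s t using dp[OF that] by (simp add: P_def dsum_diff)
  have Q: "Q t \<le> Q s" if "s \<le> t" "t \<le> NW" for s t using dq[OF that] by (simp add: Q_def dsum_diff)
  have PX: "P NX = M" using p(1) dsum_xp by (simp add: P_def)
  have QW: "Q NW = - M" using q(1) dsum_xq by (simp add: Q_def)
  have P0: "P 0 = 0" and Q0: "Q 0 = 0"
  proof -
    have "p 0 i = 0" if "i < Suc n" for i using p(3)[of 0] that by (auto simp: less_Suc_eq)
    then show "P 0 = 0" by (simp add: P_def dsum_def)
    have "q 0 i = 0" if "i < Suc n" for i using q(3)[of 0] that by (auto simp: less_Suc_eq)
    then show "Q 0 = 0" by (simp add: Q_def dsum_def)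
  qed
  have main: False if tu: "t < NX" "u < NW" "t' < NX" "u' < NW" "(t, u) \<noteq> (t', u')" "u' \<le> u"
    and z: "z \<in> carrier_vec n"
    and eq: "\<And>i. i < Suc n \<Longrightarrow> int (p t i) + int (q u i) - (int (p t' i) + int (q u' i)) = int (xp i) * s + rs ! i \<bullet> z"
    for t u t' u' s z
  proof -
    \<comment> \<open>As \<open>xp\<close> is in the lattice, the first chain may be read cyclically: the block from \<open>t'\<close> to \<open>t\<close> wraps around if
      \<open>t < t'\<close>.\<close>
    define b where "b = (if t' \<le> t then 0 else 1 :: int)"
    define \<beta> where "\<beta> i = int (p t i) - int (p t' i) + b * int (xp i)" for i
    define \<gamma> where "\<gamma> i = int (q u i) - int (q u' i)" for i
    define a where "a = s + b"
    have z_eq: "rs ! i \<bullet> z = \<beta> i + \<gamma> i - a * int (xp i)" if "i < Suc n" for i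
      using eq[OF that] by (simp add: \<beta>_def \<gamma>_def a_def algebra_simps)
    have bp: "p t i \<le> xp i" "p t' i \<le> xp i" "q u i \<le> xq i" "q u' i \<le> q u i" for i
      using p_le[of t i] p_le[of t' i] q_le[of u i] q_mono[OF tu(6), of i] tu by auto
    have \<beta>r: "0 \<le> \<beta> i" "\<beta> i \<le> int (xp i)" for i
      using p_mono[of t' t i] p_mono[of t t' i] bp[of i] tu by (auto simp: \<beta>_def b_def)
    have \<gamma>r: "0 \<le> \<gamma> i" "\<gamma> i \<le> int (xq i)" for i using bp[of i] by (simp_all add: \<gamma>_def)
    define \<tau> where "\<tau> = int t - int t' + b * int NX"
    have \<tau>: "0 \<le> \<tau>" "\<tau> < int NX" using tu by (auto simp: \<tau>_def b_def)
    have dsum_scale: "dsum (\<lambda>i. k * int (xp i)) = k * M" for k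
      unfolding dsum_xp[symmetric] dsum_def
      by (simp add: sum_distrib_left mult.left_commute mult.commute del: sum.lessThan_Suc)
    have d\<beta>: "dsum \<beta> = P t - P t' + b * M"
      unfolding \<beta>_def by (simp add: dsum_add dsum_diff dsum_scale P_def)
    have \<beta>_low: "\<tau> \<le> dsum \<beta>" and \<beta>_high: "dsum \<beta> < M"
      using P[of t' t] P[of t t'] P[of t NX] P[of t' NX] P[of 0 t] P[of 0 t'] tu P0 PX
      by (auto simp: d\<beta> \<tau>_def b_def split: if_splits)
    have d\<gamma>: "dsum \<gamma> = Q u - Q u'" unfolding \<gamma>_def by (simp add: dsum_diff Q_def)
    have \<gamma>_low: "- M \<le> dsum \<gamma>" and \<gamma>_high: "dsum \<gamma> \<le> 0"
      unfolding d\<gamma> using Q[of u' u] Q[of u NW] Q[of 0 u'] tu Q0 QW by auto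
    have "0 = dsum (\<lambda>i. \<beta> i + \<gamma> i - a * int (xp i))"
      unfolding dsum_row[OF z, symmetric] dsum_def by (rule sum.cong) (use z_eq in auto)
    then have wt: "dsum \<beta> + dsum \<gamma> = a * M" by (simp add: dsum_add dsum_diff dsum_scale)
    have "(- 1) * M \<le> a * M" "a * M < 1 * M" using wt \<beta>_low \<beta>_high \<gamma>_low \<gamma>_high \<tau>(1) by linarith+
    then have a_range: "- 1 \<le> a" "a < 1"
      using M_pos mult_le_cancel_right[of "- 1" M a] mult_less_cancel_right[of a M 1] by auto
    \<comment> \<open>If \<open>a = - 1\<close>, the weighted size of the first block is zero, and the block is empty.\<close>
    have a_cases: "a = 0 \<or> a = - 1 \<and> \<tau> = 0 \<and> (\<forall>i. \<beta> i = 0)"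
    proof (cases "a = 0")
      case False
      then have a: "a = - 1" using a_range by linarith
      then have "a * M = - M" by simp
      then have \<tau>0: "\<tau> = 0" using wt \<beta>_low \<gamma>_low \<tau>(1) by linarith
      then have "t = t'" using tu by (auto simp: \<tau>_def b_def split: if_splits)
      then show ?thesis using a \<tau>0 by (simp add: \<beta>_def b_def)
    qed simp
    show False
    proof (rule irreducible_no_proper_part[OF rs h z z_eq])
      fix i assume i: "i < Suc n"
      show "0 \<le> \<beta> i + \<gamma> i - a * int (xp i)" using a_cases \<beta>r[of i] \<gamma>r[of i] by auto
      have "\<beta> i + \<gamma> i - a * int (xp i) \<le> int (xp i) + int (xq i)" using a_cases \<beta>r[of i] \<gamma>r[of i] by auto
      then show "\<beta> i + \<gamma> i - a * int (xp i) \<le> rs ! i \<bullet> h" using xpq[OF i] by (simp add: y_def)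
    next
      have xs: "(\<Sum>i<Suc n. int (xp i)) = int NX" by (simp only: NX_def of_nat_sum)
      have "(\<Sum>i<Suc n. \<beta> i) = \<tau>"
        unfolding \<beta>_def \<tau>_def using p_sum[of t] p_sum[of t'] tu
        by (simp only: sum.distrib sum_subtractf xs less_imp_le flip: sum_distrib_left)
      moreover have "(\<Sum>i<Suc n. \<gamma> i) = int u - int u'"
        unfolding \<gamma>_def using q_sum[of u] q_sum[of u'] tu by (simp only: sum_subtractf less_imp_le)
      ultimately have total: "(\<Sum>i<Suc n. \<beta> i + \<gamma> i - a * int (xp i)) = \<tau> + (int u - int u') - a * int NX"
        by (simp only: sum.distrib sum_subtractf xs flip: sum_distrib_left)
      have "\<tau> = 0 \<Longrightarrow> t = t'" using tu by (auto simp: \<tau>_def b_def split: if_splits)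
      then have "0 < \<tau> + (int u - int u')" using \<tau>(1) tu(5,6) by (cases "\<tau> = 0") auto
      then show "0 < (\<Sum>i<Suc n. \<beta> i + \<gamma> i - a * int (xp i))"
        unfolding total using a_cases by auto
      have "(\<Sum>i<Suc n. rs ! i \<bullet> h) = (\<Sum>i<Suc n. int (xp i) + int (xq i))"
        by (rule sum.cong) (use xpq in \<open>auto simp: y_def\<close>)
      also have "\<dots> = int NX + int NW" by (simp only: sum.distrib NX_def NW_def of_nat_sum)
      finally show "(\<Sum>i<Suc n. \<beta> i + \<gamma> i - a * int (xp i)) < (\<Sum>i<Suc n. rs ! i \<bullet> h)"
        unfolding total using a_cases \<tau> tu by auto
    qed
  qed
  define K where "K = {..<NX} \<times> {..<NW}"
  have finK: "finite K" by (simp add: K_def)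
  have cK: "int (card K) = X * W" by (simp add: K_def card_cartesian_product NX NW)
  have det: "(\<Sum>i<Suc n. int (xp i) * omit_minor n rs i) = M"
    unfolding Mi[symmetric] by (simp only: d_def mult.commute)
  have nz: "(\<Sum>i<Suc n. int (xp i) * omit_minor n rs i) \<noteq> 0" unfolding det using M_pos by simp
  have card: "\<bar>\<Sum>i<Suc n. int (xp i) * omit_minor n rs i\<bar> < int (card K)"
    unfolding det cK using M_pos long by simp
  obtain \<kappa> \<kappa>' s z where \<kappa>: "\<kappa> \<in> K" "\<kappa>' \<in> K" "\<kappa> \<noteq> \<kappa>'" and z: "z \<in> carrier_vec n"
    and eq: "\<And>i. i < Suc n \<Longrightarrow> int (p (fst \<kappa>) i) + int (q (snd \<kappa>) i) - (int (p (fst \<kappa>') i) + int (q (snd \<kappa>') i)) =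
      int (xp i) * s + rs ! i \<bullet> z"
    using bordered_congruence[OF rs(1,2) nz finK card, of "\<lambda>\<kappa> i. int (p (fst \<kappa>) i) + int (q (snd \<kappa>) i)"]
    by blast
  have rng: "fst \<kappa> < NX" "snd \<kappa> < NW" "fst \<kappa>' < NX" "snd \<kappa>' < NW" using \<kappa>(1,2) by (auto simp: K_def)
  have ne: "(fst \<kappa>, snd \<kappa>) \<noteq> (fst \<kappa>', snd \<kappa>')" using \<kappa>(3) by simp
  show False
  proof (cases "snd \<kappa>' \<le> snd \<kappa>")
    case True
    show False by (rule main[OF rng ne True z eq])
  next
    case False
    show False
    proof (rule main[OF rng(3,4,1,2) ne[symmetric], of "- z" "- s"])
      fix i assume i: "i < Suc n"
      show "int (p (fst \<kappa>') i) + int (q (snd \<kappa>') i) - (int (p (fst \<kappa>) i) + int (q (snd \<kappa>) i)) =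
        int (xp i) * - s + rs ! i \<bullet> - z"
        using eq[OF i] row_uminus[OF rs(1,2) z i] by simp
    qed (use False z in simp_all)
  qed
qed

text \<open>If the slacks of \<open>h\<close> live on rows with vanishing minor, bordering by the unit vector of row \<open>j\<close> gives a
  lattice of index \<open>\<bar>d\<^sub>j\<bar>\<close>, and a single chain of unit steps suffices.\<close>

lemma zero_part_bound:
  fixes h :: "int vec" and rs :: "int vec list"
  assumes rs: "length rs = Suc n" "set rs \<subseteq> carrier_vec n" "spanning n (set rs)"
    and h: "irreducible_in_cone n (set rs) h"
    and supp: "\<And>i. i < Suc n \<Longrightarrow> omit_minor n rs i \<noteq> 0 \<Longrightarrow> rs ! i \<bullet> h = 0"
    and j: "j < Suc n" "omit_minor n rs j \<noteq> 0"
  shows "(\<Sum>i<Suc n. rs ! i \<bullet> h) \<le> \<bar>omit_minor n rs j\<bar>"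
proof (rule ccontr)
  assume long: "\<not> (\<Sum>i<Suc n. rs ! i \<bullet> h) \<le> \<bar>omit_minor n rs j\<bar>"
  have hcone: "in_cone (set rs) h" using h by (auto simp: irreducible_in_cone_def)
  have y0: "0 \<le> rs ! i \<bullet> h" if "i < Suc n" for i using hcone that rs(1) by (simp add: in_cone_def)
  define x where "x i = (if i < Suc n then nat (rs ! i \<bullet> h) else 0)" for i
  have xi: "int (x i) = rs ! i \<bullet> h" if "i < Suc n" for i using y0[OF that] that by (simp add: x_def)
  define T where "T = (\<Sum>i<Suc n. x i)"
  have T: "int T = (\<Sum>i<Suc n. rs ! i \<bullet> h)"
    unfolding T_def of_nat_sum by (rule sum.cong) (use xi in auto)
  obtain q where q: "q T = x" "\<And>s t. s \<le> t \<Longrightarrow> t \<le> T \<Longrightarrow> q s \<le> q t" "\<And>t. t \<le> T \<Longrightarrow> (\<Sum>i<Suc n. q t i) = t"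
    using unit_step_chain[of "Suc n" x] unfolding T_def by (auto simp: x_def)
  have q_le: "q t i \<le> x i" if "t \<le> T" for t i using q(2)[OF that order.refl] q(1) by (simp add: le_fun_def)
  have q_mono: "q s i \<le> q t i" if "s \<le> t" "t \<le> T" for s t i using q(2)[OF that] by (simp add: le_fun_def)
  have q_sum: "(\<Sum>i<Suc n. int (q t i)) = int t" if "t \<le> T" for t using q(3)[OF that] by (simp only: flip: of_nat_sum)
  define e where "e i = (if i = j then 1 else 0 :: int)" for i
  have "(\<Sum>i<Suc n. e i * omit_minor n rs i) = (\<Sum>i<Suc n. if i = j then omit_minor n rs i else 0)"
    by (rule sum.cong) (auto simp: e_def)
  then have det: "(\<Sum>i<Suc n. e i * omit_minor n rs i) = omit_minor n rs j"
    using j(1) by (simp add: sum.delta del: sum.lessThan_Suc)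
  have main: False if uu: "u < T" "u' < u" and z: "z \<in> carrier_vec n"
    and eq: "\<And>i. i < Suc n \<Longrightarrow> int (q u i) - int (q u' i) = e i * s + rs ! i \<bullet> z" for u u' s z
  proof -
    have b: "q u' i \<le> q u i" "q u i \<le> x i" for i using q_mono[of u' u i] q_le[of u i] uu by auto
    have dz: "omit_minor n rs i * (int (q u i) - int (q u' i)) = 0" if "i < Suc n" for i
    proof (cases "omit_minor n rs i = 0")
      case False
      then have "x i = 0" using supp[OF that] xi[OF that] by simp
      then show ?thesis using b[of i] by simp
    qed simp
    have "0 = (\<Sum>i<Suc n. omit_minor n rs i * (int (q u i) - int (q u' i)))"
      using dz by (intro sum.neutral[symmetric]) auto
    also have "\<dots> = (\<Sum>i<Suc n. (if i = j then omit_minor n rs i * s else 0) + omit_minor n rs i * (rs ! i \<bullet> z))"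
      by (rule sum.cong) (use eq in \<open>auto simp: e_def distrib_left\<close>)
    also have "\<dots> = omit_minor n rs j * s"
      unfolding sum.distrib omit_minor_orthogonal[OF rs(1,2) z] using j(1) by (simp add: sum.delta del: sum.lessThan_Suc)
    finally have "s = 0" using j(2) by simp
    show False
    proof (rule irreducible_no_proper_part[OF rs h z])
      show "rs ! i \<bullet> z = int (q u i) - int (q u' i)" if "i < Suc n" for i using eq[OF that] \<open>s = 0\<close> by simp
      show "int (q u i) - int (q u' i) \<le> rs ! i \<bullet> h" if "i < Suc n" for i using b[of i] xi[OF that] by simp
      have tot: "(\<Sum>i<Suc n. int (q u i) - int (q u' i)) = int u - int u'"
        using q_sum[of u] q_sum[of u'] uu by (simp only: sum_subtractf)
      show "0 < (\<Sum>i<Suc n. int (q u i) - int (q u' i))" unfolding tot using uu by simp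
      show "(\<Sum>i<Suc n. int (q u i) - int (q u' i)) < (\<Sum>i<Suc n. rs ! i \<bullet> h)" unfolding tot T[symmetric] using uu by simp
    qed (use b in simp)
  qed
  have nz: "(\<Sum>i<Suc n. e i * omit_minor n rs i) \<noteq> 0" unfolding det by (rule j(2))
  have card: "\<bar>\<Sum>i<Suc n. e i * omit_minor n rs i\<bar> < int (card {..<T})" unfolding det using long T by simp
  obtain u u' s z where u: "u \<in> {..<T}" "u' \<in> {..<T}" "u \<noteq> u'" and z: "z \<in> carrier_vec n"
    and eq: "\<And>i. i < Suc n \<Longrightarrow> int (q u i) - int (q u' i) = e i * s + rs ! i \<bullet> z"
    using bordered_congruence[OF rs(1,2) nz finite_lessThan card, of "\<lambda>u i. int (q u i)"] by blast
  show False
  proof (cases "u' < u")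
    case True
    show False by (rule main[OF _ True z eq]) (use u in auto)
  next
    case False
    show False
    proof (rule main[of u' u "- z" "- s"])
      fix i assume i: "i < Suc n"
      show "int (q u' i) - int (q u i) = e i * - s + rs ! i \<bullet> - z"
        using eq[OF i] row_uminus[OF rs(1,2) z i] by simp
    qed (use u False z in auto)
  qed
qed

text \<open>The weights \<open>y\<^sub>i y\<^sub>j / M\<close> on pairs of rows with positive and negative minor form the product coupling of the
  two sides of \<open>\<Sum>i. d\<^sub>i y\<^sub>i = 0\<close>; rows with zero minor are paired with a row \<open>j0\<close> of maximal \<open>\<bar>d\<bar>\<close>, which makes their
  ray vectors longest.\<close>

lemma hull_of_corank_one_cone:
  fixes h :: "int vec" and rs :: "int vec list"
  assumes rs: "length rs = Suc n" "set rs \<subseteq> carrier_vec n" "spanning n (set rs)"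
    and h: "irreducible_in_cone n (set rs) h"
  shows "real_vec h \<in> conv n (insert (0\<^sub>v n) (real_vec ` ray_vectors n (set rs)))"
proof -
  define d where "d = omit_minor n rs"
  define y where "y i = rs ! i \<bullet> h" for i
  have hc: "h \<in> carrier_vec n" and hcone: "in_cone (set rs) h" using h by (auto simp: irreducible_in_cone_def)
  have y0: "0 \<le> y i" if "i < Suc n" for i using hcone that rs(1) by (simp add: in_cone_def y_def)
  define P where "P = {i. i < Suc n \<and> 0 < d i}"
  define N where "N = {i. i < Suc n \<and> d i < 0}"
  define Z where "Z = {i. i < Suc n \<and> d i = 0}"
  have fin: "finite P" "finite N" "finite Z" by (simp_all add: P_def N_def Z_def)
  have cover: "{..<Suc n} = P \<union> (N \<union> Z)" by (auto simp: P_def N_def Z_def)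
  have split: "(\<Sum>i<Suc n. g i) = sum g P + (sum g N + sum g Z)" for g :: "nat \<Rightarrow> int"
  proof -
    have "sum g (N \<union> Z) = sum g N + sum g Z" using fin by (intro sum.union_disjoint) (auto simp: N_def Z_def)
    moreover have "sum g (P \<union> (N \<union> Z)) = sum g P + sum g (N \<union> Z)"
      using fin by (intro sum.union_disjoint) (auto simp: P_def N_def Z_def)
    ultimately show ?thesis unfolding cover by simp
  qed
  obtain i0 where i0: "i0 < Suc n" "d i0 \<noteq> 0" using omit_minor_nonzero[OF rs] unfolding d_def by blast
  have "Max ((\<lambda>i. \<bar>d i\<bar>) ` {..<Suc n}) \<in> (\<lambda>i. \<bar>d i\<bar>) ` {..<Suc n}" by (rule Max_in) auto
  then obtain j0 where j0: "j0 < Suc n" "\<bar>d j0\<bar> = Max ((\<lambda>i. \<bar>d i\<bar>) ` {..<Suc n})" by auto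
  define D where "D = \<bar>d j0\<bar>"
  have dD: "\<bar>d i\<bar> \<le> D" if "i < Suc n" for i unfolding D_def j0(2) using that by (intro Max_ge) auto
  have Dpos: "0 < D" using dD[OF i0(1)] i0(2) by linarith
  then have dj0: "d j0 \<noteq> 0" by (auto simp: D_def)
  define M where "M = (\<Sum>i\<in>P. d i * y i)"
  have "(\<Sum>i<Suc n. d i * y i) = 0" unfolding d_def y_def by (rule omit_minor_orthogonal[OF rs(1,2) hc])
  moreover have "(\<Sum>i\<in>Z. d i * y i) = 0" by (rule sum.neutral) (simp add: Z_def)
  ultimately have "(\<Sum>i\<in>N. d i * y i) = - M" using split[of "\<lambda>i. d i * y i"] by (simp add: M_def)
  moreover have "(\<Sum>j\<in>N. y j * \<bar>d j\<bar>) = (\<Sum>j\<in>N. - (d j * y j))"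
    by (rule sum.cong) (auto simp: N_def)
  ultimately have MN: "(\<Sum>j\<in>N. y j * \<bar>d j\<bar>) = M" by (simp add: sum_negf)
  define X where "X = sum y P"
  have X0: "0 \<le> X" unfolding X_def using y0 by (intro sum_nonneg) (simp add: P_def)
  \<comment> \<open>The ray vectors that carry the combination, and their slack vectors.\<close>
  define K where "K = P \<times> N \<union> Z \<times> {j0}"
  have "\<forall>\<kappa>\<in>K. \<exists>c. c \<in> ray_vectors n (set rs) \<and> (\<forall>l<Suc n. rs ! l \<bullet> c =
      (if l = fst \<kappa> then \<bar>d (snd \<kappa>)\<bar> else 0) + (if l = snd \<kappa> then \<bar>d (fst \<kappa>)\<bar> else 0))"
  proof
    fix \<kappa> assume k: "\<kappa> \<in> K"
    have c: "fst \<kappa> < Suc n" "snd \<kappa> < Suc n" "fst \<kappa> \<noteq> snd \<kappa>" "d (fst \<kappa>) * d (snd \<kappa>) \<le> 0" "d (snd \<kappa>) \<noteq> 0"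
      using k j0(1) dj0 by (auto simp: K_def P_def N_def Z_def mult_nonneg_nonpos)
    obtain c' where "c' \<in> ray_vectors n (set rs)" "rs ! fst \<kappa> \<bullet> c' = \<bar>d (snd \<kappa>)\<bar>" "rs ! snd \<kappa> \<bullet> c' = \<bar>d (fst \<kappa>)\<bar>"
      "\<And>l. l < Suc n \<Longrightarrow> l \<noteq> fst \<kappa> \<Longrightarrow> l \<noteq> snd \<kappa> \<Longrightarrow> rs ! l \<bullet> c' = 0"
      using two_row_ray[OF rs(1,2) c(1,2,3)] c(4,5) unfolding d_def by metis
    then show "\<exists>c. c \<in> ray_vectors n (set rs) \<and> (\<forall>l<Suc n. rs ! l \<bullet> c =
      (if l = fst \<kappa> then \<bar>d (snd \<kappa>)\<bar> else 0) + (if l = snd \<kappa> then \<bar>d (fst \<kappa>)\<bar> else 0))"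
      using c(3) by (intro exI[of _ c']) auto
  qed
  from bchoice[OF this] obtain c where c: "\<And>\<kappa>. \<kappa> \<in> K \<Longrightarrow> c \<kappa> \<in> ray_vectors n (set rs)"
    and rc: "\<And>\<kappa> l. \<kappa> \<in> K \<Longrightarrow> l < Suc n \<Longrightarrow> rs ! l \<bullet> c \<kappa> =
      (if l = fst \<kappa> then \<bar>d (snd \<kappa>)\<bar> else 0) + (if l = snd \<kappa> then \<bar>d (fst \<kappa>)\<bar> else 0)"
    by blast
  have sumK: "(\<Sum>\<kappa>\<in>K. g \<kappa>) = (\<Sum>i\<in>P. \<Sum>j\<in>N. g (i, j)) + (\<Sum>i\<in>Z. g (i, j0))" for g :: "nat \<times> nat \<Rightarrow> int"
  proof -
    have "(\<Sum>\<kappa>\<in>K. g \<kappa>) = sum g (P \<times> N) + sum g (Z \<times> {j0})"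
      unfolding K_def using fin by (intro sum.union_disjoint) (auto simp: P_def Z_def)
    then show ?thesis by (simp add: sum.cartesian_product' )
  qed
  \<comment> \<open>The weights are \<open>\<alpha> y\<^sub>i y\<^sub>j\<close> on \<open>P \<times> N\<close> and \<open>\<beta> y\<^sub>i\<close> on \<open>Z \<times> {j0}\<close>, with common denominator \<open>B\<close>; if \<open>X = 0\<close>, then \<open>M = 0\<close>
    and the first kind is switched off by \<open>\<alpha> = 0\<close>.\<close>
  have combine: ?thesis
    if ab: "0 \<le> \<alpha>" "0 \<le> \<beta>" "\<And>l. l \<in> P \<union> N \<Longrightarrow> \<alpha> * M * y l = B * y l" "\<beta> * D = B" "0 < B"
      and tot: "\<alpha> * (X * sum y N) + \<beta> * sum y Z \<le> B" for \<alpha> \<beta> B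
  proof -
    define \<omega> where "\<omega> \<kappa> = (if fst \<kappa> \<in> P then \<alpha> * (y (fst \<kappa>) * y (snd \<kappa>)) else \<beta> * y (fst \<kappa>))" for \<kappa> :: "nat \<times> nat"
    have \<omega>P: "\<omega> (i, j) = \<alpha> * (y i * y j)" if "i \<in> P" for i j using that by (simp add: \<omega>_def)
    have \<omega>Z: "\<omega> (i, j) = \<beta> * y i" if "i \<in> Z" for i j using that by (auto simp: \<omega>_def P_def Z_def)
    show ?thesis
    proof (rule hull_of_weighted_rays[OF rs(2,3) hc, of K c \<omega> B])
      show "finite K" using fin by (simp add: K_def)
      show "c \<kappa> \<in> insert (0\<^sub>v n) (ray_vectors n (set rs))" if "\<kappa> \<in> K" for \<kappa> using c[OF that] by simp
      show "0 \<le> \<omega> \<kappa>" if "\<kappa> \<in> K" for \<kappa>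
        using that ab(1,2) y0 by (auto simp: \<omega>_def K_def P_def N_def Z_def)
      have "(\<Sum>i\<in>P. \<Sum>j\<in>N. \<omega> (i, j)) = (\<Sum>i\<in>P. \<Sum>j\<in>N. \<alpha> * (y i * y j))" using \<omega>P by (intro sum.cong) auto
      also have "\<dots> = \<alpha> * (X * sum y N)" unfolding X_def sum_product by (simp add: sum_distrib_left)
      finally have "sum \<omega> K = \<alpha> * (X * sum y N) + \<beta> * sum y Z"
        unfolding sumK using \<omega>Z by (simp add: sum_distrib_left)
      then show "sum \<omega> K \<le> B" using tot by simp
      show "0 < B" by (rule ab(5))
      fix a assume "a \<in> set rs"
      then obtain l where l: "l < Suc n" "a = rs ! l" using rs(1) by (auto simp: in_set_conv_nth)
      have row_P: "(\<Sum>j\<in>N. \<omega> (i, j) * (rs ! l \<bullet> c (i, j))) =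
          (if l = i then \<alpha> * M * y i else 0) + (if l \<in> N then \<alpha> * y l * (d i * y i) else 0)" if i: "i \<in> P" for i
      proof -
        have "(\<Sum>j\<in>N. \<omega> (i, j) * (rs ! l \<bullet> c (i, j))) =
            (\<Sum>j\<in>N. (if l = i then \<alpha> * y i * (y j * \<bar>d j\<bar>) else 0) + (if l = j then \<alpha> * y l * (d i * y i) else 0))"
        proof (rule sum.cong[OF refl])
          fix j assume j: "j \<in> N"
          have "\<bar>d i\<bar> = d i" "(i, j) \<in> K" using i j by (auto simp: P_def K_def)
          then show "\<omega> (i, j) * (rs ! l \<bullet> c (i, j)) =
              (if l = i then \<alpha> * y i * (y j * \<bar>d j\<bar>) else 0) + (if l = j then \<alpha> * y l * (d i * y i) else 0)"
            using rc[of "(i, j)" l] l(1) \<omega>P[OF i] by (simp add: distrib_left)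
        qed
        moreover have "(\<Sum>j\<in>N. \<alpha> * y i * (y j * \<bar>d j\<bar>)) = \<alpha> * M * y i"
          unfolding sum_distrib_left[symmetric] MN by simp
        ultimately show ?thesis using fin by (simp add: sum.distrib)
      qed
      have "(\<Sum>i\<in>P. \<Sum>j\<in>N. \<omega> (i, j) * (rs ! l \<bullet> c (i, j))) =
          (\<Sum>i\<in>P. (if l = i then \<alpha> * M * y i else 0) + (if l \<in> N then \<alpha> * y l * (d i * y i) else 0))"
        using row_P by (intro sum.cong) auto
      also have "\<dots> = (if l \<in> P then \<alpha> * M * y l else 0) + (if l \<in> N then \<alpha> * y l * M else 0)"
        using fin by (simp add: sum.distrib M_def sum_distrib_left)
      also have "\<dots> = (if l \<in> P \<union> N then \<alpha> * M * y l else 0)" by (auto simp: P_def N_def mult.assoc mult.left_commute mult.commute)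
      finally have sum_P: "(\<Sum>i\<in>P. \<Sum>j\<in>N. \<omega> (i, j) * (rs ! l \<bullet> c (i, j))) = (if l \<in> P \<union> N then \<alpha> * M * y l else 0)" .
      have "(\<Sum>i\<in>Z. \<omega> (i, j0) * (rs ! l \<bullet> c (i, j0))) = (\<Sum>i\<in>Z. if l = i then \<beta> * D * y i else 0)"
      proof (rule sum.cong[OF refl])
        fix i assume i: "i \<in> Z"
        then have "d i = 0" "(i, j0) \<in> K" by (auto simp: Z_def K_def)
        then show "\<omega> (i, j0) * (rs ! l \<bullet> c (i, j0)) = (if l = i then \<beta> * D * y i else 0)"
          using rc[of "(i, j0)" l] l(1) \<omega>Z[OF i] by (simp add: D_def)
      qed
      also have "\<dots> = (if l \<in> Z then B * y l else 0)" using fin ab(4) by simp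
      finally have "(\<Sum>\<kappa>\<in>K. \<omega> \<kappa> * (rs ! l \<bullet> c \<kappa>)) =
          (if l \<in> P \<union> N then \<alpha> * M * y l else 0) + (if l \<in> Z then B * y l else 0)"
        unfolding sumK sum_P by simp
      also have "(if l \<in> P \<union> N then \<alpha> * M * y l else 0) + (if l \<in> Z then B * y l else 0) = B * y l"
        using ab(3)[of l] l(1) by (auto simp: P_def N_def Z_def)
      finally show "(\<Sum>\<kappa>\<in>K. \<omega> \<kappa> * (a \<bullet> c \<kappa>)) = B * (a \<bullet> h)" by (simp add: l(2) y_def)
    qed
  qed
  show ?thesis
  proof (cases "0 < X")
    case True
    have "{i. i < Suc n \<and> d i \<le> 0} = N \<union> Z" by (auto simp: N_def Z_def)
    moreover have "sum y (N \<union> Z) = sum y N + sum y Z"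
      using fin by (intro sum.union_disjoint) (auto simp: N_def Z_def)
    ultimately have "sum y {i. i < Suc n \<and> d i \<le> 0} = sum y N + sum y Z" by simp
    then have bound: "X * (sum y N + sum y Z) \<le> M"
      using positive_part_bound[OF rs h] True by (simp add: X_def M_def P_def y_def d_def)
    have MD: "M \<le> D * X" unfolding M_def X_def sum_distrib_left
    proof (rule sum_mono)
      fix i assume "i \<in> P"
      then show "d i * y i \<le> D * y i" using dD[of i] y0[of i] by (intro mult_right_mono) (auto simp: P_def)
    qed
    have nn: "0 \<le> sum y N" "0 \<le> sum y Z" using y0 by (auto intro!: sum_nonneg simp: N_def Z_def)
    have XM: "X \<le> M" unfolding X_def M_def
    proof (rule sum_mono)
      fix i assume i: "i \<in> P"
      then have "1 * y i \<le> d i * y i" using y0[of i] by (intro mult_right_mono) (auto simp: P_def)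
      then show "y i \<le> d i * y i" by simp
    qed
    show ?thesis
    proof (rule combine[of D M "D * M"])
      show "D * (X * sum y N) + M * sum y Z \<le> D * M"
      proof -
        have "M * sum y Z \<le> D * X * sum y Z" using MD nn by (intro mult_right_mono) auto
        then have "D * (X * sum y N) + M * sum y Z \<le> D * (X * (sum y N + sum y Z))" by (simp add: algebra_simps)
        also have "\<dots> \<le> D * M" using bound Dpos by (intro mult_left_mono) auto
        finally show ?thesis .
      qed
    qed (use Dpos True XM in auto)
  next
    case False
    then have "sum y P = 0" using X0 by (simp add: X_def)
    then have yP: "y i = 0" if "i \<in> P" for i
      using that fin y0 by (subst (asm) sum_nonneg_eq_0_iff) (auto simp: P_def)
    then have "M = 0" unfolding M_def by (intro sum.neutral) auto
    then have "(\<Sum>j\<in>N. y j * \<bar>d j\<bar>) = 0" using MN by simp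
    moreover have "0 \<le> y j * \<bar>d j\<bar>" if "j \<in> N" for j
      using that y0 by (intro mult_nonneg_nonneg) (auto simp: N_def)
    ultimately have "\<forall>j\<in>N. y j * \<bar>d j\<bar> = 0"
      using sum_nonneg_eq_0_iff[OF fin(2), of "\<lambda>j. y j * \<bar>d j\<bar>"] by blast
    then have yN: "y j = 0" if "j \<in> N" for j using that by (auto simp: N_def)
    have "(\<Sum>i<Suc n. rs ! i \<bullet> h) \<le> \<bar>omit_minor n rs j0\<bar>"
    proof (rule zero_part_bound[OF rs h _ j0(1)])
      show "omit_minor n rs j0 \<noteq> 0" using dj0 by (simp add: d_def)
      show "rs ! i \<bullet> h = 0" if "i < Suc n" "omit_minor n rs i \<noteq> 0" for i
        using yP[of i] yN[of i] that by (auto simp: P_def N_def y_def d_def neq_iff)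
    qed
    then have "sum y Z \<le> D"
      using split[of y] yP yN by (simp add: D_def d_def y_def)
    then show ?thesis using combine[of 0 1 D] yP yN Dpos by auto
  qed
qed

section \<open>Ray vectors and normalized generators\<close>

text \<open>Full column rank means that the columns are distinct and independent.\<close>

lemma (in vec_space) full_column_rank_kernel:
  assumes A: "A \<in> carrier_mat n nc" and rank: "rank A = nc"
    and v: "v \<in> carrier_vec nc" "A *\<^sub>v v = 0\<^sub>v n"
  shows "v = 0\<^sub>v nc"
proof -
  obtain S where S: "maximal S (\<lambda>T. T \<subseteq> set (cols A) \<and> lin_indpt T)"
    using maximal_exists[of "\<lambda>T. T \<subseteq> set (cols A) \<and> lin_indpt T" "card (set (cols A))" "{}"]
    by (meson List.finite_set card_mono empty_iff empty_subsetI finite_lin_indpt2 rev_finite_subset)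
  have "S \<subseteq> set (cols A)" using S by (simp add: maximal_def)
  then have "card S \<le> card (set (cols A))" by (simp add: card_mono)
  then have "length (cols A) \<le> card (set (cols A))"
    using rank_card_indpt[OF A S] rank A by simp
  then have dist: "distinct (cols A)" by (metis card_distinct card_length le_antisym)
  have "lin_indpt (set (cols A))" using full_rank_lin_indpt[OF A rank dist] .
  then show ?thesis using lin_depI[OF A v(1) _ v(2) dist] by blast
qed

lemma full_column_rank_spanning:
  assumes A: "A \<in> carrier_mat m n" and rank: "vec_space.rank m (real_mat A) = n"
  shows "spanning n (set (rows A))"
  unfolding spanning_def
proof (intro ballI impI)
  fix z :: "int vec" assume z: "z \<in> carrier_vec n" and orth: "\<forall>a\<in>set (rows A). a \<bullet> z = 0"
  have RA: "real_mat A \<in> carrier_mat m n" using A by simp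
  have "real_mat A *\<^sub>v real_vec z = 0\<^sub>v m"
  proof (rule eq_vecI)
    fix i assume "i < dim_vec (0\<^sub>v m :: real vec)"
    then have i: "i < m" by simp
    have "row A i \<bullet> z = 0" using orth i A by (auto simp: rows_def)
    then have "real_of_int (row A i \<bullet> z) = 0" by simp
    then show "(real_mat A *\<^sub>v real_vec z) $ i = 0\<^sub>v m $ i"
      using i A z by (simp add: scalar_prod_def)
  qed (use A in simp)
  moreover have "real_vec z \<in> carrier_vec n" using z by simp
  ultimately have "real_vec z = 0\<^sub>v n" using vec_space.full_column_rank_kernel[OF RA rank] by blast
  then have "real_of_int (z $ i) = 0" if "i < n" for i
    using arg_cong[of "real_vec z" "0\<^sub>v n" "\<lambda>v. v $ i"] that z by simp
  then show "z = 0\<^sub>v n" using z by auto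
qed

text \<open>The enumeration \<open>pick\<close> is the one used by \<open>submatrix\<close>.\<close>

definition selected_rows :: "'a mat \<Rightarrow> nat set \<Rightarrow> 'a vec list" where
  "selected_rows A I = map (\<lambda>k. row A (pick I k)) [0..<card I]"

lemma selected_rows_simps [simp]:
  "length (selected_rows A I) = card I"
  by (simp add: selected_rows_def)

lemma set_pick:
  assumes "finite I"
  shows "set (map (pick I) [0..<card I]) = I" "distinct (map (pick I) [0..<card I])"
proof -
  have inj: "inj_on (pick I) {0..<card I}"
    by (rule linorder_inj_onI') (metis atLeastLessThan_iff less_irrefl pick_mono_le)
  then show "distinct (map (pick I) [0..<card I])" by (simp add: distinct_map)
  have "pick I ` {0..<card I} \<subseteq> I" by (auto intro: pick_in_set_le)
  moreover have "card (pick I ` {0..<card I}) = card I" by (simp add: card_image[OF inj])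
  ultimately have "pick I ` {0..<card I} = I" using assms by (simp add: card_subset_eq)
  then show "set (map (pick I) [0..<card I]) = I" by simp
qed

lemma set_selected_rows:
  assumes "I \<subseteq> {..<dim_row A}"
  shows "set (selected_rows A I) = row A ` I" "set (selected_rows A I) \<subseteq> set (rows A)"
proof -
  have "finite I" using assms finite_subset by blast
  have "set (selected_rows A I) = row A ` set (map (pick I) [0..<card I])" by (auto simp: selected_rows_def)
  then show "set (selected_rows A I) = row A ` I" using set_pick(1)[OF \<open>finite I\<close>] by simp
  then show "set (selected_rows A I) \<subseteq> set (rows A)" using assms by (auto simp: rows_def)
qed

lemma mset_selected_rows:
  assumes "distinct ps"
  shows "mset (selected_rows A (set ps)) = mset (map (row A) ps)"
proof -
  have "mset (map (pick (set ps)) [0..<card (set ps)]) = mset ps"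
    by (subst set_eq_iff_mset_eq_distinct[symmetric]) (use set_pick[of "set ps"] assms in auto)
  then have "mset (map (row A) (map (pick (set ps)) [0..<card (set ps)])) = mset (map (row A) ps)"
    by (metis mset_map)
  then show ?thesis by (simp add: selected_rows_def comp_def)
qed

lemma row_indices:
  assumes "distinct xs" "set xs \<subseteq> set (rows A)"
  obtains ps where "distinct ps" "set ps \<subseteq> {..<dim_row A}" "xs = map (row A) ps"
proof -
  have "\<forall>x\<in>set xs. \<exists>p. p < dim_row A \<and> row A p = x"
    using assms(2) by (fastforce simp: rows_def)
  from bchoice[OF this] obtain f where f: "\<forall>x\<in>set xs. f x < dim_row A \<and> row A (f x) = x" by blast
  have "inj_on f (set xs)" by (rule inj_onI) (metis f)
  then have "distinct (map f xs)" using assms(1) by (simp add: distinct_map)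
  moreover have "xs = map (row A) (map f xs)" using f by (simp add: map_idI)
  ultimately show ?thesis using that[of "map f xs"] f by auto
qed

lemma pick_lessThan: "a < k \<Longrightarrow> pick {..<k} a = a"
proof -
  assume a: "a < k"
  have "{b \<in> {..<k}. b < a} = {..<a}" using a by auto
  then have "card {b \<in> {..<k}. b < a} = a" by simp
  then show ?thesis using pick_card_in_set[of a "{..<k}"] a by simp
qed

lemma pick_lessThan_remove:
  assumes "i < n" "b < n - 1"
  shows "pick ({..<n} - {i}) b = (if b < i then b else Suc b)"
proof -
  let ?x = "if b < i then b else Suc b"
  have x: "?x \<in> {..<n} - {i}" using assms by auto
  have "{a \<in> {..<n} - {i}. a < ?x} = (if b < i then {..<b} else {..<Suc b} - {i})" using assms by auto
  then have "card {a \<in> {..<n} - {i}. a < ?x} = b" using assms by simp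
  then show ?thesis using pick_card_in_set[OF x] by simp
qed

lemma submatrix_all_columns:
  assumes "I \<subseteq> {..<dim_row A}"
  shows "submatrix A I {..<dim_col A} = mat_of_rows (dim_col A) (selected_rows A I)"
proof -
  have I: "{i. i < dim_row A \<and> i \<in> I} = I" using assms by auto
  have J: "{j. j < dim_col A \<and> j \<in> {..<dim_col A}} = {..<dim_col A}" by auto
  have "pick I k < dim_row A" if "k < card I" for k using pick_in_set_le[OF that] assms by auto
  then show ?thesis
    by (intro eq_matI) (auto simp: submatrix_def I J pick_lessThan mat_of_rows_def selected_rows_def)
qed

lemma minor_vec_cross_vec:
  assumes "I \<subseteq> {..<dim_row A}" "card I + 1 = dim_col A"
  shows "minor_vec A I = cross_vec (dim_col A) (selected_rows A I)"
proof (rule eq_vecI)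
  fix i assume "i < dim_vec (cross_vec (dim_col A) (selected_rows A I))"
  then have i: "i < dim_col A" by (simp add: cross_vec_def)
  let ?n = "dim_col A"
  have I: "{i. i < dim_row A \<and> i \<in> I} = I" using assms by auto
  have J: "{j. j < ?n \<and> j \<in> {..<?n} - {i}} = {..<?n} - {i}" by auto
  have cJ: "card ({..<?n} - {i}) = ?n - 1" using i by simp
  have pk: "pick I k < dim_row A" if "k < card I" for k using pick_in_set_le[OF that] assms by auto
  have "submatrix A I ({..<?n} - {i}) = mat_delete (mat_of_rows ?n (0\<^sub>v ?n # selected_rows A I)) 0 i"
  proof (rule eq_matI)
    fix a b assume "a < dim_row (mat_delete (mat_of_rows ?n (0\<^sub>v ?n # selected_rows A I)) 0 i)"
      "b < dim_col (mat_delete (mat_of_rows ?n (0\<^sub>v ?n # selected_rows A I)) 0 i)"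
    then have ab: "a < card I" "b < ?n - 1" by auto
    have "submatrix A I ({..<?n} - {i}) $$ (a, b) = A $$ (pick I a, pick ({..<?n} - {i}) b)"
      by (rule submatrix_index) (use ab cJ in \<open>simp_all only: I J\<close>)
    also have "\<dots> = A $$ (pick I a, if b < i then b else Suc b)"
      using pick_lessThan_remove[OF i ab(2)] by simp
    also have "\<dots> = mat_delete (mat_of_rows ?n (0\<^sub>v ?n # selected_rows A I)) 0 i $$ (a, b)"
      using ab i pk by (simp add: mat_delete_def mat_of_rows_def selected_rows_def)
    finally show "submatrix A I ({..<?n} - {i}) $$ (a, b) = mat_delete (mat_of_rows ?n (0\<^sub>v ?n # selected_rows A I)) 0 i $$ (a, b)" .
  qed (use cJ in \<open>simp_all only: dim_submatrix I J, simp_all\<close>)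
  then show "minor_vec A I $ i = cross_vec ?n (selected_rows A I) $ i"
    using i by (simp add: minor_vec_def cross_vec_def cofactor_def)
qed (simp add: minor_vec_def cross_vec_def)

text \<open>Repeated rows give determinant zero; otherwise the list is a permutation of the rows of a submatrix.\<close>

lemma det_rows_of_minors:
  assumes A: "A \<in> carrier_mat m n" and minors: "minors A n \<subseteq> {0, k, - k, 2 * k, - 2 * k}"
    and xs: "length xs = n" "set xs \<subseteq> set (rows A)"
  shows "det_rows n xs \<in> {0, k, - k, 2 * k, - 2 * k}"
proof (cases "distinct xs")
  case False
  then show ?thesis by (simp add: det_rows_repeat)
next
  case True
  obtain ps where ps: "distinct ps" "set ps \<subseteq> {..<m}" "xs = map (row A) ps"
    using row_indices[OF True xs(2)] A by auto
  have I: "card (set ps) = n" using ps xs(1) distinct_card by fastforce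
  have "det (submatrix A (set ps) {..<n}) \<in> minors A n"
    unfolding minors_def
    by (intro CollectI exI[of _ "set ps"] exI[of _ "{..<n}"]) (use ps(2) A I in auto)
  moreover have "det (submatrix A (set ps) {..<n}) = det_rows n (selected_rows A (set ps))"
    using submatrix_all_columns[of "set ps" A] ps(2) A by (simp add: det_rows_def)
  moreover have "\<bar>det_rows n (selected_rows A (set ps))\<bar> = \<bar>det_rows n xs\<bar>"
    using abs_det_rows_permute[OF mset_selected_rows[OF ps(1)]] ps(3) by simp
  ultimately show ?thesis using minors by (auto simp: abs_eq_iff)
qed

lemma ray_vector_minor_vec:
  assumes A: "A \<in> carrier_mat m n" and c: "c \<in> ray_vectors n (set (rows A))" "c \<noteq> 0\<^sub>v n"
  obtains I where "I \<subseteq> {..<m}" "card I + 1 = n" "c = minor_vec A I \<or> c = - minor_vec A I"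
proof -
  obtain qs where qs: "length qs + 1 = n" "set qs \<subseteq> set (rows A)" "c = cross_vec n qs \<or> c = - cross_vec n qs"
    using c by (auto simp: ray_vectors_def)
  have dist: "distinct qs"
  proof (rule ccontr)
    assume "\<not> distinct qs"
    then have "det_rows n (unit_vec n j # qs) = 0" for j by (intro det_rows_repeat) simp
    then have "cross_vec n qs = 0\<^sub>v n" using cross_vec_component[OF qs(1)] by (intro eq_vecI) (auto simp: cross_vec_def)
    then show False using qs(3) c(2) by auto
  qed
  obtain ps where ps: "distinct ps" "set ps \<subseteq> {..<m}" "qs = map (row A) ps"
    using row_indices[OF dist qs(2)] A by auto
  have I: "card (set ps) + 1 = n" using ps qs(1) distinct_card by fastforce
  obtain \<sigma> :: int where \<sigma>: "\<sigma> = 1 \<or> \<sigma> = - 1"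
    "\<And>us. det_rows n (us @ selected_rows A (set ps)) = \<sigma> * det_rows n (us @ qs)"
    using det_rows_permute[OF mset_selected_rows[OF ps(1)]] unfolding ps(3) by metis
  have "minor_vec A (set ps) = cross_vec n (selected_rows A (set ps))"
    using minor_vec_cross_vec[of "set ps" A] ps(2) I A by simp
  also have "\<dots> = \<sigma> \<cdot>\<^sub>v cross_vec n qs"
  proof (rule eq_vecI)
    fix j assume "j < dim_vec (\<sigma> \<cdot>\<^sub>v cross_vec n qs)"
    then have j: "j < n" by (simp add: cross_vec_def)
    have len: "length (selected_rows A (set ps)) + 1 = n" using I by simp
    show "cross_vec n (selected_rows A (set ps)) $ j = (\<sigma> \<cdot>\<^sub>v cross_vec n qs) $ j"
      using cross_vec_component[OF len j] cross_vec_component[OF qs(1) j] \<sigma>(2)[of "[unit_vec n j]"]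
        j by simp
  qed (simp add: cross_vec_def)
  finally have mv: "minor_vec A (set ps) = \<sigma> \<cdot>\<^sub>v cross_vec n qs" .
  have "c = minor_vec A (set ps) \<or> c = - minor_vec A (set ps)"
    using \<sigma>(1) qs(3) unfolding mv by (auto simp: vec_eq_iff)
  then show ?thesis using that ps(2) I by blast
qed

lemma submatrix_column_deletion:
  assumes I: "I \<subseteq> {..<dim_row A}" and i: "i < dim_col A"
    and L: "{a. a < card I \<and> a \<in> L} = {..<card I}"
  shows "submatrix (submatrix A I UNIV) L ({..<dim_col A} - {i}) = submatrix A I ({..<dim_col A} - {i})"
proof -
  let ?J = "{..<dim_col A} - {i}"
  have I': "{a. a < dim_row A \<and> a \<in> I} = I" using I by auto
  have J: "{j. j < dim_col A \<and> j \<in> ?J} = ?J" by auto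
  have U: "card {j. j < dim_col A \<and> j \<in> (UNIV :: nat set)} = dim_col A" by simp
  have "?J = {j. j < dim_col A \<and> j \<noteq> i}" by auto
  moreover have "card ?J = dim_col A - 1" using i by simp
  ultimately have cJ: "card {j. j < dim_col A \<and> j \<noteq> i} = dim_col A - 1" by simp
  have pL: "pick L a = a" if "a < card I" for a
  proof -
    have "a < card {b. b < card I \<and> b \<in> L}" using L that by simp
    from pick_reduce_set[OF this] show ?thesis using L that by (simp add: pick_lessThan)
  qed
  have pJ: "pick ?J b < dim_col A" if "b < dim_col A - 1" for b
    using pick_lessThan_remove[OF i that] that by (auto split: if_splits)
  show ?thesis
    by (rule eq_matI)
       (auto simp: submatrix_def I' J U L pL pJ pick_UNIV cJ)
qed

text \<open>A maximal minor of \<open>n - 1\<close> rows omits exactly one column, and a gcd ignores signs.\<close>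

lemma gcd_mat_minor_vec:
  assumes I: "I \<subseteq> {..<dim_row A}" "card I + 1 = dim_col A"
  shows "gcd_mat (submatrix A I UNIV) = Gcd ((\<lambda>i. minor_vec A I $ i) ` {..<dim_col A})"
proof -
  let ?n = "dim_col A" and ?M = "submatrix A I UNIV"
  have I': "{a. a < dim_row A \<and> a \<in> I} = I" using I by auto
  have dims: "dim_row ?M = card I" "dim_col ?M = ?n" by (simp_all add: dim_submatrix I')
  let ?D = "\<lambda>i. det (submatrix A I ({..<?n} - {i}))"
  have del: "submatrix ?M {..<card I} ({..<?n} - {i}) = submatrix A I ({..<?n} - {i})" if "i < ?n" for i
    by (rule submatrix_column_deletion[OF I(1) that]) auto
  have "minors ?M (card I) = ?D ` {..<?n}"
  proof (intro equalityI subsetI)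
    fix x assume "x \<in> minors ?M (card I)"
    then obtain L J where x: "x = det (submatrix ?M L J)" and L: "L \<subseteq> {..<card I}" "card L = card I"
      and J: "J \<subseteq> {..<?n}" "card J = card I" unfolding minors_def dims by blast
    have "L = {..<card I}" using L by (simp add: card_subset_eq)
    have "finite J" using J(1) finite_subset by blast
    then have "card ({..<?n} - J) = 1" using J I(2) by (simp add: card_Diff_subset)
    then obtain i where "{..<?n} - J = {i}" by (meson card_1_singletonE)
    then have i: "i < ?n" "J = {..<?n} - {i}" using J(1) by auto
    then show "x \<in> ?D ` {..<?n}" using x \<open>L = {..<card I}\<close> del[OF i(1)] by auto
  next
    fix x assume "x \<in> ?D ` {..<?n}"
    then obtain i where i: "i < ?n" "x = ?D i" by auto
    have "{..<?n} - {i} \<subseteq> {..<?n}" "card ({..<?n} - {i}) = card I" using i(1) I(2) by auto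
    moreover have "x = det (submatrix ?M {..<card I} ({..<?n} - {i}))" using del[OF i(1)] i(2) by simp
    ultimately show "x \<in> minors ?M (card I)" unfolding minors_def dims
      by (intro CollectI exI[of _ "{..<card I}"] exI[of _ "{..<?n} - {i}"]) auto
  qed
  then have g: "gcd_mat ?M = Gcd (?D ` {..<?n})" using I(2) by (simp add: gcd_mat_def dims)
  have mv: "minor_vec A I $ i = (- 1) ^ i * ?D i" if "i < ?n" for i using that by (simp add: minor_vec_def)
  have dvd: "b dvd minor_vec A I $ i \<longleftrightarrow> b dvd ?D i" if "i < ?n" for i b
    using mv[OF that] by (cases "even i") simp_all
  have "Gcd (?D ` {..<?n}) dvd Gcd ((\<lambda>i. minor_vec A I $ i) ` {..<?n})"
    by (rule Gcd_greatest) (use dvd Gcd_dvd in auto)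
  moreover have "Gcd ((\<lambda>i. minor_vec A I $ i) ` {..<?n}) dvd Gcd (?D ` {..<?n})"
  proof (rule Gcd_greatest)
    fix b assume "b \<in> ?D ` {..<?n}"
    then obtain i where i: "i < ?n" "b = ?D i" by auto
    have "Gcd ((\<lambda>i. minor_vec A I $ i) ` {..<?n}) dvd minor_vec A I $ i" by (rule Gcd_dvd) (use i in auto)
    then show "Gcd ((\<lambda>i. minor_vec A I $ i) ` {..<?n}) dvd b" using dvd[OF i(1)] i(2) by simp
  qed
  ultimately show ?thesis unfolding g by (intro zdvd_antisym_nonneg) auto
qed

lemma (in vec_space) rank_le_rows:
  assumes A: "A \<in> carrier_mat n nc"
  shows "rank A \<le> n"
proof -
  obtain S where S: "maximal S (\<lambda>T. T \<subseteq> set (cols A) \<and> lin_indpt T)"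
    using maximal_exists[of "\<lambda>T. T \<subseteq> set (cols A) \<and> lin_indpt T" "card (set (cols A))" "{}"]
    by (meson List.finite_set card_mono empty_iff empty_subsetI finite_lin_indpt2 rev_finite_subset)
  have "S \<subseteq> set (cols A)" "lin_indpt S" using S by (simp_all add: maximal_def)
  moreover have "set (cols A) \<subseteq> carrier_vec n" using cols_dim[of A] A by simp
  ultimately have "card S \<le> dim" by (intro li_le_dim(2)[OF fin_dim]) auto
  then show ?thesis using rank_card_indpt[OF A S] dim_is_n by simp
qed

lemma rank_of_nonzero_minor_vec:
  assumes I: "I \<subseteq> {..<dim_row A}" "card I + 1 = dim_col A" and nz: "minor_vec A I \<noteq> 0\<^sub>v (dim_col A)"
  shows "vec_space.rank (dim_col A - 1) (real_mat (submatrix A I UNIV)) = dim_col A - 1"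
proof -
  let ?n = "dim_col A"
  let ?M = "real_mat (submatrix A I UNIV)"
  have I': "{a. a < dim_row A \<and> a \<in> I} = I" using I by auto
  have M: "?M \<in> carrier_mat (?n - 1) ?n" using I(2) by (auto simp: dim_submatrix I')
  have "minor_vec A I \<in> carrier_vec ?n" by (simp add: minor_vec_def)
  then obtain i where i: "i < ?n" "minor_vec A I $ i \<noteq> 0" using nz by (auto simp: vec_eq_iff)
  have d: "det (submatrix A I ({..<?n} - {i})) \<noteq> 0" using i by (simp add: minor_vec_def)
  have "submatrix (submatrix A I UNIV) UNIV ({..<?n} - {i}) = submatrix A I ({..<?n} - {i})"
    by (rule submatrix_column_deletion[OF I(1) i(1)]) auto
  moreover have "submatrix ?M UNIV ({..<?n} - {i}) = real_mat (submatrix (submatrix A I UNIV) UNIV ({..<?n} - {i}))"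
  proof (rule eq_matI)
    fix a b assume "a < dim_row (real_mat (submatrix (submatrix A I UNIV) UNIV ({..<?n} - {i})))"
      "b < dim_col (real_mat (submatrix (submatrix A I UNIV) UNIV ({..<?n} - {i})))"
    then have ab: "a < card {k. k < dim_row (submatrix A I UNIV) \<and> k \<in> UNIV}"
      "b < card {j. j < dim_col (submatrix A I UNIV) \<and> j \<in> {..<?n} - {i}}"
      by (simp_all only: dim_submatrix index_map_mat)
    have "pick UNIV a < dim_row (submatrix A I UNIV)" by (rule pick_le[OF ab(1)])
    moreover have "pick ({..<?n} - {i}) b < dim_col (submatrix A I UNIV)" by (rule pick_le[OF ab(2)])
    moreover have "submatrix ?M UNIV ({..<?n} - {i}) $$ (a, b) = ?M $$ (pick UNIV a, pick ({..<?n} - {i}) b)"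
      by (rule submatrix_index) (use ab in \<open>simp_all only: index_map_mat\<close>)
    moreover have "submatrix (submatrix A I UNIV) UNIV ({..<?n} - {i}) $$ (a, b) =
        submatrix A I UNIV $$ (pick UNIV a, pick ({..<?n} - {i}) b)"
      by (rule submatrix_index[OF ab])
    moreover have "a < dim_row (submatrix (submatrix A I UNIV) UNIV ({..<?n} - {i}))"
      "b < dim_col (submatrix (submatrix A I UNIV) UNIV ({..<?n} - {i}))"
      using ab by (simp_all only: dim_submatrix)
    ultimately show "submatrix ?M UNIV ({..<?n} - {i}) $$ (a, b) =
        real_mat (submatrix (submatrix A I UNIV) UNIV ({..<?n} - {i})) $$ (a, b)" by simp
  qed (simp_all add: dim_submatrix)
  ultimately have "det (submatrix ?M UNIV ({..<?n} - {i})) \<noteq> 0" using d by simp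
  from vec_space.rank_gt_minor[OF M this] have "card {j. j < ?n \<and> j \<in> {..<?n} - {i}} \<le> vec_space.rank (?n - 1) ?M" .
  moreover have "{j. j < ?n \<and> j \<in> {..<?n} - {i}} = {..<?n} - {i}" by auto
  ultimately have "?n - 1 \<le> vec_space.rank (?n - 1) ?M" using i(1) by simp
  then show ?thesis using vec_space.rank_le_rows[OF M] by (rule antisym[rotated])
qed

lemma (in vec_space) affine_dim_one:
  assumes r: "r \<in> carrier_vec n" "r \<noteq> 0\<^sub>v n" "r \<in> {x - y | x y. x \<in> F \<and> y \<in> F}"
    and line: "\<And>x y. x \<in> F \<Longrightarrow> y \<in> F \<Longrightarrow> \<exists>c. x - y = c \<cdot>\<^sub>v r"
  shows "affine_dim F = 1"
proof -
  let ?L = "{x - y | x y. x \<in> F \<and> y \<in> F}"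
  have rs: "r \<in> span {r}" using r(1) span_self by simp
  have "?L \<subseteq> span {r}" using line smult_in_span[OF _ rs] r(1) by fastforce
  then have "span ?L \<subseteq> span {r}" using span_subsetI[of "{r}" ?L] r(1) by simp
  moreover have "span {r} \<subseteq> span ?L" by (rule span_is_monotone) (use r(3) in simp)
  ultimately have "span ?L = span {r}" by blast
  then have "affine_dim F = vectorspace.dim class_ring (span_vs {r})"
    unfolding affine_dim_def by simp
  also have "\<dots> = card {r}"
  proof (rule dim_span)
    have "lin_indpt {r}"
    proof -
      have "r \<notin> span {}" using span_empty r(2) by simp
      then show ?thesis using lindep_span[of "{r}"] r(1) by auto
    qed
    then show "maximal {r} (\<lambda>T. T \<subseteq> {r} \<and> lin_indpt T)" by (auto simp: maximal_def)
  qed (use r(1) in auto)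
  finally show ?thesis by simp
qed

lemma affine_dim_ray:
  fixes r :: "real vec"
  assumes r: "r \<in> carrier_vec n" "r \<noteq> 0\<^sub>v n"
  shows "vec_space.affine_dim n {t \<cdot>\<^sub>v r | t. 0 \<le> t} = 1"
proof (rule vec_space.affine_dim_one[OF r])
  have "r = 1 \<cdot>\<^sub>v r - 0 \<cdot>\<^sub>v r" using r(1) by (auto simp: vec_eq_iff)
  moreover have "1 \<cdot>\<^sub>v r \<in> {t \<cdot>\<^sub>v r | t. 0 \<le> t}"
    by (intro CollectI exI[of _ "1::real"] conjI) simp_all
  moreover have "0 \<cdot>\<^sub>v r \<in> {t \<cdot>\<^sub>v r | t. 0 \<le> t}"
    by (intro CollectI exI[of _ "0::real"] conjI) simp_all
  ultimately show "r \<in> {x - y | x y. x \<in> {t \<cdot>\<^sub>v r | t. 0 \<le> t} \<and> y \<in> {t \<cdot>\<^sub>v r | t. 0 \<le> t}}"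
    by blast
  fix x y assume "x \<in> {t \<cdot>\<^sub>v r | t. 0 \<le> t}" "y \<in> {t \<cdot>\<^sub>v r | t. 0 \<le> t}"
  then obtain s t where "x = s \<cdot>\<^sub>v r" "y = t \<cdot>\<^sub>v r" by auto
  then have "x - y = (s - t) \<cdot>\<^sub>v r" using r(1) by (auto simp: vec_eq_iff algebra_simps)
  then show "\<exists>c. x - y = c \<cdot>\<^sub>v r" by blast
qed

lemma polyhedral_cone_iff:
  assumes A: "A \<in> carrier_mat m n"
  shows "x \<in> polyhedral_cone A \<longleftrightarrow> x \<in> carrier_vec n \<and> (\<forall>a \<in> set (rows A). 0 \<le> real_vec a \<bullet> x)"
proof -
  have "row (real_mat A) i = real_vec (row A i)" if "i < m" for i
    using that A by (intro eq_vecI) auto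
  then show ?thesis
    using A by (auto simp: polyhedral_cone_def less_eq_vec_def rows_def)
qed

text \<open>With a unit vector on top, \<open>n - 1\<close> rows with a nonzero cross product become nonsingular.\<close>

lemma kernel_line:
  fixes x :: "real vec" and c :: "int vec"
  assumes qs: "length qs + 1 = n" "set qs \<subseteq> carrier_vec n" and c: "c = cross_vec n qs \<or> c = - cross_vec n qs"
    and j: "j < n" "c $ j \<noteq> 0"
    and x: "x \<in> carrier_vec n" "\<And>a. a \<in> set qs \<Longrightarrow> real_vec a \<bullet> x = 0"
  shows "x = (x $ j / real_of_int (c $ j)) \<cdot>\<^sub>v real_vec c"
proof -
  have cc: "c \<in> carrier_vec n" using c by auto
  let ?xs = "unit_vec n j # qs"
  have xsc: "set ?xs \<subseteq> carrier_vec n" using qs(2) by simp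
  have "cross_vec n qs $ j \<noteq> 0" using c j by auto
  then have "det_rows n ?xs \<noteq> 0" using cross_vec_component[OF qs(1) j(1)] by simp
  moreover have "det_rows n (map real_vec ?xs) = real_of_int (det_rows n ?xs)"
    unfolding det_rows_def mat_of_rows_map[OF xsc] by simp
  ultimately have d: "det_rows n (map real_vec ?xs) \<noteq> 0" by simp
  define t where "t = x $ j / real_of_int (c $ j)"
  have "x - t \<cdot>\<^sub>v real_vec c = 0\<^sub>v n"
  proof (rule det_rows_kernel[OF d])
    show "set (map real_vec ?xs) \<subseteq> carrier_vec n" using xsc by auto
    show "x - t \<cdot>\<^sub>v real_vec c \<in> carrier_vec n" using x(1) cc by simp
    fix b assume "b \<in> set (map real_vec ?xs)"
    then consider "b = real_vec (unit_vec n j)" | a where "a \<in> set qs" "b = real_vec a" by auto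
    then show "b \<bullet> (x - t \<cdot>\<^sub>v real_vec c) = 0"
    proof cases
      case 1
      have "real_vec (unit_vec n j) = unit_vec n j" by (rule eq_vecI) (auto simp: unit_vec_def)
      then have "b \<bullet> (x - t \<cdot>\<^sub>v real_vec c) = (x - t \<cdot>\<^sub>v real_vec c) $ j"
        using 1 x(1) cc j(1) by (simp del: index_minus_vec)
      also have "\<dots> = 0" using x(1) cc j by (simp add: t_def)
      finally show ?thesis .
    next
      case 2
      have ac: "a \<in> carrier_vec n" using 2 qs(2) by auto
      have "a \<bullet> c = 0" using orthogonal_cross_vec[OF qs 2(1)] c ac by auto
      moreover have "real_vec a \<bullet> real_vec c = real_of_int (a \<bullet> c)"
        using ac cc by (simp add: scalar_prod_def)
      ultimately have "real_vec a \<bullet> real_vec c = 0" by simp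
      moreover have "real_vec a \<bullet> (x - t \<cdot>\<^sub>v real_vec c) = real_vec a \<bullet> x - real_vec a \<bullet> (t \<cdot>\<^sub>v real_vec c)"
        using ac cc x(1) by (intro scalar_prod_minus_distrib[of _ n]) auto
      moreover have "real_vec a \<bullet> (t \<cdot>\<^sub>v real_vec c) = t * (real_vec a \<bullet> real_vec c)"
        using ac cc by simp
      ultimately show ?thesis using x(2)[OF 2(1)] 2(2) by simp
    qed
  qed
  then have z: "(x - t \<cdot>\<^sub>v real_vec c) $ i = 0" if "i < n" for i using that by simp
  have "x $ i = (t \<cdot>\<^sub>v real_vec c) $ i" if "i < n" for i
    using z[OF that] that x(1) cc by simp
  then show ?thesis unfolding t_def[symmetric] using x(1) cc by (intro eq_vecI) auto
qed

text \<open>The sum of the rows \<open>qs\<close> is nonnegative on the cone and vanishes only where all of them vanish; it thus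
  exposes the ray through \<open>c\<close>.\<close>

lemma extreme_ray_of_ray_vector:
  assumes A: "A \<in> carrier_mat m n" and sp: "spanning n (set (rows A))"
    and c: "c \<in> ray_vectors n (set (rows A))" "c \<noteq> 0\<^sub>v n"
  shows "extreme_ray A {t \<cdot>\<^sub>v real_vec c | t. 0 \<le> t}"
proof -
  let ?F = "{t \<cdot>\<^sub>v real_vec c | t. 0 \<le> t}"
  have rowsc: "set (rows A) \<subseteq> carrier_vec n" using A rows_carrier by blast
  obtain qs where qs: "length qs + 1 = n" "set qs \<subseteq> set (rows A)" "c = cross_vec n qs \<or> c = - cross_vec n qs"
    using c by (auto simp: ray_vectors_def)
  have qsc: "set qs \<subseteq> carrier_vec n" using qs(2) rowsc by blast
  have cc: "c \<in> carrier_vec n" using c(1) by (rule ray_vectors_carrier)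
  obtain j where j: "j < n" "c $ j \<noteq> 0" using c(2) cc by (auto simp: vec_eq_iff)
  have ac0: "0 \<le> a \<bullet> c" if "a \<in> set (rows A)" for a using c(1) that by (simp add: ray_vectors_def in_cone_def)
  have rac: "real_vec a \<bullet> (t \<cdot>\<^sub>v real_vec c) = t * real_of_int (a \<bullet> c)" if "a \<in> carrier_vec n" for a t
  proof -
    have "real_vec a \<bullet> (t \<cdot>\<^sub>v real_vec c) = t * (real_vec a \<bullet> real_vec c)" using that cc by simp
    also have "real_vec a \<bullet> real_vec c = real_of_int (a \<bullet> c)" using that cc by (simp add: scalar_prod_def)
    finally show ?thesis .
  qed
  have aq0: "a \<bullet> c = 0" if "a \<in> set qs" for a
    using orthogonal_cross_vec[OF qs(1) qsc that] qs(3) qsc that by (auto simp: subset_iff)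
  define e where "e = vec n (\<lambda>i. \<Sum>a\<leftarrow>qs. real_of_int (a $ i))"
  have ex: "e \<bullet> x = (\<Sum>a\<leftarrow>qs. real_vec a \<bullet> x)" if x: "x \<in> carrier_vec n" for x
  proof -
    have "e \<bullet> x = (\<Sum>i = 0..<n. (\<Sum>a\<leftarrow>qs. real_of_int (a $ i)) * x $ i)"
      using x by (simp add: e_def scalar_prod_def)
    also have "\<dots> = (\<Sum>i = 0..<n. \<Sum>a\<leftarrow>qs. real_of_int (a $ i) * x $ i)" by (simp add: sum_list_mult_const)
    also have "\<dots> = (\<Sum>a\<leftarrow>qs. \<Sum>i = 0..<n. real_of_int (a $ i) * x $ i)"
      by (induction qs) (simp_all add: sum.distrib)
    also have "\<dots> = (\<Sum>a\<leftarrow>qs. real_vec a \<bullet> x)"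
    proof (rule arg_cong[of _ _ sum_list], rule map_cong[OF refl])
      fix a assume "a \<in> set qs"
      then have "dim_vec a = n" using qsc by auto
      then show "(\<Sum>i = 0..<n. real_of_int (a $ i) * x $ i) = real_vec a \<bullet> x" using x by (simp add: scalar_prod_def)
    qed
    finally show ?thesis .
  qed
  note cone = polyhedral_cone_iff[OF A]
  have "face n (polyhedral_cone A) ?F"
    unfolding face_def
  proof (intro bexI[of _ e] exI[of _ "0::real"] conjI ballI)
    show "e \<in> carrier_vec n" by (simp add: e_def)
    fix x assume "x \<in> polyhedral_cone A"
    then have x: "x \<in> carrier_vec n" "\<And>a. a \<in> set (rows A) \<Longrightarrow> 0 \<le> real_vec a \<bullet> x" by (auto simp: cone)
    show "0 \<le> e \<bullet> x" unfolding ex[OF x(1)] using x(2) qs(2) by (intro sum_list_nonneg) auto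
  next
    show "?F = {x \<in> polyhedral_cone A. e \<bullet> x = 0}"
    proof (intro equalityI subsetI)
      fix x assume "x \<in> ?F"
      then obtain t where t: "x = t \<cdot>\<^sub>v real_vec c" "0 \<le> t" by blast
      have xc: "x \<in> carrier_vec n" using t cc by simp
      have "0 \<le> real_vec a \<bullet> x" if "a \<in> set (rows A)" for a
        unfolding t(1) using rac[of a t] that rowsc ac0[OF that] t(2) by (auto simp: subset_iff)
      moreover have "e \<bullet> x = 0"
      proof -
        have "(\<Sum>a\<leftarrow>qs. real_vec a \<bullet> x) = (\<Sum>a\<leftarrow>qs. 0)"
          unfolding t(1) using rac aq0 qsc by (intro arg_cong[of _ _ sum_list] map_cong) auto
        then show ?thesis unfolding ex[OF xc] by simp
      qed
      ultimately show "x \<in> {x \<in> polyhedral_cone A. e \<bullet> x = 0}" using xc by (auto simp: cone)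
    next
      fix x assume "x \<in> {x \<in> polyhedral_cone A. e \<bullet> x = 0}"
      then have x: "x \<in> carrier_vec n" "\<And>a. a \<in> set (rows A) \<Longrightarrow> 0 \<le> real_vec a \<bullet> x" and e0: "e \<bullet> x = 0"
        by (auto simp: cone)
      have "\<forall>s\<in>set (map (\<lambda>a. real_vec a \<bullet> x) qs). 0 \<le> s" using x(2) qs(2) by auto
      then have "\<forall>s\<in>set (map (\<lambda>a. real_vec a \<bullet> x) qs). s = 0"
        using sum_list_nonneg_eq_0_iff[of "map (\<lambda>a. real_vec a \<bullet> x) qs"] e0 ex[OF x(1)] by auto
      then have q0: "real_vec a \<bullet> x = 0" if "a \<in> set qs" for a using that by auto
      define t where "t = x $ j / real_of_int (c $ j)"
      have xt: "x = t \<cdot>\<^sub>v real_vec c" unfolding t_def by (rule kernel_line[OF qs(1) qsc qs(3) j x(1) q0])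
      obtain a where a: "a \<in> set (rows A)" "a \<bullet> c \<noteq> 0" using sp cc c(2) by (metis spanning_def)
      have "0 \<le> t * real_of_int (a \<bullet> c)" using x(2)[OF a(1)] rac[of a t] a(1) rowsc xt by auto
      moreover have "0 < real_of_int (a \<bullet> c)" using ac0[OF a(1)] a(2) by simp
      ultimately have "0 \<le> t" by (simp add: zero_le_mult_iff)
      then show "x \<in> ?F" using xt by blast
    qed
  qed
  moreover have "vec_space.affine_dim n ?F = 1"
  proof (rule affine_dim_ray)
    show "real_vec c \<in> carrier_vec n" using cc by simp
    show "real_vec c \<noteq> 0\<^sub>v n"
    proof
      assume "real_vec c = 0\<^sub>v n"
      then have "real_vec c $ j = 0\<^sub>v n $ j" by (rule arg_cong)
      then show False using j cc by simp
    qed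
  qed
  ultimately show ?thesis using A by (simp add: extreme_ray_def)
qed

text \<open>Both \<open>c\<close> and the vector of minors \<open>v\<close> of an index set \<open>I\<close> with maximal gcd lie on the same line, and the ratio of
  their lengths is the ratio of the gcds. Hence \<open>c\<close> is at most as long as the normalized generator.\<close>

lemma ray_vector_in_normalized_hull:
  assumes A: "A \<in> carrier_mat m n" and sp: "spanning n (set (rows A))"
    and c: "c \<in> ray_vectors n (set (rows A))"
  shows "real_vec c \<in> conv n (insert (0\<^sub>v n) (normalized_generators A))"
proof (cases "c = 0\<^sub>v n")
  case True
  then have z: "real_vec c = 0\<^sub>v n" by auto
  show ?thesis unfolding z by (rule conv_member) auto
next
  case False
  let ?F = "{t \<cdot>\<^sub>v real_vec c | t. 0 \<le> t}"
  have rowsc: "set (rows A) \<subseteq> carrier_vec n" using A rows_carrier by blast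
  have cc: "c \<in> carrier_vec n" using c(1) by (rule ray_vectors_carrier)
  have dimA: "dim_row A = m" "dim_col A = n" using A by auto
  obtain I0 where I0: "I0 \<subseteq> {..<m}" "card I0 + 1 = n" "c = minor_vec A I0 \<or> c = - minor_vec A I0"
    using ray_vector_minor_vec[OF A c False] by metis
  have sel: "submatrix A I UNIV = mat_of_rows n (selected_rows A I)" if "I \<subseteq> {..<m}" for I
  proof -
    have "submatrix A I UNIV = submatrix A I {..<n}"
      unfolding submatrix_def dimA by (rule cong_mat) (auto simp: pick_UNIV pick_lessThan)
    then show ?thesis using submatrix_all_columns[of I A] that dimA by simp
  qed
  have kill: "real_mat (submatrix A I UNIV) *\<^sub>v x = 0\<^sub>v (n - 1) \<longleftrightarrow> (\<forall>a\<in>set (selected_rows A I). real_vec a \<bullet> x = 0)"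
    if I: "I \<subseteq> {..<m}" "card I + 1 = n" for I x
  proof -
    have len: "length (selected_rows A I) = n - 1" using I by simp
    have sc: "set (selected_rows A I) \<subseteq> carrier_vec n" using set_selected_rows(2)[of I A] I rowsc dimA by auto
    have "row (real_mat (submatrix A I UNIV)) k = real_vec (selected_rows A I ! k)" if "k < n - 1" for k
    proof -
      have "selected_rows A I ! k \<in> carrier_vec n" using that len sc by (metis nth_mem subsetD)
      then show ?thesis using that len unfolding sel[OF I(1)] by (intro eq_vecI) (auto simp: mat_of_rows_index)
    qed
    then have "real_mat (submatrix A I UNIV) *\<^sub>v x = vec (n - 1) (\<lambda>k. real_vec (selected_rows A I ! k) \<bullet> x)"
      unfolding mult_mat_vec_def using len sel[OF I(1)] by (intro eq_vecI) auto
    then show ?thesis using len by (auto simp: vec_eq_iff all_set_conv_all_nth)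
  qed
  define R where "R = ray_index_sets A ?F"
  have Rsub: "I \<subseteq> {..<m}" "card I + 1 = n" if "I \<in> R" for I
    using that I0(2) by (auto simp: R_def ray_index_sets_def dimA)
  have "finite R" by (rule finite_subset[of _ "Pow {..<m}"]) (use Rsub in auto)
  have I0R: "I0 \<in> R"
    unfolding R_def ray_index_sets_def dimA
  proof (intro CollectI conjI ballI)
    show "I0 \<subseteq> {..<m}" "card I0 = n - 1" using I0 by auto
    have "minor_vec A I0 \<noteq> 0\<^sub>v n" using I0(3) False by auto
    then show "vec_space.rank (n - 1) (real_mat (submatrix A I0 UNIV)) = n - 1"
      using rank_of_nonzero_minor_vec[of I0 A] I0 dimA by simp
    fix x assume "x \<in> ?F"
    then obtain t where t: "x = t \<cdot>\<^sub>v real_vec c" by blast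
    have "real_vec a \<bullet> x = 0" if a: "a \<in> set (selected_rows A I0)" for a
    proof -
      have sc: "set (selected_rows A I0) \<subseteq> carrier_vec n" using set_selected_rows(2)[of I0 A] I0 rowsc dimA by auto
      have ac: "a \<in> carrier_vec n" using a sc by blast
      have "a \<bullet> cross_vec n (selected_rows A I0) = 0"
        by (rule orthogonal_cross_vec[OF _ sc a]) (use I0 in simp)
      then have "a \<bullet> c = 0" using I0(3) minor_vec_cross_vec[of I0 A] I0(1,2) dimA ac by auto
      moreover have "real_vec a \<bullet> real_vec c = real_of_int (a \<bullet> c)" using ac cc by (simp add: scalar_prod_def)
      ultimately show ?thesis unfolding t using ac cc by simp
    qed
    then show "real_mat (submatrix A I0 UNIV) *\<^sub>v x = 0\<^sub>v (n - 1)" using kill[OF I0(1,2)] by blast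
  qed
  define gm where "gm I = gcd_mat (submatrix A I UNIV)" for I
  have "Max (gm ` R) \<in> gm ` R" using \<open>finite R\<close> I0R by (intro Max_in) auto
  then obtain I where I: "I \<in> R" "gm I = Max (gm ` R)" by auto
  have max: "gm I' \<le> gm I" if "I' \<in> R" for I' unfolding I(2) using that \<open>finite R\<close> by simp
  define v where "v = minor_vec A I"
  have vc: "v \<in> carrier_vec n" by (simp add: v_def minor_vec_def dimA)
  have gI: "gm I = Gcd ((\<lambda>i. v $ i) ` {..<n})"
    unfolding gm_def v_def using gcd_mat_minor_vec[of I A] Rsub[OF I(1)] dimA by simp
  have gI0: "gm I0 = Gcd ((\<lambda>i. c $ i) ` {..<n})"
  proof -
    have "gm I0 = Gcd ((\<lambda>i. minor_vec A I0 $ i) ` {..<n})"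
      unfolding gm_def using gcd_mat_minor_vec[of I0 A] I0 dimA by simp
    moreover have "Gcd ((\<lambda>i. minor_vec A I0 $ i) ` {..<n}) = Gcd ((\<lambda>i. c $ i) ` {..<n})"
    proof -
      have mc: "minor_vec A I0 \<in> carrier_vec n" by (simp add: minor_vec_def dimA)
      have "b dvd minor_vec A I0 $ i \<longleftrightarrow> b dvd c $ i" if "i < n" for b i
        using I0(3) mc that by auto
      moreover have "Gcd ((\<lambda>i. u $ i) ` {..<n}) dvd Gcd ((\<lambda>i. w $ i) ` {..<n})"
        if dvd: "\<And>b i. i < n \<Longrightarrow> b dvd u $ i \<longleftrightarrow> b dvd w $ i" for u w :: "int vec"
      proof (rule Gcd_greatest)
        fix b assume "b \<in> (\<lambda>i. w $ i) ` {..<n}"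
        then obtain i where i: "i < n" "b = w $ i" by auto
        have "Gcd ((\<lambda>i. u $ i) ` {..<n}) dvd u $ i" using i(1) by (intro Gcd_dvd) simp
        then show "Gcd ((\<lambda>i. u $ i) ` {..<n}) dvd b" using dvd[OF i(1)] i(2) by simp
      qed
      ultimately have "Gcd ((\<lambda>i. minor_vec A I0 $ i) ` {..<n}) dvd Gcd ((\<lambda>i. c $ i) ` {..<n})"
        "Gcd ((\<lambda>i. c $ i) ` {..<n}) dvd Gcd ((\<lambda>i. minor_vec A I0 $ i) ` {..<n})"
        by blast+
      then show ?thesis by (intro zdvd_antisym_nonneg) auto
    qed
    ultimately show ?thesis by simp
  qed
  have g0pos: "0 < gm I0"
  proof -
    have "gm I0 \<noteq> 0"
    proof
      assume "gm I0 = 0"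
      then have "\<forall>i<n. c $ i = 0" unfolding gI0 by (auto simp: Gcd_0_iff)
      then show False using False cc by auto
    qed
    moreover have "0 \<le> gm I0" unfolding gI0 by simp
    ultimately show ?thesis by simp
  qed
  then have gIpos: "0 < gm I" using max[OF I0R] by simp
  have "v \<noteq> 0\<^sub>v n"
  proof
    assume "v = 0\<^sub>v n"
    then have "(\<lambda>i. v $ i) ` {..<n} \<subseteq> {0}" by auto
    then have "gm I = 0" unfolding gI by (simp only: Gcd_0_iff)
    then show False using gIpos by simp
  qed
  then obtain j where j: "j < n" "v $ j \<noteq> 0" using vc by (auto simp: vec_eq_iff)
  have selc: "set (selected_rows A I) \<subseteq> carrier_vec n" using set_selected_rows(2)[of I A] Rsub[OF I(1)] rowsc dimA by auto
  have v_cross: "v = cross_vec n (selected_rows A I)"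
    unfolding v_def using minor_vec_cross_vec[of I A] Rsub[OF I(1)] dimA by simp
  have "real_vec c \<in> ?F" by (intro CollectI exI[of _ "1::real"]) simp
  then have "real_mat (submatrix A I UNIV) *\<^sub>v real_vec c = 0\<^sub>v (n - 1)"
    using I(1) unfolding R_def ray_index_sets_def dimA by blast
  then have q0: "real_vec a \<bullet> real_vec c = 0" if "a \<in> set (selected_rows A I)" for a
    using kill[OF Rsub[OF I(1)]] that by blast
  have eqc: "real_vec c = (real_vec c $ j / real_of_int (v $ j)) \<cdot>\<^sub>v real_vec v"
    by (rule kernel_line[OF _ selc _ j _ q0]) (use Rsub[OF I(1)] v_cross cc in auto)
  have par: "real_of_int (v $ j) * real_of_int (c $ i) = real_of_int (c $ j) * real_of_int (v $ i)" if i: "i < n" for i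
  proof -
    have "real_vec c $ i = ((real_vec c $ j / real_of_int (v $ j)) \<cdot>\<^sub>v real_vec v) $ i"
      using eqc by (rule arg_cong)
    then have "real_of_int (c $ i) = real_of_int (c $ j) / real_of_int (v $ j) * real_of_int (v $ i)"
      using i j(1) cc vc by simp
    then show ?thesis using j(2) by simp
  qed
  have par': "v $ j * c $ i = c $ j * v $ i" if "i < n" for i
  proof -
    have "real_of_int (v $ j * c $ i) = real_of_int (c $ j * v $ i)" using par[OF that] by simp
    then show ?thesis by (simp only: of_int_eq_iff)
  qed
  have cj: "c $ j \<noteq> 0"
  proof
    assume "c $ j = 0"
    then have "c $ i = 0" if "i < n" for i using par'[OF that] j by simp
    then show False using False cc by auto
  qed
  have "\<bar>v $ j\<bar> * gm I0 = \<bar>c $ j\<bar> * gm I"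
  proof -
    have "(\<lambda>i. v $ j * c $ i) ` {..<n} = (\<lambda>i. c $ j * v $ i) ` {..<n}" using par' by (intro image_cong) auto
    moreover have "Gcd ((\<lambda>i. v $ j * c $ i) ` {..<n}) = \<bar>v $ j\<bar> * Gcd ((\<lambda>i. c $ i) ` {..<n})"
      using Gcd_mult[of "v $ j" "(\<lambda>i. c $ i) ` {..<n}"] by (simp add: image_image abs_mult)
    moreover have "Gcd ((\<lambda>i. c $ j * v $ i) ` {..<n}) = \<bar>c $ j\<bar> * Gcd ((\<lambda>i. v $ i) ` {..<n})"
      using Gcd_mult[of "c $ j" "(\<lambda>i. v $ i) ` {..<n}"] by (simp add: image_image abs_mult)
    ultimately show ?thesis unfolding gI gI0 by simp
  qed
  then have "\<bar>c $ j\<bar> * gm I0 \<le> \<bar>v $ j\<bar> * gm I0" using mult_left_mono[OF max[OF I0R], of "\<bar>c $ j\<bar>"] by simp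
  then have le: "\<bar>c $ j\<bar> \<le> \<bar>v $ j\<bar>" using g0pos by simp
  define \<tau> where "\<tau> = \<bar>real_of_int (v $ j)\<bar> / \<bar>real_of_int (c $ j)\<bar>"
  have "\<bar>real_of_int (c $ j)\<bar> \<le> \<bar>real_of_int (v $ j)\<bar>" using le by linarith
  then have \<tau>1: "1 \<le> \<tau>" using cj by (simp add: \<tau>_def)
  define r where "r = (if 0 < v $ j * c $ j then real_vec v else - real_vec v)"
  have "r = \<tau> \<cdot>\<^sub>v real_vec c"
  proof (rule eq_vecI)
    fix i assume "i < dim_vec (\<tau> \<cdot>\<^sub>v real_vec c)"
    then have i: "i < n" using cc by simp
    have ri: "r $ i = (if 0 < v $ j * c $ j then real_of_int (v $ i) else - real_of_int (v $ i))"
      using i vc by (simp add: r_def)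
    define \<rho> where "\<rho> = real_of_int (v $ j) / real_of_int (c $ j)"
    have vi: "real_of_int (v $ i) = \<rho> * real_of_int (c $ i)"
      using par[OF i] cj by (simp add: \<rho>_def field_simps)
    have "(0 < v $ j * c $ j) = (0 < \<rho>)" by (simp add: \<rho>_def zero_less_divide_iff zero_less_mult_iff)
    moreover have "\<tau> = \<bar>\<rho>\<bar>" by (simp add: \<tau>_def \<rho>_def)
    ultimately have "r $ i = \<tau> * real_of_int (c $ i)" unfolding ri vi by simp
    then show "r $ i = (\<tau> \<cdot>\<^sub>v real_vec c) $ i" using i cc by simp
  qed (use vc cc in \<open>auto simp: r_def\<close>)
  then have rF: "r \<in> ?F" using \<tau>1 by (intro CollectI exI[of _ \<tau>]) simp
  have er: "extreme_ray A ?F" by (rule extreme_ray_of_ray_vector[OF A sp c False])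
  have "r = real_vec (minor_vec A I) \<or> r = - real_vec (minor_vec A I)" by (simp add: r_def v_def)
  then have "r \<in> normalized_generators A"
    unfolding normalized_generators_def using er rF I(1)[unfolded R_def] max[unfolded R_def gm_def] by blast
  moreover have "r \<in> carrier_vec n" using vc by (simp add: r_def)
  ultimately have rconv: "r \<in> conv n (insert (0\<^sub>v n) (normalized_generators A))" by (intro conv_member) auto
  show ?thesis
  proof (rule conv_combination[of "{()}" "\<lambda>_. 1 / \<tau>" "\<lambda>_. r"])
    show "real_vec c $ i = (\<Sum>\<kappa>\<in>{()}. 1 / \<tau> * r $ i)" if "i < n" for i
      unfolding \<open>r = \<tau> \<cdot>\<^sub>v real_vec c\<close> using that cc \<tau>1 by simp
  qed (use \<tau>1 cc rconv in simp_all)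
qed

section \<open>The Hilbert basis lies in the hull of the normalized generators\<close>

text \<open>The integral points of the polyhedral cone are the integer vectors in the cone of the rows.\<close>

lemma hilbert_basis_element_irreducible:
  assumes A: "A \<in> carrier_mat m n" and h: "hilbert_basis_element A (integer_lattice n) h"
  obtains h' where "h = real_vec h'" "irreducible_in_cone n (set (rows A)) h'"
proof -
  note cone = polyhedral_cone_iff[OF A]
  have dimA: "dim_col A = n" using A by simp
  have cone_int: "real_vec z \<in> polyhedral_cone A \<longleftrightarrow> in_cone (set (rows A)) z" if z: "z \<in> carrier_vec n" for z
  proof -
    have "real_vec a \<bullet> real_vec z = real_of_int (a \<bullet> z)" if "a \<in> set (rows A)" for a
      using that z A by (auto simp: rows_def scalar_prod_def)
    then show ?thesis using z by (auto simp: cone in_cone_def)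
  qed
  have inj: "x = y" if "real_vec x = real_vec y" "x \<in> carrier_vec n" "y \<in> carrier_vec n" for x y
    using that by (auto simp: vec_eq_iff)
  have zero: "real_vec (0\<^sub>v n) = 0\<^sub>v n" by auto
  obtain h' where h': "h = real_vec h'" "h' \<in> carrier_vec n"
    using h by (auto simp: hilbert_basis_element_def integer_lattice_def)
  have "irreducible_in_cone n (set (rows A)) h'"
    unfolding irreducible_in_cone_def
  proof (intro conjI ballI impI)
    show "h' \<in> carrier_vec n" by (rule h'(2))
    show "h' \<noteq> 0\<^sub>v n" using h h'(1) zero dimA by (auto simp: hilbert_basis_element_def)
    show "in_cone (set (rows A)) h'" using h h' cone_int by (auto simp: hilbert_basis_element_def)
    fix z :: "int vec" assume z: "z \<in> carrier_vec n" "in_cone (set (rows A)) z \<and> in_cone (set (rows A)) (h' - z)"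
    have dc: "h' - z \<in> carrier_vec n" using z(1) h'(2) by simp
    have "real_vec z \<in> polyhedral_cone A \<inter> integer_lattice n"
      "real_vec (h' - z) \<in> polyhedral_cone A \<inter> integer_lattice n"
      using z dc cone_int by (auto simp: integer_lattice_def)
    moreover have "h = real_vec z + real_vec (h' - z)" unfolding h'(1) using z(1) h'(2) by auto
    ultimately have "real_vec z = 0\<^sub>v n \<or> real_vec (h' - z) = 0\<^sub>v n"
      using h dimA unfolding hilbert_basis_element_def by blast
    then show "z = 0\<^sub>v n \<or> z = h'"
    proof
      assume "real_vec z = 0\<^sub>v n"
      then show ?thesis using inj[of z "0\<^sub>v n"] z(1) zero by simp
    next
      assume "real_vec (h' - z) = 0\<^sub>v n"
      then have "h' - z = 0\<^sub>v n" using inj[OF _ dc, of "0\<^sub>v n"] zero by simp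
      then have "(h' - z) $ i = 0" if "i < n" for i using that by simp
      then have "h' $ i = z $ i" if "i < n" for i using that z(1) h'(2) by fastforce
      then show ?thesis using z(1) h'(2) by (auto simp: vec_eq_iff)
    qed
  qed
  then show ?thesis using that h'(1) by blast
qed

text \<open>A zero row among \<open>qs\<close> makes the cross product vanish.\<close>

lemma ray_vectors_insert_zero:
  "ray_vectors n (insert (0\<^sub>v n) S) \<subseteq> insert (0\<^sub>v n) (ray_vectors n S)"
proof
  fix c assume c: "c \<in> ray_vectors n (insert (0\<^sub>v n) S)"
  then obtain qs where qs: "length qs + 1 = n" "set qs \<subseteq> insert (0\<^sub>v n) S" "c = cross_vec n qs \<or> c = - cross_vec n qs"
    and cone: "in_cone (insert (0\<^sub>v n) S) c" by (auto simp: ray_vectors_def)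
  show "c \<in> insert (0\<^sub>v n) (ray_vectors n S)"
  proof (cases "0\<^sub>v n \<in> set qs")
    case True
    then obtain us vs where uv: "qs = us @ 0\<^sub>v n # vs" by (meson split_list)
    have "det_rows n (unit_vec n j # qs) = 0" if "j < n" for j
    proof -
      let ?us = "unit_vec n j # us"
      have "det_rows n (0\<^sub>v n # ?us @ vs) = 0\<^sub>v n \<bullet> cross_vec n (?us @ vs)"
        by (rule det_rows_Cons) (use qs(1) uv in auto)
      also have "\<dots> = 0" by (rule scalar_prod_left_zero) simp
      finally show ?thesis using det_rows_move[of n "[]" ?us "0\<^sub>v n" vs] uv by simp
    qed
    then have "cross_vec n qs = 0\<^sub>v n" using cross_vec_component[OF qs(1)] by (intro eq_vecI) auto
    then show ?thesis using qs(3) by auto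
  next
    case False
    then show ?thesis using qs cone by (auto simp: ray_vectors_def in_cone_def)
  qed
qed

theorem theorem1p1:
  fixes A :: "int mat" and m n :: nat
  assumes "A \<in> carrier_mat m n" and "n \<le> m"
    and "vec_space.rank m (real_mat A) = n"
    and "m \<le> n + 1 \<or>
      (\<exists>k::int. k \<ge> 1 \<and> minors A n \<subseteq> {0, k, - k, 2 * k, - 2 * k})"
  shows "SHC A"
  unfolding SHC_def
proof (intro allI impI)
  fix h assume h: "hilbert_basis_element A (integer_lattice (dim_col A)) h"
  note A = assms(1)
  have dimA: "dim_col A = n" using A by simp
  let ?S = "set (rows A)"
  have S: "?S \<subseteq> carrier_vec n" "finite ?S" using A rows_carrier by (blast, simp)
  have sp: "spanning n ?S" by (rule full_column_rank_spanning[OF A assms(3)])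
  obtain h' where h': "h = real_vec h'" "irreducible_in_cone n ?S h'"
    using hilbert_basis_element_irreducible[OF A] h dimA by metis
  have "h \<in> conv n (insert (0\<^sub>v n) (real_vec ` ray_vectors n ?S))"
    using assms(4)
  proof
    assume "\<exists>k::int. k \<ge> 1 \<and> minors A n \<subseteq> {0, k, - k, 2 * k, - 2 * k}"
    then obtain k :: int where "k \<ge> 1" "minors A n \<subseteq> {0, k, - k, 2 * k, - 2 * k}" by blast
    then show ?thesis
      unfolding h'(1) by (intro hull_of_bimodular_cone[OF S sp _ _ h'(2), of k] det_rows_of_minors[OF A])
  next
    assume "m \<le> n + 1"
    then consider "m = n + 1" | "m = n" using assms(2) by linarith
    then show ?thesis
    proof cases
      case 1
      then have "length (rows A) = Suc n" using A by simp
      from hull_of_corank_one_cone[OF this S(1) sp h'(2)] show ?thesis unfolding h'(1) .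
    next
      case 2
      \<comment> \<open>A zero row turns the simplicial case into the case of \<open>n + 1\<close> rows.\<close>
      let ?rs = "rows A @ [0\<^sub>v n]"
      have len: "length ?rs = Suc n" using 2 A by simp
      have rs: "set ?rs = insert (0\<^sub>v n) ?S" by simp
      have cone: "in_cone (insert (0\<^sub>v n) ?S) x \<longleftrightarrow> in_cone ?S x" if "x \<in> carrier_vec n" for x
        using that by (auto simp: in_cone_def)
      have "set ?rs \<subseteq> carrier_vec n" using S by simp
      moreover have "spanning n (set ?rs)" using sp unfolding spanning_def rs by blast
      moreover have "irreducible_in_cone n (set ?rs) h'"
        using h'(2) unfolding irreducible_in_cone_def rs by (auto simp: cone)
      ultimately have hull: "real_vec h' \<in> conv n (insert (0\<^sub>v n) (real_vec ` ray_vectors n (insert (0\<^sub>v n) ?S)))"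
        using hull_of_corank_one_cone[OF len] rs by simp
      show ?thesis
        unfolding h'(1)
      proof (rule conv_insert_zero_mono[OF _ hull])
        fix x assume "x \<in> real_vec ` ray_vectors n (insert (0\<^sub>v n) ?S)"
        then obtain c where c: "c \<in> ray_vectors n (insert (0\<^sub>v n) ?S)" "x = real_vec c" by blast
        have "real_vec (0\<^sub>v n) = 0\<^sub>v n" by auto
        then have "x \<in> insert (0\<^sub>v n) (real_vec ` ray_vectors n ?S)"
          using c ray_vectors_insert_zero[of n ?S] by auto
        moreover have "x \<in> carrier_vec n" using c ray_vectors_carrier by auto
        ultimately show "x \<in> conv n (insert (0\<^sub>v n) (real_vec ` ray_vectors n ?S))" by (rule conv_member)
      qed
    qed
  qed
  then have "h \<in> conv n (insert (0\<^sub>v n) (normalized_generators A))"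
    by (rule conv_insert_zero_mono[rotated]) (use ray_vector_in_normalized_hull[OF A sp] in auto)
  then show "h \<in> conv (dim_col A) (insert (0\<^sub>v (dim_col A)) (normalized_generators A))" by (simp add: dimA)
qed

end
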